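(* Let $N$ be a Poisson point process of unit rate in the sector $\{(t,x):0\le t\le x<\infty\}$. Let $\beta^*=0.760660\cdots$ be the unique positive solution $z$ of $$\int_0^{\sqrt{2z}}\int_0^u e^{(u^2-v^2)/2}\,\mathrm dv\,\mathrm du=1 .$$ Then the stopping strategy that stops at the first record $(t,x)$ of $N$ with $x\le t+\sqrt{2\beta^*}$ is optimal among all admissible strategies for maximising the probability of stopping at the last record (the atom with the minimal mark), and the optimal success probability is $$e^{-\beta^*}+\left(e^{\beta^*}\frac{\sqrt\pi}{2\sqrt{\beta^*}}\,\mathrm{erf}\bigl(\sqrt{\beta^*}\bigr)-1\right)\sqrt{\pi\beta^*}\;\mathrm{erfc}\bigl(\sqrt{\beta^*}\bigr)=0.703128\cdots .$$ Moreover, this number is the limit as $n\to\infty$ of the optimal best-choice probability $v_n=\sup_\tau\mathbb P(X_\tau=\min\{X_1,\dots,X_n\})$ in the triangular model, where $X_1,\dots,X_n$ are independent, $X_j$ is uniformly distributed on $\{j,\dots,n\}$, and $\tau$ ranges over stopping times adapted to the natural filtration of $X_1,\dots,X_n$.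
   Context: An atom $(t,x)$ of $N$ is read as mark $x$ arriving at time $t$. It is a record if no other atom of $N$ lies in $[0,t]\times[0,x]$, and it is the last record if, in addition, its mark is the smallest mark among all atoms of $N$. An admissible strategy is a stopping time, with respect to the filtration generated by the configuration of $N$-atoms with time coordinate in $[0,t]$, $t\ge0$, which takes values in the random set of record times or makes no choice (no choice counts as failure). Notation: $\mathrm{erf}(x)=\frac2{\sqrt\pi}\int_0^xe^{-t^2}\,\mathrm dt$ and $\mathrm{erfc}(x)=\frac2{\sqrt\pi}\int_x^\infty e^{-t^2}\,\mathrm dt$. *)

theory Defs
  imports "HOL-Probability.Probability"
begin

section \<open>Error functions and the constant\<close>

definition erf :: "real \<Rightarrow> real" where
  "erf x = 2 / sqrt pi * (LBINT t=0..x. exp (- t\<^sup>2))"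

definition erfc :: "real \<Rightarrow> real" where
  "erfc x = 2 / sqrt pi * (LBINT t=x..\<infinity>. exp (- t\<^sup>2))"

definition solves_beta :: "real \<Rightarrow> bool" where
  "solves_beta z \<longleftrightarrow> 0 < z \<and>
     (LBINT u=0..sqrt (2 * z). (LBINT v=0..u. exp ((u\<^sup>2 - v\<^sup>2) / 2))) = 1"

definition beta_star :: real where
  "beta_star = (THE z. solves_beta z)"

definition optimal_value :: real where
  "optimal_value =
     exp (- beta_star)
     + (exp beta_star * (sqrt pi / (2 * sqrt beta_star)) * erf (sqrt beta_star) - 1)
       * sqrt (pi * beta_star) * erfc (sqrt beta_star)"

section \<open>Poisson point processes in the plane\<close>

text \<open>
  A realisation is a locally finite set of atoms; since the intensity measure is diffuse, the
  process is simple, so that sets (rather than counting measures) suffice. Counts are only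
  considered on bounded Borel sets, where they are finite. The probabilities are written out
  because the library's \<open>poisson_pmf\<close> excludes the rate 0, which occurs for null sets.
\<close>

definition unit_poisson_process ::
    "'w measure \<Rightarrow> (real \<times> real) set \<Rightarrow> ('w \<Rightarrow> (real \<times> real) set) \<Rightarrow> bool" where
  "unit_poisson_process M S N \<longleftrightarrow>
     prob_space M
     \<and> (\<forall>w\<in>space M. N w \<subseteq> S \<and> (\<forall>B. bounded B \<longrightarrow> finite (N w \<inter> B)))
     \<and> (\<forall>B\<in>sets borel. bounded B \<longrightarrow>
          (\<lambda>w. card (N w \<inter> B)) \<in> M \<rightarrow>\<^sub>M count_space UNIV
          \<and> (\<forall>k. measure M {w \<in> space M. card (N w \<inter> B) = k} =
                   measure lborel (B \<inter> S) ^ k / fact k * exp (- measure lborel (B \<inter> S))))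
     \<and> (\<forall>(I :: nat set) B. finite I \<and> disjoint_family_on B I
            \<and> (\<forall>i\<in>I. B i \<in> sets borel \<and> bounded (B i)) \<longrightarrow>
          prob_space.indep_vars M (\<lambda>_. count_space UNIV) (\<lambda>i w. card (N w \<inter> B i)) I)"

definition sector :: "(real \<times> real) set" where
  "sector = {(t, x). 0 \<le> t \<and> t \<le> x}"

section \<open>Records and stopping strategies\<close>

text \<open>An atom is a pair of an arrival time and a mark.\<close>

definition is_record :: "(real \<times> real) set \<Rightarrow> real \<times> real \<Rightarrow> bool" where
  "is_record A p \<longleftrightarrow> p \<in> A \<and> (\<forall>q\<in>A. q \<in> {0..fst p} \<times> {0..snd p} \<longrightarrow> q = p)"

definition is_last_record :: "(real \<times> real) set \<Rightarrow> real \<times> real \<Rightarrow> bool" where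
  "is_last_record A p \<longleftrightarrow> is_record A p \<and> (\<forall>q\<in>A. snd p \<le> snd q)"

definition record_times :: "(real \<times> real) set \<Rightarrow> real set" where
  "record_times A = {t. \<exists>x. is_record A (t, x)}"

text \<open>
  Time is extended-real valued so that \<open>\<infinity>\<close> can encode ``no choice''. At negative
  times the history is trivial.
\<close>

definition history :: "'w measure \<Rightarrow> ('w \<Rightarrow> (real \<times> real) set) \<Rightarrow> ereal \<Rightarrow> 'w measure" where
  "history M N s = sigma (space M)
     {{w \<in> space M. card (N w \<inter> B) = k} | B k.
        B \<in> sets borel \<and> bounded B \<and> B \<subseteq> {(t, x). 0 \<le> t \<and> ereal t \<le> s}}"

definition admissible ::
    "'w measure \<Rightarrow> ('w \<Rightarrow> (real \<times> real) set) \<Rightarrow> ('w \<Rightarrow> ereal) \<Rightarrow> bool" where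
  "admissible M N T \<longleftrightarrow>
     stopping_time (history M N) T
     \<and> (\<forall>w\<in>space M. T w \<in> ereal ` record_times (N w) \<union> {\<infinity>})"

text \<open>A time \<open>t\<close> carries at most one record, so the stopping time determines the chosen atom.\<close>

definition success_prob ::
    "'w measure \<Rightarrow> ('w \<Rightarrow> (real \<times> real) set) \<Rightarrow> ('w \<Rightarrow> ereal) \<Rightarrow> real" where
  "success_prob M N T =
     measure M {w \<in> space M. \<exists>t x. T w = ereal t \<and> is_last_record (N w) (t, x)}"

text \<open>The infimum is a minimum for locally finite sets of atoms in the sector, and
  \<open>Inf {} = \<infinity>\<close>.\<close>

definition first_record_below :: "real \<Rightarrow> (real \<times> real) set \<Rightarrow> ereal" where
  "first_record_below c A = Inf {ereal t | t x. is_record A (t, x) \<and> x \<le> t + c}"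

section \<open>The triangular model\<close>

definition triangular_model :: "'b measure \<Rightarrow> nat \<Rightarrow> (nat \<Rightarrow> 'b \<Rightarrow> nat) \<Rightarrow> bool" where
  "triangular_model P n X \<longleftrightarrow>
     prob_space P
     \<and> prob_space.indep_vars P (\<lambda>_. count_space UNIV) X {1..n}
     \<and> (\<forall>j\<in>{1..n}. distr P (count_space UNIV) (X j) = measure_pmf (pmf_of_set {j..n}))"

definition natural_filtration :: "'b measure \<Rightarrow> (nat \<Rightarrow> 'b \<Rightarrow> nat) \<Rightarrow> nat \<Rightarrow> 'b measure" where
  "natural_filtration P X k = sigma (space P) {X j -` A \<inter> space P | j A. j \<in> {1..k}}"

definition best_choice_value :: "'b measure \<Rightarrow> nat \<Rightarrow> (nat \<Rightarrow> 'b \<Rightarrow> nat) \<Rightarrow> real" where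
  "best_choice_value P n X =
     (SUP \<tau> \<in> {\<tau>. stopping_time (natural_filtration P X) \<tau> \<and> (\<forall>w\<in>space P. \<tau> w \<in> {1..n})}.
        measure P {w \<in> space P. X (\<tau> w) w = Min ((\<lambda>j. X j w) ` {1..n})})"

end

theory Submission
  imports Defs
begin

text \<open>
  Why the theorem is true. Let \<open>d\<close> be the distance between the running minimum of the marks and the
  current time. By invariance of the sector along the diagonal the future depends on the past only
  through \<open>d\<close>, and \<open>d\<close> never increases. A record at distance \<open>d\<close> is the last one iff the triangle with
  legs \<open>d\<close> below it is empty, which has probability \<open>no_lower d = exp (- d\<^sup>2 / 2)\<close>; stopping instead at the
  next record succeeds with probability \<open>no_lower d * advantage d\<close>. The factor \<open>advantage\<close> increases, so
  looking one record ahead says to stop iff \<open>d \<le> c\<close>, where \<open>advantage c = 1\<close>; for \<open>c = sqrt (2 * z)\<close> this is the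
  equation that defines \<open>beta_star\<close>. Since the states \<open>d \<le> c\<close> are never left again, this rule is optimal.
  The value \<open>V d\<close> of going on from distance \<open>d\<close> (the constant \<open>cont_value\<close>) solves
  \<open>V' d = F d - d * V d\<close>, where \<open>F\<close> (\<open>opt_int\<close>) is the integral of \<open>max (no_lower d) (V d)\<close>. Past \<open>c\<close> this is a
  Gaussian integral in closed form, and its limit at infinity is \<open>optimal_value\<close>.

  How it is proved. Both models are compared with one finite problem (locale \<open>slots\<close>): independent marks
  \<open>Y\<^sub>1, \<dots>, Y\<^sub>K\<close> with \<open>Y\<^sub>j\<close> nearly uniform of density \<open>h\<^sup>2\<close> on the integers above \<open>j\<close>. For the triangular model these
  are the variables themselves, with \<open>h = 1 / sqrt n\<close>. For the Poisson process the sector is cut into cells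
  of side \<open>h\<close>, and \<open>Y\<^sub>j\<close> is the lowest occupied cell of column \<open>j\<close>. Sampled on the grid, \<open>V\<close> satisfies the
  Bellman equation of the finite problem up to \<open>O(h\<^sup>2)\<close> (\<open>grid_step\<close>). There are \<open>O(1/h)\<close> steps, so backward
  induction bounds every stopping rule above (\<open>prob_stop_at_min_le\<close>) and the cutoff rule below
  (\<open>prob_cutoff_ge\<close>), each with error \<open>O(h)\<close>. Marks beyond a level \<open>L = K * h\<close> are ignored; letting first
  \<open>h \<rightarrow> 0\<close> and then \<open>L \<rightarrow> \<infinity>\<close> removes both errors.

  For the Poisson process an admissible strategy induces a stopping rule of the finite problem that
  succeeds whenever the strategy does, unless all marks exceed \<open>L\<close> (\<open>success_cases\<close>); this gives optimality.
  In the other direction, outside an event of small probability the cutoff rule on the cells and the rule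
  \<open>x \<le> t + c\<close> on the atoms pick the same atom (\<open>cutoff_success\<close>). For the triangular model both directions are
  immediate. The numerical bounds come from expanding \<open>exp (u\<^sup>2 / 2)\<close> times the integral of
  \<open>exp (- v\<^sup>2 / 2)\<close> in powers of \<open>u\<close>, with a remainder read off from its differential equation.
\<close>

section \<open>Gaussian integrals and the one-step advantage\<close>

text \<open>
  The interval integral is oriented, so the derivative exists at every real point; there is no one-sided
  case at the lower end \<open>0\<close>.
\<close>

lemma LBINT_has_derivative:
  fixes f :: "real \<Rightarrow> real"
  assumes f: "\<And>x. isCont f x"
  shows "((\<lambda>x. LBINT t=0..ereal x. f t) has_real_derivative f x) (at x)"
proof -
  obtain F where F: "\<And>x. (F has_vector_derivative f x) (at x)"
    using einterval_antiderivative[of "-\<infinity>" \<infinity> f] f by auto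
  have eq: "(LBINT t=0..ereal x. f t) = F x - F 0" for x
    using interval_integral_FTC_finite[of 0 x f F] f F
    by (auto simp: zero_ereal_def intro: has_vector_derivative_at_within
          continuous_at_imp_continuous_on)
  have "(F has_real_derivative f x) (at x)"
    using F by (simp add: has_real_derivative_iff_has_vector_derivative)
  then show ?thesis
    unfolding eq by (auto intro!: derivative_eq_intros)
qed

lemma DERIV_paste:
  fixes f g :: "real \<Rightarrow> real"
  assumes f: "\<And>x. (f has_real_derivative f' x) (at x)"
    and g: "\<And>x. (g has_real_derivative g' x) (at x)"
    and "f c = g c" "f' c = g' c"
  shows "((\<lambda>x. if x \<le> c then f x else g x) has_real_derivative (if x \<le> c then f' x else g' x)) (at x)"
proof -
  have "((\<lambda>x. if x \<in> {..c} then f x else g x) has_vector_derivative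
      (if x \<in> {..c} then f' x else g' x)) (at x within UNIV)"
    using f g assms(3,4)
    by (intro has_vector_derivative_If_within_closures[where T = "{c<..}"])
      (auto simp: has_real_derivative_iff_has_vector_derivative[symmetric]
         intro: has_field_derivative_at_within)
  then show ?thesis
    by (simp add: has_real_derivative_iff_has_vector_derivative)
qed

text \<open>
  Success probability when stopping at a record at distance \<open>d\<close>: the region that could still produce a
  smaller mark is a triangle of area \<open>d\<^sup>2 / 2\<close>.
\<close>

definition no_lower :: "real \<Rightarrow> real" where
  "no_lower d = exp (- (d\<^sup>2) / 2)"

definition gauss_int :: "real \<Rightarrow> real" where
  "gauss_int d = (LBINT t=0..ereal d. no_lower t)"

text \<open>
  Waiting for the next record wins with \<open>advantage d\<close> times the probability of winning by stopping now.
  In the double integral \<open>u\<close> is the distance that remains of \<open>d\<close> when the next record arrives and \<open>v\<close> is the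
  distance at which it arrives, so that \<open>exp (u\<^sup>2 / 2)\<close> undoes the part of the triangle not yet explored.
\<close>

definition advantage :: "real \<Rightarrow> real" where
  "advantage d = (LBINT u=0..ereal d. exp (u\<^sup>2 / 2) * gauss_int u)"

lemma no_lower_0 [simp]: "no_lower 0 = 1"
  by (simp add: no_lower_def)

lemma no_lower_pos [simp]: "0 < no_lower d"
  by (simp add: no_lower_def)

lemma no_lower_nonneg [simp]: "0 \<le> no_lower d"
  by (simp add: no_lower_def)

lemma no_lower_le_1 [simp]: "no_lower d \<le> 1"
  by (simp add: no_lower_def)

lemma exp_no_lower [simp]: "exp (d\<^sup>2 / 2) * no_lower d = 1"
  by (simp add: no_lower_def flip: exp_add)

lemma no_lower_less: "0 \<le> x \<Longrightarrow> x < y \<Longrightarrow> no_lower y < no_lower x"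
  by (simp add: no_lower_def power_strict_mono)

lemma no_lower_mono: "0 \<le> x \<Longrightarrow> x \<le> y \<Longrightarrow> no_lower y \<le> no_lower x"
  by (simp add: no_lower_def power_mono)

lemma DERIV_no_lower [derivative_intros]:
  "(f has_real_derivative f') (at x) \<Longrightarrow>
    ((\<lambda>x. no_lower (f x)) has_real_derivative (- f x * no_lower (f x) * f')) (at x)"
  unfolding no_lower_def by (auto intro!: derivative_eq_intros)

lemma gauss_int_0 [simp]: "gauss_int 0 = 0"
  by (simp add: gauss_int_def zero_ereal_def)

lemma advantage_0 [simp]: "advantage 0 = 0"
  by (simp add: advantage_def zero_ereal_def)

lemma DERIV_gauss_int: "(gauss_int has_real_derivative no_lower x) (at x)"
  unfolding gauss_int_def[abs_def]
  by (rule LBINT_has_derivative) (auto intro!: continuous_intros simp: no_lower_def)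

lemma DERIV_gauss_int' [derivative_intros]:
  "(f has_real_derivative f') (at x) \<Longrightarrow>
    ((\<lambda>x. gauss_int (f x)) has_real_derivative (no_lower (f x) * f')) (at x)"
  using DERIV_chain2[OF DERIV_gauss_int] .

lemma DERIV_advantage: "(advantage has_real_derivative exp (x\<^sup>2 / 2) * gauss_int x) (at x)"
  unfolding advantage_def[abs_def]
  by (rule LBINT_has_derivative)
    (auto intro!: continuous_intros DERIV_isCont[OF DERIV_gauss_int])

lemma DERIV_advantage' [derivative_intros]:
  "(f has_real_derivative f') (at x) \<Longrightarrow>
    ((\<lambda>x. advantage (f x)) has_real_derivative (exp ((f x)\<^sup>2 / 2) * gauss_int (f x) * f')) (at x)"
  using DERIV_chain2[OF DERIV_advantage] .

lemma gauss_int_less: "x < y \<Longrightarrow> gauss_int x < gauss_int y"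
  using DERIV_pos_imp_increasing[of x y gauss_int] DERIV_gauss_int no_lower_pos by blast

lemma gauss_int_mono: "x \<le> y \<Longrightarrow> gauss_int x \<le> gauss_int y"
  using gauss_int_less[of x y] by (cases "x = y") auto

lemma advantage_less: "0 \<le> x \<Longrightarrow> x < y \<Longrightarrow> advantage x < advantage y"
proof (rule DERIV_pos_imp_increasing_open[of x y advantage])
  fix t assume "0 \<le> x" "x < t" "t < y"
  then show "\<exists>z. (advantage has_real_derivative z) (at t) \<and> 0 < z"
    using DERIV_advantage[of t] gauss_int_less[of 0 t] by fastforce
qed (auto intro!: continuous_at_imp_continuous_on DERIV_isCont[OF DERIV_advantage])

lemma advantage_nonneg: "0 \<le> x \<Longrightarrow> 0 \<le> advantage x"
  using advantage_less[of 0 x] by (cases "x = 0") auto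

lemma advantage_mono: "0 \<le> x \<Longrightarrow> x \<le> y \<Longrightarrow> advantage x \<le> advantage y"
  using advantage_less[of x y] by (cases "x = y") auto

lemma solves_beta_iff: "solves_beta z \<longleftrightarrow> 0 < z \<and> advantage (sqrt (2 * z)) = 1"
proof -
  have "exp ((u\<^sup>2 - v\<^sup>2) / 2) = exp (u\<^sup>2 / 2) * no_lower v" for u v :: real
    by (simp add: no_lower_def diff_divide_distrib flip: exp_add)
  then have "(LBINT v=0..ereal u. exp ((u\<^sup>2 - v\<^sup>2) / 2)) = exp (u\<^sup>2 / 2) * gauss_int u" for u :: real
    unfolding gauss_int_def by simp
  then show ?thesis
    unfolding solves_beta_def advantage_def by simp
qed

text \<open>
  Error terms are needed only on bounded intervals and only up to constants, so compactness replaces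
  explicit derivative bounds throughout.
\<close>

lemma C1_lipschitz:
  fixes f :: "real \<Rightarrow> real"
  assumes f: "\<And>x. (f has_real_derivative f' x) (at x)" and c: "continuous_on {a..b} f'"
  obtains A where "0 < A" "\<And>x y. x \<in> {a..b} \<Longrightarrow> y \<in> {a..b} \<Longrightarrow> \<bar>f x - f y\<bar> \<le> A * \<bar>x - y\<bar>"
proof -
  have "bounded (f' ` {a..b})"
    by (intro compact_imp_bounded compact_continuous_image c) simp
  then obtain A where A: "0 < A" "\<And>x. x \<in> {a..b} \<Longrightarrow> norm (f' x) \<le> A"
    by (auto simp: bounded_pos)
  have "norm (f x - f y) \<le> A * norm (x - y)" if "x \<in> {a..b}" "y \<in> {a..b}" for x y
    by (rule field_differentiable_bound[where S = "{a..b}" and f' = f'])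
      (use that A f in \<open>auto intro: has_field_derivative_at_within\<close>)
  with A(1) show ?thesis
    by (intro that[of A]) auto
qed

text \<open>
  The distance \<open>c\<close> at which stopping and waiting for the next record are equally good.
\<close>

locale threshold =
  fixes c :: real
  assumes c_pos: "0 < c" and advantage_c: "advantage c = 1"
begin

text \<open>
  Beyond \<open>c\<close> the equation \<open>V' = F - d * V\<close> differentiates to \<open>V'' = - d * V'\<close>, hence \<open>V'\<close> is a multiple of
  \<open>no_lower\<close>; continuity of \<open>V'\<close> at \<open>c\<close> determines this factor.
\<close>

definition slope :: real where
  "slope = (gauss_int c - c * no_lower c) * exp (c\<^sup>2 / 2)"

definition cont_value :: "real \<Rightarrow> real" where
  "cont_value d = (if d \<le> c then no_lower d * advantage d
     else no_lower c + slope * (gauss_int d - gauss_int c))"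

definition opt_value :: "real \<Rightarrow> real" where
  "opt_value d = (if d \<le> c then no_lower d else cont_value d)"

definition opt_int :: "real \<Rightarrow> real" where
  "opt_int d = (if d \<le> c then gauss_int d else slope * no_lower d + d * cont_value d)"

lemma slope_no_lower: "slope * no_lower c = gauss_int c - c * no_lower c"
  using exp_no_lower[of c] by (simp add: slope_def mult.assoc)

lemma slope_pos: "0 < slope"
proof -
  have "c * no_lower c < gauss_int c"
  proof -
    have "\<exists>z. 0 < z \<and> z < c \<and> gauss_int c - gauss_int 0 = (c - 0) * no_lower z"
      by (rule MVT2) (auto simp: c_pos DERIV_gauss_int)
    then show ?thesis
      using no_lower_less[of _ c] c_pos by fastforce
  qed
  then show ?thesis by (simp add: slope_def)
qed

lemma opt_int_0 [simp]: "opt_int 0 = 0"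
  using c_pos by (simp add: opt_int_def)

lemma cont_value_0 [simp]: "cont_value 0 = 0"
  using c_pos by (simp add: cont_value_def)

text \<open>
  The Bellman equation in continuous time: the distance shrinks at rate one, and at rate \<open>d\<close> a record
  arrives at a uniform distance in \<open>[0, d]\<close> and offers \<open>opt_value\<close>. Smoothness at \<open>c\<close> holds because
  \<open>slope\<close> was chosen to match the two branches.
\<close>

lemma DERIV_cont_value:
  "(cont_value has_real_derivative opt_int x - x * cont_value x) (at x)"
proof -
  have eq: "opt_int x - x * cont_value x =
      (if x \<le> c then gauss_int x - x * (no_lower x * advantage x) else slope * no_lower x)"
    by (simp add: opt_int_def cont_value_def)
  show ?thesis
    unfolding eq
    unfolding cont_value_def[abs_def]
  proof (rule DERIV_paste)
    show "((\<lambda>d. no_lower d * advantage d) has_real_derivative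
        gauss_int x - x * (no_lower x * advantage x)) (at x)" for x
      using exp_no_lower[of x]
      by (auto intro!: derivative_eq_intros simp: algebra_simps)
  qed (use slope_no_lower advantage_c in \<open>auto intro!: derivative_eq_intros\<close>)
qed

lemma DERIV_opt_int: "(opt_int has_real_derivative opt_value x) (at x)"
proof -
  let ?v = "\<lambda>d. no_lower c + slope * (gauss_int d - gauss_int c)"
  have eq: "opt_int d = (if d \<le> c then gauss_int d else slope * no_lower d + d * ?v d)"
    "opt_value d = (if d \<le> c then no_lower d else ?v d)" for d
    by (auto simp: opt_int_def opt_value_def cont_value_def)
  show ?thesis
    unfolding eq[abs_def]
    by (rule DERIV_paste)
      (use slope_no_lower in \<open>auto intro!: derivative_eq_intros DERIV_gauss_int simp: algebra_simps\<close>)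
qed

lemmas cont_cont_value = DERIV_isCont[OF DERIV_cont_value]
lemmas cont_opt_int = DERIV_isCont[OF DERIV_opt_int]

lemma cont_opt_value: "isCont opt_value x"
proof -
  have "opt_value = (\<lambda>d. no_lower (min d c) + cont_value (max d c) - no_lower c)"
    by (rule ext) (auto simp: opt_value_def cont_value_def advantage_c min_def max_def)
  moreover have "isCont no_lower t" for t
    by (rule DERIV_isCont) (rule DERIV_no_lower DERIV_ident)+
  moreover have "isCont (\<lambda>d. min d c) x" "isCont (\<lambda>d. max d c) x"
    by (auto intro!: continuous_intros)
  ultimately show ?thesis
    by (simp add: isCont_o2[where g = no_lower] isCont_o2[where g = cont_value] cont_cont_value)
qed

lemma cont_value_gt: "c \<le> d \<Longrightarrow> cont_value d = no_lower c + slope * (gauss_int d - gauss_int c)"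
  using advantage_c by (auto simp: cont_value_def)

lemma cont_value_nonneg: "0 \<le> d \<Longrightarrow> 0 \<le> cont_value d"
proof (cases "d \<le> c")
  case False
  then have "0 \<le> slope * (gauss_int d - gauss_int c)"
    using slope_pos gauss_int_mono[of c d] by simp
  with False show ?thesis
    by (simp add: cont_value_def add_nonneg_nonneg)
qed (simp add: cont_value_def advantage_nonneg less_imp_le)

text \<open>
  Left of \<open>c\<close> this is \<open>advantage \<le> 1\<close>; right of \<open>c\<close> the reward decreases while the continuation value
  increases, starting from equality at \<open>c\<close>.
\<close>

lemma opt_value_eq_max: "0 \<le> d \<Longrightarrow> opt_value d = max (no_lower d) (cont_value d)"
proof (cases "d \<le> c")
  case True
  assume "0 \<le> d"
  with True have "advantage d \<le> 1"
    using advantage_mono[of d c] advantage_c by simp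
  with True show ?thesis
    using mult_left_mono[of "advantage d" 1 "no_lower d"] no_lower_pos[of d]
    by (auto simp: opt_value_def cont_value_def)
next
  case False
  then have "no_lower d \<le> no_lower c" "no_lower c \<le> cont_value d"
    using no_lower_mono[of c d] c_pos slope_pos gauss_int_mono[of c d] by (auto simp: cont_value_def)
  with False show ?thesis
    by (auto simp: opt_value_def)
qed

lemma cont_value_mono_above: "c \<le> x \<Longrightarrow> x \<le> y \<Longrightarrow> cont_value x \<le> cont_value y"
  using slope_pos by (simp add: cont_value_gt gauss_int_mono)

text \<open>
  The last two bounds are the local errors of one explicit Euler step for \<open>cont_value\<close> and of one term of
  a right Riemann sum for \<open>opt_int\<close>.
\<close>

lemma regularity:
  obtains A where "1 \<le> A"
    "\<And>d. d \<in> {0..b} \<Longrightarrow> \<bar>cont_value d\<bar> \<le> A" "\<And>d. d \<in> {0..b} \<Longrightarrow> \<bar>opt_value d\<bar> \<le> A"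
    "\<And>x y. x \<in> {0..b} \<Longrightarrow> y \<in> {0..b} \<Longrightarrow> \<bar>cont_value x - cont_value y\<bar> \<le> A * \<bar>x - y\<bar>"
    "\<And>x y. x \<in> {0..b} \<Longrightarrow> y \<in> {0..b} \<Longrightarrow> \<bar>opt_int x - opt_int y\<bar> \<le> A * \<bar>x - y\<bar>"
    "\<And>x h. 0 \<le> h \<Longrightarrow> h \<le> x \<Longrightarrow> x \<le> b \<Longrightarrow>
       \<bar>cont_value (x - h) - (cont_value x - h * (opt_int x - x * cont_value x))\<bar> \<le> A * h\<^sup>2"
    "\<And>x h. 0 \<le> h \<Longrightarrow> h \<le> x \<Longrightarrow> x \<le> b \<Longrightarrow>
       \<bar>opt_int x - opt_int (x - h) - h * opt_value x\<bar> \<le> A * h\<^sup>2"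
proof -
  let ?D = "\<lambda>x. opt_int x - x * cont_value x"
  note cont [continuous_intros] = continuous_at_imp_continuous_on[OF ballI[OF cont_cont_value]]
    continuous_at_imp_continuous_on[OF ballI[OF cont_opt_int]]
    continuous_at_imp_continuous_on[OF ballI[OF cont_opt_value]]
  obtain A1 where A1: "0 < A1" "\<And>x y. x \<in> {0..b} \<Longrightarrow> y \<in> {0..b} \<Longrightarrow>
      \<bar>cont_value x - cont_value y\<bar> \<le> A1 * \<bar>x - y\<bar>"
    by (rule C1_lipschitz[OF DERIV_cont_value, of 0 b]) (auto intro!: continuous_intros)
  obtain A2 where A2: "0 < A2" "\<And>x y. x \<in> {0..b} \<Longrightarrow> y \<in> {0..b} \<Longrightarrow>
      \<bar>opt_int x - opt_int y\<bar> \<le> A2 * \<bar>x - y\<bar>"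
    by (rule C1_lipschitz[OF DERIV_opt_int, of 0 b]) (auto intro!: continuous_intros)
  obtain A3 where A3: "0 < A3" "\<And>x y. x \<in> {0..b} \<Longrightarrow> y \<in> {0..b} \<Longrightarrow>
      \<bar>no_lower x - no_lower y\<bar> \<le> A3 * \<bar>x - y\<bar>"
    by (rule C1_lipschitz[of no_lower "\<lambda>x. - x * no_lower x * 1" 0 b])
      (auto intro!: continuous_intros derivative_eq_intros simp: no_lower_def)
  have "(?D has_real_derivative opt_value x - (1 * cont_value x + (opt_int x - x * cont_value x) * x)) (at x)" for x
    by (intro derivative_intros DERIV_opt_int DERIV_mult DERIV_cont_value)
  then obtain A4 where A4: "0 < A4" "\<And>x y. x \<in> {0..b} \<Longrightarrow> y \<in> {0..b} \<Longrightarrow>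
      \<bar>?D x - ?D y\<bar> \<le> A4 * \<bar>x - y\<bar>"
    by (rule C1_lipschitz[of ?D _ 0 b]) (auto intro!: continuous_intros)
  define A0 where "A0 = A1 + A2 + A3 + A4 + 1"
  have A0: "A1 \<le> A0" "A2 \<le> A0" "A3 \<le> A0" "A4 \<le> A0" "1 \<le> A0"
    using A1(1) A2(1) A3(1) A4(1) by (auto simp: A0_def)
  have lip: "\<bar>opt_value x - opt_value y\<bar> \<le> A0 * (y - x)" if "0 \<le> x" "x \<le> y" "y \<le> b" for x y
  proof (cases "y \<le> c \<or> c < x")
    case True
    then show ?thesis
      using that A1(2)[of x y] A3(2)[of x y] mult_right_mono[of A1 A0 "y - x"]
        mult_right_mono[of A3 A0 "y - x"] A0 by (auto simp: opt_value_def)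
  next
    case False
    then have "\<bar>no_lower x - no_lower c\<bar> \<le> A0 * (c - x)" "\<bar>cont_value c - cont_value y\<bar> \<le> A0 * (y - c)"
      using that A1(2)[of c y] A3(2)[of x c] mult_right_mono[of A1 A0 "y - c"]
        mult_right_mono[of A3 A0 "c - x"] A0 c_pos abs_minus_commute[of c y]
      by (auto intro: order_trans)
    then have "\<bar>no_lower x - cont_value y\<bar> \<le> A0 * (c - x) + A0 * (y - c)"
      using cont_value_gt[of c] by simp
    with False show ?thesis
      by (simp add: opt_value_def algebra_simps)
  qed
  have V0: "\<bar>cont_value d\<bar> \<le> A0 * b" if "d \<in> {0..b}" for d
    using A1(2)[of d 0] that mult_mono[of A1 A0 d b] A0 by auto
  have U0: "\<bar>opt_value d\<bar> \<le> A0 * b + 1" if "d \<in> {0..b}" for d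
  proof -
    have "\<bar>no_lower d\<bar> \<le> 1" "0 \<le> A0 * b" using A0 that by simp_all
    with V0[OF that] show ?thesis
      unfolding opt_value_def by (smt (verit))
  qed
  have "A0 \<le> A0 * (\<bar>b\<bar> + 1) + 1"
    using A0 by (simp add: distrib_left)
  note A0_le = this
  from A0_le have le: "A1 * t \<le> (A0 * (\<bar>b\<bar> + 1) + 1) * t" "A2 * t \<le> (A0 * (\<bar>b\<bar> + 1) + 1) * t" if "0 \<le> t" for t
    using that A0 by (meson mult_right_mono order_trans)+
  show ?thesis
  proof (rule that[of "A0 * (\<bar>b\<bar> + 1) + 1"])
    show "1 \<le> A0 * (\<bar>b\<bar> + 1) + 1" using A0 by auto
    show "\<bar>cont_value d\<bar> \<le> A0 * (\<bar>b\<bar> + 1) + 1" if "d \<in> {0..b}" for d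
      using V0[OF that] A0 that by (auto simp: algebra_simps)
    show "\<bar>opt_value d\<bar> \<le> A0 * (\<bar>b\<bar> + 1) + 1" if "d \<in> {0..b}" for d
      using U0[OF that] A0 that by (auto simp: algebra_simps)
    show "\<bar>cont_value x - cont_value y\<bar> \<le> (A0 * (\<bar>b\<bar> + 1) + 1) * \<bar>x - y\<bar>"
      if "x \<in> {0..b}" "y \<in> {0..b}" for x y
      using A1(2)[OF that] le(1)[of "\<bar>x - y\<bar>"] by simp
    show "\<bar>opt_int x - opt_int y\<bar> \<le> (A0 * (\<bar>b\<bar> + 1) + 1) * \<bar>x - y\<bar>"
      if "x \<in> {0..b}" "y \<in> {0..b}" for x y
      using A2(2)[OF that] le(2)[of "\<bar>x - y\<bar>"] by simp
    fix x h :: real assume h: "0 \<le> h" "h \<le> x" "x \<le> b"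
    have le': "A0 * h * h \<le> (A0 * (\<bar>b\<bar> + 1) + 1) * h\<^sup>2"
      using mult_right_mono[OF A0_le, of "h * h"] by (simp add: power2_eq_square mult.assoc)
    have "\<bar>cont_value (x - h) - (cont_value x - h * ?D x)\<bar> \<le> A0 * h * h"
    proof (cases "h = 0")
      case False
      then obtain z where z: "x - h < z" "z < x"
          "cont_value x - cont_value (x - h) = (x - (x - h)) * ?D z"
        using MVT2[of "x - h" x cont_value ?D] DERIV_cont_value h by auto
      then have "\<bar>?D x - ?D z\<bar> \<le> A0 * h"
        using A4(2)[of x z] mult_mono[of A4 A0 "\<bar>x - z\<bar>" h] h A0 by auto
      then have "h * \<bar>?D x - ?D z\<bar> \<le> h * (A0 * h)"
        using h by (intro mult_left_mono) auto
      moreover have "cont_value (x - h) - (cont_value x - h * ?D x) = h * (?D x - ?D z)"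
        using z(3) by (simp add: algebra_simps)
      ultimately show ?thesis
        using h by (simp add: abs_mult mult_ac)
    qed simp
    with le' show "\<bar>cont_value (x - h) - (cont_value x - h * ?D x)\<bar> \<le> (A0 * (\<bar>b\<bar> + 1) + 1) * h\<^sup>2"
      by linarith
    have "\<bar>opt_int x - opt_int (x - h) - h * opt_value x\<bar> \<le> A0 * h * h"
    proof (cases "h = 0")
      case False
      then obtain z where z: "x - h < z" "z < x"
          "opt_int x - opt_int (x - h) = (x - (x - h)) * opt_value z"
        using MVT2[of "x - h" x opt_int opt_value] DERIV_opt_int h by auto
      then have "\<bar>opt_value z - opt_value x\<bar> \<le> A0 * h"
        using lip[of z x] mult_left_mono[of "x - z" h A0] h A0 by linarith
      then have "h * \<bar>opt_value z - opt_value x\<bar> \<le> h * (A0 * h)"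
        using h by (intro mult_left_mono) auto
      moreover have "opt_int x - opt_int (x - h) - h * opt_value x = h * (opt_value z - opt_value x)"
        using z(3) by (simp add: algebra_simps)
      ultimately show ?thesis
        using h by (simp add: abs_mult mult_ac)
    qed simp
    with le' show "\<bar>opt_int x - opt_int (x - h) - h * opt_value x\<bar> \<le> (A0 * (\<bar>b\<bar> + 1) + 1) * h\<^sup>2"
      by linarith
  qed
qed

end

section \<open>Stopping at the minimum of finitely many independent marks\<close>

lemma disjoint_family_on_ordered:
  fixes A :: "nat \<Rightarrow> 'a set"
  assumes "\<And>i j. 1 \<le> i \<Longrightarrow> i < j \<Longrightarrow> A i \<inter> A j = {}"
  shows "disjoint_family_on A {1..K}"
  unfolding disjoint_family_on_def
proof (intro ballI impI)
  fix i j assume "i \<in> {1..K}" "j \<in> {1..K}" "i \<noteq> j"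
  then show "A i \<inter> A j = {}"
    using assms[of i j] assms[of j i] by (cases "i < j") auto
qed

text \<open>
  For \<open>p l x\<close> the probability that mark \<open>l\<close> equals \<open>x\<close>, the probability that all marks after time \<open>j\<close> are at
  least \<open>y\<close>.
\<close>

definition surv :: "nat \<Rightarrow> (nat \<Rightarrow> nat \<Rightarrow> real) \<Rightarrow> nat \<Rightarrow> nat \<Rightarrow> real" where
  "surv K p j y = (\<Prod>l\<in>{j<..K}. 1 - (\<Sum>x<y. p l x))"

text \<open>
  The Bellman operator for one time step from running minimum \<open>k\<close>: a mark \<open>y \<le> k\<close> brings \<open>u y\<close>, and
  otherwise the running minimum and hence the value \<open>v k\<close> stay. Subtracting \<open>v k\<close> inside the sum accounts for the
  remaining probability without naming it.
\<close>

definition one_step :: "nat \<Rightarrow> (nat \<Rightarrow> nat \<Rightarrow> real) \<Rightarrow> nat \<Rightarrow> (nat \<Rightarrow> real) \<Rightarrow> (nat \<Rightarrow> real) \<Rightarrow> nat \<Rightarrow> real" where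
  "one_step K p j u v k = v k + (\<Sum>y\<le>min k K. p j y * (u y - v k))"

text \<open>
  Marks \<open>Y 1, \<dots>, Y K\<close> with information \<open>F j\<close> at time \<open>j\<close>, where every mark above \<open>K\<close> counts as
  ``no mark''. Independence is asked for only between \<open>F j\<close> and the single next mark, which is what one step of
  backward induction consumes, and only for values up to \<open>K\<close>.
\<close>

locale slots = prob_space M for M :: "'a measure" +
  fixes F :: "nat \<Rightarrow> 'a measure" and Y :: "nat \<Rightarrow> 'a \<Rightarrow> nat" and K :: nat and p :: "nat \<Rightarrow> nat \<Rightarrow> real"
  assumes space_F: "\<And>j. space (F j) = space M"
    and sets_F: "\<And>j. j \<le> K \<Longrightarrow> sets (F j) \<subseteq> events"
    and F_mono: "\<And>i j. i \<le> j \<Longrightarrow> j \<le> K \<Longrightarrow> sets (F i) \<subseteq> sets (F j)"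
    and Y_F: "\<And>j y. 1 \<le> j \<Longrightarrow> j \<le> K \<Longrightarrow> y \<le> K \<Longrightarrow> {w \<in> space M. Y j w = y} \<in> sets (F j)"
    and Y_indep: "\<And>j A y. j < K \<Longrightarrow> A \<in> sets (F j) \<Longrightarrow> y \<le> K \<Longrightarrow>
       prob (A \<inter> {w \<in> space M. Y (Suc j) w = y}) = prob A * p (Suc j) y"
begin

primrec running_min :: "nat \<Rightarrow> 'a \<Rightarrow> nat" where
  "running_min 0 w = Suc K"
| "running_min (Suc j) w = min (running_min j w) (Y (Suc j) w)"

text \<open>
  Ties count as success. In the triangular model this is the rule of the game, and for the Poisson process
  ties between cells have vanishing probability.
\<close>

definition overall_min :: "nat \<Rightarrow> 'a set" where
  "overall_min j = {w \<in> space M. Y j w \<le> K \<and> (\<forall>l\<in>{1..K}. Y j w \<le> Y l w)}"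

definition mean :: "nat \<Rightarrow> 'a set \<Rightarrow> (nat \<Rightarrow> real) \<Rightarrow> real" where
  "mean j A f = expectation (\<lambda>w. indicator A w * f (running_min j w))"

lemma le_running_min: "y \<le> running_min j w \<longleftrightarrow> y \<le> Suc K \<and> (\<forall>i\<in>{1..j}. y \<le> Y i w)"
  by (induction j) (auto simp: le_Suc_eq)

lemma running_min_le: "running_min j w \<le> Suc K"
  using le_running_min[of "running_min j w" j w] by simp

lemma F_events: "j \<le> K \<Longrightarrow> A \<in> sets (F j) \<Longrightarrow> A \<in> events"
  using sets_F by blast

lemma F_Suc: "j < K \<Longrightarrow> A \<in> sets (F j) \<Longrightarrow> A \<in> sets (F (Suc j))"
  using F_mono[of j "Suc j"] by auto

lemma Int_F: "A \<in> sets (F j) \<Longrightarrow> {w \<in> space M. P w} \<in> sets (F j) \<Longrightarrow> {w \<in> A. P w} \<in> sets (F j)"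
proof -
  assume a: "A \<in> sets (F j)" "{w \<in> space M. P w} \<in> sets (F j)"
  then have "{w \<in> A. P w} = A \<inter> {w \<in> space M. P w}"
    using sets.sets_into_space[OF a(1)] by (auto simp: space_F)
  with a show ?thesis by auto
qed

lemma Y_ge_F: "1 \<le> j \<Longrightarrow> j \<le> K \<Longrightarrow> y \<le> Suc K \<Longrightarrow> {w \<in> space M. y \<le> Y j w} \<in> sets (F j)"
proof -
  assume a: "1 \<le> j" "j \<le> K" "y \<le> Suc K"
  have "{w \<in> space M. y \<le> Y j w} = space (F j) - (\<Union>x\<in>{..<y}. {w \<in> space M. Y j w = x})"
    by (auto simp: space_F)
  also have "\<dots> \<in> sets (F j)"
    using a by (intro sets.Diff sets.top sets.finite_UN Y_F) auto
  finally show ?thesis .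
qed

lemma le_running_min_F:
  assumes "j \<le> K" shows "{w \<in> space M. y \<le> running_min j w} \<in> sets (F j)"
proof (cases "y \<le> Suc K")
  case True
  have Yi: "{w \<in> space M. y \<le> Y i w} \<in> sets (F j)" if "i \<in> {1..j}" for i
    using Y_ge_F[of i y] F_mono[of i j] that True assms by auto
  have "{w \<in> space M. y \<le> running_min j w} = space (F j) \<inter> (\<Inter>i\<in>{1..j}. space (F j) \<inter> {w \<in> space M. y \<le> Y i w})"
    using True by (auto simp: le_running_min space_F)
  also have "\<dots> \<in> sets (F j)"
  proof (cases "j = 0")
    case False
    then show ?thesis
      by (intro sets.Int sets.finite_INT sets.top Yi) auto
  qed simp
  finally show ?thesis .
qed (use le_running_min in auto)

lemma running_min_F:
  assumes "j \<le> K" shows "{w \<in> space M. running_min j w = k} \<in> sets (F j)"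
proof -
  have "{w \<in> space M. running_min j w = k} =
      {w \<in> space M. k \<le> running_min j w} - {w \<in> space M. Suc k \<le> running_min j w}"
    by auto
  then show ?thesis
    using le_running_min_F[OF assms] by auto
qed

lemma prob_Y_ge:
  assumes "j < K" "A \<in> sets (F j)" "y \<le> Suc K"
  shows "prob {w \<in> A. y \<le> Y (Suc j) w} = prob A * (1 - (\<Sum>x<y. p (Suc j) x))"
proof -
  let ?E = "\<lambda>x. A \<inter> {w \<in> space M. Y (Suc j) w = x}"
  have AM: "A \<in> events" "A \<subseteq> space M"
    using assms F_events[of j A] sets.sets_into_space by auto
  have E: "?E x \<in> events" if "x < y" for x
  proof -
    have "{w \<in> space M. Y (Suc j) w = x} \<in> events"
      using assms that by (intro F_events[of "Suc j"] Y_F) simp_all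
    with AM(1) show ?thesis by (rule sets.Int)
  qed
  have "{w \<in> A. y \<le> Y (Suc j) w} = A - (\<Union>x\<in>{..<y}. ?E x)"
    using AM by auto
  moreover have "prob (A - (\<Union>x\<in>{..<y}. ?E x)) = prob A - prob (\<Union>x\<in>{..<y}. ?E x)"
    by (intro finite_measure_Diff AM(1) sets.finite_UN E) (use AM in auto)
  moreover have "prob (\<Union>x\<in>{..<y}. ?E x) = (\<Sum>x<y. prob (?E x))"
    using E by (intro finite_measure_finite_Union) (auto simp: disjoint_family_on_def)
  moreover have "\<dots> = (\<Sum>x<y. prob A * p (Suc j) x)"
    using assms by (intro sum.cong refl Y_indep) auto
  ultimately show ?thesis
    by (simp add: algebra_simps sum_distrib_left)
qed

text \<open>
  One-step independence iterates to independence of the whole future.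
\<close>

lemma prob_later_ge:
  assumes "j \<le> K" "A \<in> sets (F j)" "y \<le> Suc K"
  shows "prob {w \<in> A. \<forall>l\<in>{j<..K}. y \<le> Y l w} = prob A * surv K p j y"
  using assms(1,2)
proof (induction j arbitrary: A rule: inc_induct)
  case base
  then show ?case by (simp add: surv_def)
next
  case (step j)
  let ?B = "{w \<in> A. y \<le> Y (Suc j) w}"
  have set: "{j<..K} = insert (Suc j) {Suc j<..K}"
    using step by auto
  have B: "?B \<in> sets (F (Suc j))"
    using step.hyps step.prems assms(3) by (intro Int_F[OF F_Suc Y_ge_F]) simp_all
  have "{w \<in> A. \<forall>l\<in>{j<..K}. y \<le> Y l w} = {w \<in> ?B. \<forall>l\<in>{Suc j<..K}. y \<le> Y l w}"
    unfolding set by auto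
  then show ?case
    using step.IH[OF B] prob_Y_ge[OF _ step.prems assms(3)] step.hyps
    by (simp add: surv_def set)
qed

lemma expectation_indicator_sum:
  assumes "finite I" "\<And>i. i \<in> I \<Longrightarrow> B i \<in> events"
    and "\<And>w. w \<in> space M \<Longrightarrow> Z w = (\<Sum>i\<in>I. c i * indicator (B i) w)"
  shows "integrable M Z" "expectation Z = (\<Sum>i\<in>I. c i * prob (B i))"
proof -
  have i: "integrable M (\<lambda>w. c i * indicator (B i) w)" if "i \<in> I" for i
    using assms(2)[OF that] by (intro integrable_mult_right) (auto intro: integrable_real_indicator simp: emeasure_eq_measure)
  have "integrable M Z \<longleftrightarrow> integrable M (\<lambda>w. \<Sum>i\<in>I. c i * indicator (B i) w)"
    by (intro Bochner_Integration.integrable_cong) (auto simp: assms)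
  with i show "integrable M Z"
    by auto
  have "expectation Z = expectation (\<lambda>w. \<Sum>i\<in>I. c i * indicator (B i) w)"
    by (intro Bochner_Integration.integral_cong) (auto simp: assms)
  also have "\<dots> = (\<Sum>i\<in>I. c i * prob (B i))"
    using assms(2) i by (subst Bochner_Integration.integral_sum) (auto intro!: sum.cong)
  finally show "expectation Z = (\<Sum>i\<in>I. c i * prob (B i))" .
qed

lemma mean_eq:
  assumes "j \<le> K" "A \<in> sets (F j)"
  shows "integrable M (\<lambda>w. indicator A w * f (running_min j w))"
    "mean j A f = (\<Sum>k\<le>Suc K. f k * prob {w \<in> A. running_min j w = k})"
proof -
  have eq: "indicator A w * f (running_min j w) =
      (\<Sum>k\<le>Suc K. f k * indicator {w \<in> A. running_min j w = k} w)" for w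
    using running_min_le[of j w]
    by (subst sum.mono_neutral_right[of _ "{running_min j w}"]) (auto simp: indicator_def)
  have ev: "{w \<in> A. running_min j w = k} \<in> events" for k
    by (rule F_events[OF assms(1) Int_F[OF assms(2) running_min_F[OF assms(1)]]])
  show "integrable M (\<lambda>w. indicator A w * f (running_min j w))"
    by (rule expectation_indicator_sum(1)[OF _ _ eq]) (use ev in auto)
  show "mean j A f = (\<Sum>k\<le>Suc K. f k * prob {w \<in> A. running_min j w = k})"
    unfolding mean_def by (rule expectation_indicator_sum(2)[OF _ _ eq]) (use ev in auto)
qed

text \<open>
  Stopping at \<open>j + 1\<close> succeeds iff the new mark is a record so far and no later mark is below it; conditioning
  on the present replaces the second event by its probability \<open>surv\<close>.
\<close>

lemma prob_overall_min:
  assumes "j < K" "A \<in> sets (F (Suc j))"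
  shows "integrable M (\<lambda>w. indicator A w *
      (if Y (Suc j) w \<le> min (running_min j w) K then surv K p (Suc j) (Y (Suc j) w) else 0))"
    and "prob (A \<inter> overall_min (Suc j)) = expectation (\<lambda>w. indicator A w *
      (if Y (Suc j) w \<le> min (running_min j w) K then surv K p (Suc j) (Y (Suc j) w) else 0))"
proof -
  let ?B = "\<lambda>y. {w \<in> {w \<in> A. Y (Suc j) w = y}. y \<le> running_min j w}"
  let ?C = "\<lambda>y. {w \<in> ?B y. \<forall>l\<in>{Suc j<..K}. y \<le> Y l w}"
  have B: "?B y \<in> sets (F (Suc j))" if "y \<le> K" for y
    using assms that by (intro Int_F[OF Int_F[OF _ Y_F] F_Suc[OF _ le_running_min_F]]) simp_all
  have Bev: "?B y \<in> events" if "y \<le> K" for y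
    using assms by (intro F_events[OF _ B[OF that]]) simp
  have C: "?C y \<in> events" if "y \<le> K" for y
  proof -
    have "?C y = (\<Inter>l\<in>{Suc j<..K}. ?B y \<inter> {w \<in> space M. y \<le> Y l w}) \<inter> ?B y"
      using sets.sets_into_space[OF B[OF that]] by (auto simp: space_F)
    moreover note Bev[OF that]
    moreover have "{w \<in> space M. y \<le> Y l w} \<in> events" if "l \<in> {Suc j<..K}" for l
      using that \<open>y \<le> K\<close> by (intro F_events[OF _ Y_ge_F]) simp_all
    ultimately show ?thesis
      by (cases "{Suc j<..K} = {}") (simp_all add: sets.Int sets.finite_INT)
  qed
  have eq: "indicator A w * (if Y (Suc j) w \<le> min (running_min j w) K then surv K p (Suc j) (Y (Suc j) w) else 0)
      = (\<Sum>y\<le>K. surv K p (Suc j) y * indicator (?B y) w)" for w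
  proof -
    have "(\<Sum>y\<le>K. surv K p (Suc j) y * indicator (?B y) w) =
        (\<Sum>y\<le>K. if y = Y (Suc j) w then (if w \<in> A \<and> y \<le> running_min j w then surv K p (Suc j) y else 0) else 0)"
      by (intro sum.cong refl) (simp add: indicator_def)
    also have "\<dots> = indicator A w * (if Y (Suc j) w \<le> min (running_min j w) K then surv K p (Suc j) (Y (Suc j) w) else 0)"
      by (simp add: sum.delta indicator_def)
    finally show ?thesis ..
  qed
  show "integrable M (\<lambda>w. indicator A w *
      (if Y (Suc j) w \<le> min (running_min j w) K then surv K p (Suc j) (Y (Suc j) w) else 0))"
    by (rule expectation_indicator_sum(1)[OF _ _ eq]) (use Bev in simp_all)
  have "A \<inter> overall_min (Suc j) = (\<Union>y\<in>{..K}. ?C y)"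
  proof -
    have split: "{1..K} = {1..j} \<union> {Suc j} \<union> {Suc j<..K}"
      using assms by auto
    show ?thesis
    proof (intro set_eqI iffI)
      fix w assume w: "w \<in> A \<inter> overall_min (Suc j)"
      then have "w \<in> ?C (Y (Suc j) w)"
        using assms(1) by (simp add: overall_min_def le_running_min)
      moreover have "Y (Suc j) w \<le> K"
        using w by (simp add: overall_min_def)
      ultimately show "w \<in> (\<Union>y\<in>{..K}. ?C y)" by blast
    next
      fix w assume "w \<in> (\<Union>y\<in>{..K}. ?C y)"
      moreover from this have "w \<in> space M"
        using sets.sets_into_space[OF assms(2)] by (auto simp: space_F)
      ultimately show "w \<in> A \<inter> overall_min (Suc j)"
        by (auto simp: overall_min_def split[simplified] le_running_min)
    qed
  qed
  moreover have "prob (\<Union>y\<in>{..K}. ?C y) = (\<Sum>y\<le>K. prob (?C y))"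
    by (intro finite_measure_finite_Union image_subsetI C) (auto simp: disjoint_family_on_def)
  ultimately have "prob (A \<inter> overall_min (Suc j)) = (\<Sum>y\<le>K. prob (?C y))"
    by simp
  also have "\<dots> = (\<Sum>y\<le>K. surv K p (Suc j) y * prob (?B y))"
  proof (intro sum.cong refl)
    fix y assume y: "y \<in> {..K}"
    show "prob (?C y) = surv K p (Suc j) y * prob (?B y)"
      by (subst prob_later_ge[OF _ B]) (use y assms(1) in simp_all)
  qed
  also have "\<dots> = expectation (\<lambda>w. indicator A w *
      (if Y (Suc j) w \<le> min (running_min j w) K then surv K p (Suc j) (Y (Suc j) w) else 0))"
    by (rule expectation_indicator_sum(2)[OF _ _ eq, symmetric]) (use Bev in simp_all)
  finally show "prob (A \<inter> overall_min (Suc j)) = expectation (\<lambda>w. indicator A w *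
      (if Y (Suc j) w \<le> min (running_min j w) K then surv K p (Suc j) (Y (Suc j) w) else 0))" .
qed

lemma mean_step:
  assumes "j < K" "A \<in> sets (F j)"
  shows "integrable M (\<lambda>w. indicator A w *
      (if Y (Suc j) w \<le> min (running_min j w) K then u (Y (Suc j) w) else a (running_min j w)))"
    and "expectation (\<lambda>w. indicator A w *
      (if Y (Suc j) w \<le> min (running_min j w) K then u (Y (Suc j) w) else a (running_min j w)))
     = mean j A (one_step K p (Suc j) u a)"
proof -
  let ?I = "\<lambda>w. indicator A w *
      (if Y (Suc j) w \<le> min (running_min j w) K then u (Y (Suc j) w) else a (running_min j w))"
  let ?R = "\<lambda>k. {w \<in> A. running_min j w = k}"
  let ?B = "\<lambda>(k, y). ?R k \<inter> {w \<in> space M. Y (Suc j) w = y}"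
  let ?I2 = "\<lambda>w. (\<Sum>(k, y)\<in>(SIGMA k:{..Suc K}. {..min k K}). (u y - a k) * indicator (?B (k, y)) w)"
  have R: "?R k \<in> sets (F j)" for k
    using assms by (intro Int_F[OF _ running_min_F]) simp_all
  have B: "?B (k, y) \<in> events" if "y \<le> K" for k y
  proof -
    have "{w \<in> space M. Y (Suc j) w = y} \<in> events"
      using assms that by (intro F_events[of "Suc j"] Y_F) simp_all
    with F_events[OF _ R[of k]] assms(1) show ?thesis
      by (simp add: sets.Int)
  qed
  have eq: "?I w = indicator A w * a (running_min j w) + ?I2 w" if w: "w \<in> space M" for w
  proof -
    have "?I2 w = (\<Sum>z\<in>(SIGMA k:{..Suc K}. {..min k K}).
        if z = (running_min j w, Y (Suc j) w) then (if w \<in> A then u (snd z) - a (fst z) else 0) else 0)"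
      using w by (intro sum.cong refl) (auto simp: indicator_def)
    also have "\<dots> = (if Y (Suc j) w \<le> min (running_min j w) K
        then (if w \<in> A then u (Y (Suc j) w) - a (running_min j w) else 0) else 0)"
      using running_min_le[of j w] by (subst sum.delta) auto
    finally have "?I2 w = (if Y (Suc j) w \<le> min (running_min j w) K
        then (if w \<in> A then u (Y (Suc j) w) - a (running_min j w) else 0) else 0)" .
    then show ?thesis
      by (simp add: indicator_def)
  qed
  have eq2: "integrable M ?I2" "expectation ?I2 = (\<Sum>(k, y)\<in>(SIGMA k:{..Suc K}. {..min k K}). (u y - a k) * prob (?B (k, y)))"
    unfolding case_prod_unfold
    by (rule expectation_indicator_sum[OF _ _ refl]; use B in auto)+
  have int: "integrable M ?I \<longleftrightarrow> integrable M (\<lambda>w. indicator A w * a (running_min j w) + ?I2 w)"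
    by (intro Bochner_Integration.integrable_cong eq refl)
  show "integrable M ?I"
    unfolding int using mean_eq(1)[of j A a] assms eq2(1) by (intro Bochner_Integration.integrable_add) auto
  have "expectation ?I = expectation (\<lambda>w. indicator A w * a (running_min j w) + ?I2 w)"
    by (intro Bochner_Integration.integral_cong eq refl)
  also have "\<dots> = mean j A a + expectation ?I2"
    unfolding mean_def
    using mean_eq(1)[of j A a] assms eq2(1) by (intro Bochner_Integration.integral_add) auto
  also have "\<dots> = mean j A a + (\<Sum>k\<le>Suc K. \<Sum>y\<le>min k K. (u y - a k) * prob (?B (k, y)))"
    unfolding eq2 by (subst sum.Sigma) auto
  also have "\<dots> = mean j A a + (\<Sum>k\<le>Suc K. \<Sum>y\<le>min k K. (u y - a k) * (prob (?R k) * p (Suc j) y))"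
  proof (intro arg_cong2[of _ _ _ _ "(+)"] sum.cong refl)
    fix k y assume "y \<in> {..min k K}"
    then show "(u y - a k) * prob (?B (k, y)) = (u y - a k) * (prob (?R k) * p (Suc j) y)"
      unfolding case_prod_conv by (subst Y_indep[OF assms(1) R]) simp_all
  qed
  also have "\<dots> = mean j A (one_step K p (Suc j) u a)"
  proof -
    have jK: "j \<le> K" using assms(1) by simp
    have "a k * q + (\<Sum>y\<le>min k K. (u y - a k) * (q * p (Suc j) y)) =
        (a k + (\<Sum>y\<le>min k K. p (Suc j) y * (u y - a k))) * q" for k q
      by (simp add: distrib_left distrib_right sum_distrib_left sum_distrib_right mult_ac)
    then show ?thesis
      by (simp only: mean_eq(2)[OF jK assms(2)] one_step_def flip: sum.distrib)
  qed
  finally show "expectation ?I = mean j A (one_step K p (Suc j) u a)" .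
qed

lemma mean_mono:
  assumes "j \<le> K" "A \<in> sets (F j)" "\<And>k. k \<le> Suc K \<Longrightarrow> f k \<le> g k + e" "0 \<le> e"
  shows "mean j A f \<le> mean j A g + e"
proof -
  have "mean j A f \<le> expectation (\<lambda>w. indicator A w * g (running_min j w) + e)"
    unfolding mean_def
    using assms running_min_le
    by (intro integral_mono mean_eq Bochner_Integration.integrable_add) (auto simp: indicator_def)
  also have "\<dots> = mean j A g + e"
    unfolding mean_def
    by (subst Bochner_Integration.integral_add) (use assms mean_eq prob_space in auto)
  finally show ?thesis .
qed

definition undecided :: "(nat \<Rightarrow> 'a set) \<Rightarrow> nat \<Rightarrow> 'a set" where
  "undecided A j = space M - (\<Union>i\<in>{1..j}. A i)"

lemma undecided_F:
  assumes "\<And>j. j \<in> {1..K} \<Longrightarrow> A j \<in> sets (F j)" "j \<le> K"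
  shows "undecided A j \<in> sets (F j)"
proof -
  have "A i \<in> sets (F j)" if "i \<in> {1..j}" for i
    using assms(1)[of i] F_mono[of i j] that assms(2) by (auto simp del: One_nat_def)
  then have "space (F j) - (\<Union>i\<in>{1..j}. A i) \<in> sets (F j)"
    by (intro sets.Diff sets.top sets.finite_UN) simp_all
  then show ?thesis
    by (simp only: undecided_def space_F)
qed

lemma undecided_Suc: "undecided A (Suc j) = undecided A j - A (Suc j)"
  by (auto simp: undecided_def atLeastAtMostSuc_conv)

lemma sum_Suc_greater: "j < K \<Longrightarrow> (\<Sum>i\<in>{j<..K}. f i) = f (Suc j) + (\<Sum>i\<in>{Suc j<..K}. f i :: real)"
proof -
  assume "j < K"
  then have "{j<..K} = insert (Suc j) {Suc j<..K}" by auto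
  then show ?thesis by simp
qed

text \<open>
  A family of disjoint decisions is a stopping rule. If \<open>a j\<close> dominates the Bellman operator up to \<open>e\<close>, then
  the mean of \<open>a j\<close> on the event that nothing was chosen by time \<open>j\<close>, increased by \<open>e\<close> for every step to
  come, dominates the probability of a later success; this is backward induction on \<open>j\<close>.
\<close>

theorem prob_stop_at_min_le:
  fixes a :: "nat \<Rightarrow> nat \<Rightarrow> real"
  assumes A: "\<And>j. j \<in> {1..K} \<Longrightarrow> A j \<in> sets (F j)" and dis: "disjoint_family_on A {1..K}"
    and a: "\<And>j k. 0 \<le> a j k" and e: "0 \<le> e"
    and step: "\<And>j k. j < K \<Longrightarrow> k \<le> Suc K \<Longrightarrow>
      one_step K p (Suc j) (\<lambda>y. max (surv K p (Suc j) y) (a (Suc j) y)) (a (Suc j)) k \<le> a j k + e"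
  shows "(\<Sum>j=1..K. prob (A j \<inter> overall_min j)) \<le> a 0 (Suc K) + real K * e"
proof -
  have "(\<Sum>i\<in>{j<..K}. prob (A i \<inter> overall_min i)) \<le> mean j (undecided A j) (a j) + real (K - j) * e" if "j \<le> K" for j
    using that
  proof (induction j rule: inc_induct)
    case base
    show ?case using a by (auto simp: mean_def intro!: Bochner_Integration.integral_nonneg)
  next
    case (step j)
    let ?N = "undecided A"
    let ?I1 = "\<lambda>w. indicator (A (Suc j)) w *
      (if Y (Suc j) w \<le> min (running_min j w) K then surv K p (Suc j) (Y (Suc j) w) else 0)"
    let ?I2 = "\<lambda>w. indicator (?N (Suc j)) w * a (Suc j) (running_min (Suc j) w)"
    let ?I = "\<lambda>w. indicator (?N j) w * (if Y (Suc j) w \<le> min (running_min j w) K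
      then max (surv K p (Suc j) (Y (Suc j) w)) (a (Suc j) (Y (Suc j) w)) else a (Suc j) (running_min j w))"
    have A1: "A (Suc j) \<in> sets (F (Suc j))" using A step.hyps(2) by simp
    have N: "?N j \<in> sets (F j)" "?N (Suc j) \<in> sets (F (Suc j))"
      using step.hyps(2) by (intro undecided_F A; simp)+
    have "A (Suc j) \<inter> A i = {}" if "i \<in> {1..j}" for i
      using disjoint_family_onD[OF dis, of "Suc j" i] that step.hyps(2) by simp
    moreover have "A (Suc j) \<subseteq> space M"
      using sets.sets_into_space[OF A1] by (simp add: space_F)
    ultimately have "A (Suc j) \<subseteq> ?N j"
      unfolding undecided_def by blast
    then have pw: "?I1 w + ?I2 w \<le> ?I w" for w
      using a[of "Suc j" "running_min (Suc j) w"] running_min_le[of j w]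
      by (cases "w \<in> A (Suc j)"; cases "w \<in> ?N j"; cases "Y (Suc j) w \<le> running_min j w";
          cases "Y (Suc j) w \<le> K") (auto simp: undecided_Suc le_Suc_eq min_def split: if_splits)
    have int1: "integrable M ?I1" and int2: "integrable M ?I2"
      using prob_overall_min(1)[OF step.hyps(2) A1] mean_eq(1)[OF _ N(2)] step.hyps(2) by simp_all
    have "prob (A (Suc j) \<inter> overall_min (Suc j)) + mean (Suc j) (?N (Suc j)) (a (Suc j))
        = expectation (\<lambda>w. ?I1 w + ?I2 w)"
      unfolding mean_def prob_overall_min(2)[OF step(2) A1]
      by (subst Bochner_Integration.integral_add)
        (rule int1 int2 refl)+
    also have "\<dots> \<le> expectation ?I"
      by (intro integral_mono Bochner_Integration.integrable_add pw int1 int2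
          mean_step(1)[OF step.hyps(2) N(1)])
    also have "\<dots> = mean j (?N j) (one_step K p (Suc j) (\<lambda>y. max (surv K p (Suc j) y) (a (Suc j) y)) (a (Suc j)))"
      by (rule mean_step(2)[OF step.hyps(2) N(1)])
    also have "\<dots> \<le> mean j (?N j) (a j) + e"
      using N(1) step.hyps(2) assms(5) e by (intro mean_mono) simp_all
    finally show ?case
      using step.IH step.hyps
      by (simp add: sum_Suc_greater Suc_diff_Suc[symmetric] of_nat_diff algebra_simps)
  qed
  from this[of 0] have *: "(\<Sum>i\<in>{0<..K}. prob (A i \<inter> overall_min i)) \<le> mean 0 (undecided A 0) (a 0) + real K * e"
    by simp
  have "mean 0 (undecided A 0) (a 0) = expectation (\<lambda>w. a 0 (Suc K))"
    unfolding mean_def by (intro Bochner_Integration.integral_cong) (auto simp: undecided_def)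
  with * show ?thesis
    using prob_space by (simp add: atLeastSucAtMost_greaterThanAtMost)
qed

text \<open>
  The cutoff rule chooses the first mark that does not exceed the running minimum and lies at most \<open>q\<close>
  above its own time.
\<close>

primrec cutoff_wait :: "nat \<Rightarrow> nat \<Rightarrow> 'a set" where
  "cutoff_wait q 0 = space M"
| "cutoff_wait q (Suc j) = {w \<in> cutoff_wait q j. \<not> (Y (Suc j) w \<le> min (running_min j w) K \<and> Y (Suc j) w \<le> Suc j + q)}"

definition cutoff_stop :: "nat \<Rightarrow> nat \<Rightarrow> 'a set" where
  "cutoff_stop q j = {w \<in> cutoff_wait q (j - 1). Y j w \<le> min (running_min (j - 1) w) K \<and> Y j w \<le> j + q}"

lemma cutoff_F:
  shows "j \<le> K \<Longrightarrow> cutoff_wait q j \<in> sets (F j)"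
    and "j \<in> {1..K} \<Longrightarrow> cutoff_stop q j \<in> sets (F j)"
proof -
  have S: "{w \<in> A. Y (Suc j) w \<le> min (running_min j w) K \<and> Y (Suc j) w \<le> Suc j + q} \<in> sets (F (Suc j))"
    if "A \<in> sets (F j)" "j < K" for A j
  proof -
    have "{w \<in> A. Y (Suc j) w \<le> min (running_min j w) K \<and> Y (Suc j) w \<le> Suc j + q} =
       (\<Union>y\<in>{..min K (Suc j + q)}. {w \<in> {w \<in> A. Y (Suc j) w = y}. y \<le> running_min j w})"
      by auto
    also have "\<dots> \<in> sets (F (Suc j))"
      using that F_Suc[OF that(2) that(1)]
      by (intro sets.finite_UN Int_F[OF Int_F[OF _ Y_F] F_Suc[OF _ le_running_min_F]]) simp_all
    finally show ?thesis .
  qed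
  have W: "j \<le> K \<Longrightarrow> cutoff_wait q j \<in> sets (F j)" for j
  proof (induction j)
    case 0 then show ?case by (simp add: space_F[of 0, symmetric])
  next
    case (Suc j)
    have "cutoff_wait q (Suc j) = cutoff_wait q j -
       {w \<in> cutoff_wait q j. Y (Suc j) w \<le> min (running_min j w) K \<and> Y (Suc j) w \<le> Suc j + q}"
      by auto
    with S[of "cutoff_wait q j" j] Suc F_Suc[of j "cutoff_wait q j"] show ?case by auto
  qed
  show "j \<le> K \<Longrightarrow> cutoff_wait q j \<in> sets (F j)" by (rule W)
  show "j \<in> {1..K} \<Longrightarrow> cutoff_stop q j \<in> sets (F j)"
    using S[OF W, of "j - 1"] by (auto simp: cutoff_stop_def)
qed

text \<open>
  The same backward induction, where the rule decides which of the two rewards enters each step, so that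
  the comparison of integrands becomes an equality.
\<close>

theorem prob_cutoff_ge:
  fixes a :: "nat \<Rightarrow> nat \<Rightarrow> real"
  assumes e: "0 \<le> e" and a_end: "\<And>k. k \<le> Suc K \<Longrightarrow> a K k \<le> e'" and e': "0 \<le> e'"
    and step: "\<And>j k. j < K \<Longrightarrow> k \<le> Suc K \<Longrightarrow>
      a j k \<le> one_step K p (Suc j)
        (\<lambda>y. if y \<le> Suc j + q then surv K p (Suc j) y else a (Suc j) y) (a (Suc j)) k + e"
  shows "a 0 (Suc K) - real K * e - e' \<le> (\<Sum>j=1..K. prob (cutoff_stop q j \<inter> overall_min j))"
proof -
  let ?N = "cutoff_wait q" and ?A = "cutoff_stop q"
  have "mean j (?N j) (a j) - real (K - j) * e - e' \<le> (\<Sum>i\<in>{j<..K}. prob (?A i \<inter> overall_min i))" if "j \<le> K" for j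
    using that
  proof (induction j rule: inc_induct)
    case base
    have "mean K (?N K) (a K) \<le> e'"
      using mean_mono[of K "?N K" "a K" "\<lambda>_. 0" e'] a_end e' cutoff_F(1)[of K q]
      by (simp add: mean_def[of _ _ "\<lambda>_. 0"])
    then show ?case by simp
  next
    case (step j)
    let ?I1 = "\<lambda>w. indicator (?A (Suc j)) w *
      (if Y (Suc j) w \<le> min (running_min j w) K then surv K p (Suc j) (Y (Suc j) w) else 0)"
    let ?I2 = "\<lambda>w. indicator (?N (Suc j)) w * a (Suc j) (running_min (Suc j) w)"
    let ?u = "\<lambda>y. if y \<le> Suc j + q then surv K p (Suc j) y else a (Suc j) y"
    let ?I = "\<lambda>w. indicator (?N j) w * (if Y (Suc j) w \<le> min (running_min j w) K
      then ?u (Y (Suc j) w) else a (Suc j) (running_min j w))"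
    have A1: "?A (Suc j) \<in> sets (F (Suc j))" and N: "?N j \<in> sets (F j)" "?N (Suc j) \<in> sets (F (Suc j))"
      using step.hyps(2) by (auto simp del: cutoff_wait.simps intro!: cutoff_F)
    have pw: "?I w = ?I1 w + ?I2 w" for w
      using running_min_le[of j w]
      by (cases "w \<in> ?N j"; cases "Y (Suc j) w \<le> running_min j w";
          cases "Y (Suc j) w \<le> K"; cases "Y (Suc j) w \<le> Suc j + q")
        (auto simp: cutoff_stop_def le_Suc_eq min_def split: if_splits)
    have int1: "integrable M ?I1" and int2: "integrable M ?I2"
      using prob_overall_min(1)[OF step.hyps(2) A1] mean_eq(1)[OF _ N(2)] step.hyps(2) by simp_all
    have "mean j (?N j) (a j) \<le> mean j (?N j) (one_step K p (Suc j) ?u (a (Suc j))) + e"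
      using N(1) step.hyps(2) assms(4) e by (intro mean_mono) simp_all
    also have "mean j (?N j) (one_step K p (Suc j) ?u (a (Suc j))) = expectation ?I"
      by (rule mean_step(2)[OF step.hyps(2) N(1), symmetric])
    also have "\<dots> = expectation (\<lambda>w. ?I1 w + ?I2 w)"
      unfolding pw ..
    also have "\<dots> = prob (?A (Suc j) \<inter> overall_min (Suc j)) + mean (Suc j) (?N (Suc j)) (a (Suc j))"
      unfolding mean_def prob_overall_min(2)[OF step(2) A1]
      by (subst Bochner_Integration.integral_add)
        (rule int1 int2 refl)+
    finally show ?case
      using step.IH step.hyps
      by (simp add: sum_Suc_greater Suc_diff_Suc[symmetric] of_nat_diff algebra_simps)
  qed
  from this[of 0] have *: "mean 0 (?N 0) (a 0) - real K * e - e' \<le> (\<Sum>i\<in>{0<..K}. prob (?A i \<inter> overall_min i))"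
    by simp
  have "mean 0 (?N 0) (a 0) = expectation (\<lambda>w. a 0 (Suc K))"
    unfolding mean_def by (intro Bochner_Integration.integral_cong) auto
  with * show ?thesis
    using prob_space by (simp add: atLeastSucAtMost_greaterThanAtMost)
qed

lemma prob_no_low:
  "prob {w \<in> space M. \<forall>l\<in>{1..K}. Suc K \<le> Y l w} = surv K p 0 (Suc K)"
  using prob_later_ge[of 0 "space M" "Suc K"] sets.top[of "F 0"] prob_space
  by (simp add: space_F atLeastSucAtMost_greaterThanAtMost)

lemma overall_min_events:
  assumes "j \<in> {1..K}" shows "overall_min j \<in> events"
proof -
  let ?B = "\<lambda>y. {w \<in> space M. Y j w = y} \<inter> (\<Inter>l\<in>{1..K}. {w \<in> space M. y \<le> Y l w})"
  have "overall_min j = (\<Union>y\<in>{..K}. ?B y)"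
    using assms by (auto simp: overall_min_def)
  also have "\<dots> \<in> events"
  proof (intro sets.finite_UN sets.Int sets.finite_INT)
    show "{w \<in> space M. Y j w = y} \<in> events" if "y \<in> {..K}" for y
      using assms that by (intro F_events[OF _ Y_F]) auto
    show "{w \<in> space M. y \<le> Y l w} \<in> events" if "y \<in> {..K}" "l \<in> {1..K}" for y l
      using that by (intro F_events[OF _ Y_ge_F]) auto
  qed (use assms in auto)
  finally show ?thesis .
qed

text \<open>
  How an upper bound for the finite problem transfers to a model: success implies success on the grid unless
  no mark is at most \<open>K\<close>.
\<close>

lemma prob_le_stop_sum:
  assumes A: "\<And>j. j \<in> {1..K} \<Longrightarrow> A j \<in> sets (F j)"
    and S: "AE w in M. w \<in> S \<longrightarrow> w \<in> (\<Union>j\<in>{1..K}. A j \<inter> overall_min j) \<union> {w \<in> space M. \<forall>l\<in>{1..K}. Suc K \<le> Y l w}"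
  shows "prob S \<le> (\<Sum>j=1..K. prob (A j \<inter> overall_min j)) + prob {w \<in> space M. \<forall>l\<in>{1..K}. Suc K \<le> Y l w}"
proof -
  let ?N = "{w \<in> space M. \<forall>l\<in>{1..K}. Suc K \<le> Y l w}"
  have AO: "A j \<inter> overall_min j \<in> events" if "j \<in> {1..K}" for j
    using F_events[OF _ A[OF that]] overall_min_events[OF that] that by auto
  have "{w \<in> space M. Suc K \<le> running_min K w} \<in> events"
    by (intro F_events[OF _ le_running_min_F]) auto
  also have "{w \<in> space M. Suc K \<le> running_min K w} = ?N"
    by (simp add: le_running_min)
  finally have N: "?N \<in> events" .
  have U: "(\<Union>j\<in>{1..K}. A j \<inter> overall_min j) \<in> events"
    using AO by (intro sets.finite_UN) auto
  have "prob S \<le> prob ((\<Union>j\<in>{1..K}. A j \<inter> overall_min j) \<union> ?N)"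
    using S by (rule finite_measure_mono_AE) (use U N in auto)
  also have "\<dots> \<le> prob (\<Union>j\<in>{1..K}. A j \<inter> overall_min j) + prob ?N"
    by (rule measure_Un_le[OF U N])
  also have "prob (\<Union>j\<in>{1..K}. A j \<inter> overall_min j) \<le> (\<Sum>j\<in>{1..K}. prob (A j \<inter> overall_min j))"
    using AO by (intro finite_measure_subadditive_finite) auto
  finally show ?thesis by simp
qed

lemma cutoff_wait_antimono: "i \<le> j \<Longrightarrow> cutoff_wait q j \<subseteq> cutoff_wait q i"
  by (induction j rule: dec_induct) auto

lemma cutoff_stop_disjoint: "disjoint_family_on (cutoff_stop q) {1..K}"
proof -
  have "cutoff_stop q i \<inter> cutoff_stop q j = {}" if "1 \<le> i" "i < j" for i j
  proof -
    have "i \<le> j - 1" using that by simp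
    then have "cutoff_stop q j \<subseteq> cutoff_wait q i"
      using cutoff_wait_antimono[of i "j - 1" q] that by (auto simp: cutoff_stop_def)
    moreover have "cutoff_stop q i \<inter> cutoff_wait q i = {}"
      using that by (cases i) (auto simp: cutoff_stop_def)
    ultimately show ?thesis by blast
  qed
  then show ?thesis
    by (rule disjoint_family_on_ordered)
qed

text \<open>
  How a lower bound transfers: outside an exceptional event \<open>E\<close> success on the grid implies success in the
  model.
\<close>

lemma stop_sum_le_prob:
  assumes S: "S \<in> events" and E: "E \<in> events"
    and *: "AE w in M. w \<notin> E \<longrightarrow> w \<in> (\<Union>j\<in>{1..K}. cutoff_stop q j \<inter> overall_min j) \<longrightarrow> w \<in> S"
  shows "(\<Sum>j=1..K. prob (cutoff_stop q j \<inter> overall_min j)) \<le> prob S + prob E"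
proof -
  have AO: "cutoff_stop q j \<inter> overall_min j \<in> events" if "j \<in> {1..K}" for j
    using F_events[OF _ cutoff_F(2)[OF that]] overall_min_events[OF that] that by auto
  have "(\<Sum>j\<in>{1..K}. prob (cutoff_stop q j \<inter> overall_min j)) = prob (\<Union>j\<in>{1..K}. cutoff_stop q j \<inter> overall_min j)"
    using AO cutoff_stop_disjoint[of q]
    by (intro finite_measure_finite_Union[symmetric]) (auto simp: disjoint_family_on_def)
  also have "\<dots> \<le> prob (S \<union> E)"
    by (rule finite_measure_mono_AE) (use * S E in auto)
  also have "\<dots> \<le> prob S + prob E"
    by (rule measure_Un_le[OF S E])
  finally show ?thesis by simp
qed

end

section \<open>Nearly uniform marks and the limiting value function\<close>

text \<open>
  The common shape of both models at scale \<open>h\<close>: mark \<open>j\<close> takes each value in \<open>{j<..K}\<close> with probability \<open>h\<^sup>2\<close>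
  up to a relative error \<open>O(h)\<close>. The diagonal value \<open>j\<close> is only bounded, because a cell on the diagonal is cut in half
  while the triangular model gives it full weight.
\<close>

definition near_uniform :: "real \<Rightarrow> real \<Rightarrow> (nat \<Rightarrow> nat \<Rightarrow> real) \<Rightarrow> nat \<Rightarrow> real \<Rightarrow> bool" where
  "near_uniform L C p K h \<longleftrightarrow> 0 < h \<and> h \<le> 1 \<and> real K * h \<le> L \<and>
     (\<forall>j\<in>{1..K}. (\<forall>y\<le>K. 0 \<le> p j y) \<and> (\<Sum>y\<le>K. p j y) \<le> 1 \<and> (\<forall>y<j. p j y = 0) \<and>
        p j j \<le> C * h\<^sup>2 \<and> (\<forall>y\<in>{j<..K}. \<bar>p j y - h\<^sup>2\<bar> \<le> C * h ^ 3))"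

lemma exp_minus_diff_le:
  fixes a b :: real
  assumes "0 \<le> a" "0 \<le> b"
  shows "\<bar>exp (- a) - exp (- b)\<bar> \<le> \<bar>a - b\<bar>"
proof -
  have *: "exp (- x) - exp (- y) \<le> y - x" if "0 \<le> x" "x \<le> y" for x y :: real
  proof -
    have "exp (- x) - exp (- y) = exp (- x) * (1 - exp (- (y - x)))"
      by (simp add: algebra_simps flip: exp_add)
    also have "\<dots> \<le> 1 * (y - x)"
    proof (intro mult_mono)
      show "1 - exp (- (y - x)) \<le> y - x"
        using exp_ge_add_one_self[of "- (y - x)"] by linarith
    qed (use that in auto)
    finally show ?thesis by simp
  qed
  show ?thesis
    using *[of a b] *[of b a] assms by (cases "a \<le> b") auto
qed

lemma exp_minus_linear:
  fixes t :: real
  assumes "0 \<le> t" shows "\<bar>exp (- t) - (1 - t)\<bar> \<le> t\<^sup>2"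
proof -
  have "exp (- t) \<le> 1 / (1 + t)"
    using exp_ge_add_one_self[of t] assms by (simp add: exp_minus field_simps)
  also have "\<dots> \<le> 1 - t + t\<^sup>2"
    using assms by (simp add: field_simps power2_eq_square)
  finally show ?thesis
    using exp_ge_add_one_self[of "- t"] by simp
qed

lemma sum_triangle:
  fixes j y K :: nat
  assumes "j \<le> K" "y \<le> Suc K"
  shows "2 * (\<Sum>l\<in>{j<..K}. y - l) = (y - j) * (y - j - 1)"
  using assms(1)
proof (induction j rule: inc_induct)
  case base then show ?case using assms(2) by (cases "y - K") auto
next
  case (step j)
  have set: "{j<..K} = insert (Suc j) {Suc j<..K}"
    using step by auto
  show ?case
  proof (cases "y \<le> j")
    case False
    then obtain m where "y = j + Suc m"
      using less_imp_Suc_add[of j y] by auto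
    then show ?thesis
      using step.IH by (cases m) (auto simp: set)
  qed (auto simp: set)
qed

text \<open>
  Fewer than \<open>K \<le> L / h\<close> terms, each with error \<open>O(h\<^sup>3)\<close>, and one diagonal term \<open>O(h\<^sup>2)\<close>.
\<close>

lemma sum_lessThan_near:
  assumes nu: "near_uniform L C p K h" and C: "0 \<le> C" and l: "l \<in> {1..K}" and y: "y \<le> Suc K"
  shows "\<bar>(\<Sum>x<y. p l x) - h\<^sup>2 * real (y - l)\<bar> \<le> (C + C * L + 1) * h\<^sup>2"
proof (cases "y \<le> l")
  case True
  have "(\<Sum>x<y. p l x) = 0"
    using nu l True by (intro sum.neutral) (auto simp: near_uniform_def)
  moreover have "0 \<le> L"
    using nu by (auto simp: near_uniform_def intro: order_trans[of _ "real K * h"])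
  ultimately show ?thesis using C True by simp
next
  case False
  have h: "0 < h" "real K * h \<le> L" using nu by (auto simp: near_uniform_def)
  have p: "p l x = 0" if "x < l" for x using nu l that by (auto simp: near_uniform_def)
  have pl: "0 \<le> p l l" "p l l \<le> C * h\<^sup>2"
    using nu l by (auto simp: near_uniform_def)
  have "(\<Sum>x<y. p l x) = (\<Sum>x\<in>{l..<y}. p l x)"
    by (intro sum.mono_neutral_right) (auto simp: p not_le)
  also have "\<dots> = p l l + (\<Sum>x\<in>{l<..<y}. p l x)"
    using False by (subst sum.remove[of _ l]) (auto intro!: sum.cong)
  finally have s: "(\<Sum>x<y. p l x) = p l l + (\<Sum>x\<in>{l<..<y}. p l x)" .
  have "\<bar>\<Sum>x\<in>{l<..<y}. p l x - h\<^sup>2\<bar> \<le> (\<Sum>x\<in>{l<..<y}. C * h ^ 3)"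
    using nu l y by (intro order_trans[OF sum_abs] sum_mono) (auto simp: near_uniform_def)
  also have "\<dots> = real (y - Suc l) * (C * h ^ 3)" by simp
  also have "\<dots> \<le> real K * (C * h ^ 3)"
    using y C h l by (intro mult_right_mono) auto
  also have "\<dots> = (real K * h) * (C * h\<^sup>2)" by (simp add: power2_eq_square power3_eq_cube)
  also have "\<dots> \<le> L * (C * h\<^sup>2)" using h C by (intro mult_right_mono) auto
  finally have "\<bar>(\<Sum>x\<in>{l<..<y}. p l x) - real (y - Suc l) * h\<^sup>2\<bar> \<le> C * L * h\<^sup>2"
    by (simp add: sum_subtractf mult_ac)
  moreover have "h\<^sup>2 * real (y - l) = real (y - Suc l) * h\<^sup>2 + h\<^sup>2"
    using False by (simp add: of_nat_diff algebra_simps)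
  moreover have "(C + C * L + 1) * h\<^sup>2 = C * h\<^sup>2 + C * L * h\<^sup>2 + h\<^sup>2" "0 \<le> h\<^sup>2"
    by (simp_all add: distrib_right)
  ultimately show ?thesis
    using s pl by linarith
qed

text \<open>
  The factors \<open>1 - s\<close> are replaced by \<open>exp (- t)\<close> with \<open>t = h\<^sup>2 * (y - l)\<close> at a cost of \<open>O(h\<^sup>2)\<close> each; the
  exponents add up to a triangular number, which is the area \<open>d\<^sup>2 / 2\<close> up to the diagonal term \<open>O(h)\<close>.
\<close>

lemma surv_near:
  assumes nu: "near_uniform L C p K h" and C: "0 \<le> C" and j: "j \<le> K" and y: "y \<le> Suc K"
  shows "\<bar>surv K p j y - no_lower (real (y - j) * h)\<bar> \<le> (L * ((C + C * L + 1) + (L + 1)\<^sup>2) + (L + 1)) * h"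
proof -
  have h: "0 < h" "h \<le> 1" "real K * h \<le> L" using nu by (auto simp: near_uniform_def)
  have L: "0 \<le> L" using h by (auto intro: order_trans[of _ "real K * h"])
  define s where "s l = (\<Sum>x<y. p l x)" for l
  define t where "t l = h\<^sup>2 * real (y - l)" for l
  have yh: "real (y - i) * h \<le> L + 1" for i
  proof -
    have "real (y - i) * h \<le> (real K + 1) * h"
      using y h by (intro mult_right_mono) auto
    with h show ?thesis by (simp add: distrib_right)
  qed
  have s01: "0 \<le> s l" "s l \<le> 1" if "l \<in> {j<..K}" for l
  proof -
    have l: "l \<in> {1..K}" using that by auto
    have "s l \<le> (\<Sum>x\<le>K. p l x)"
      unfolding s_def using nu l y by (intro sum_mono2) (auto simp: near_uniform_def)
    also have "\<dots> \<le> 1" using nu l by (auto simp: near_uniform_def)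
    finally show "s l \<le> 1" .
    show "0 \<le> s l" unfolding s_def using nu l y by (intro sum_nonneg) (auto simp: near_uniform_def)
  qed
  have t0: "0 \<le> t l" for l by (simp add: t_def)
  have "\<bar>(\<Prod>l\<in>{j<..K}. 1 - s l) - (\<Prod>l\<in>{j<..K}. exp (- t l))\<bar> \<le> (\<Sum>l\<in>{j<..K}. \<bar>1 - s l - exp (- t l)\<bar>)"
    using norm_prod_diff[of "{j<..K}" "\<lambda>l. 1 - s l" "\<lambda>l. exp (- t l)"] s01 t0 by auto
  also have "\<dots> \<le> (\<Sum>l\<in>{j<..K}. ((C + C * L + 1) + (L + 1)\<^sup>2) * h\<^sup>2)"
  proof (rule sum_mono)
    fix l assume l: "l \<in> {j<..K}"
    have "\<bar>s l - t l\<bar> \<le> (C + C * L + 1) * h\<^sup>2"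
      unfolding s_def t_def using l by (intro sum_lessThan_near[OF nu C _ y]) auto
    moreover have "(t l)\<^sup>2 \<le> (L + 1)\<^sup>2 * h\<^sup>2"
    proof -
      have "t l = (real (y - l) * h) * h" by (simp add: t_def power2_eq_square)
      also have "\<dots> \<le> (L + 1) * h" using yh[of l] h by (intro mult_right_mono) auto
      finally show ?thesis
        unfolding power_mult_distrib[symmetric] using t0[of l] by (intro power_mono) auto
    qed
    ultimately show "\<bar>1 - s l - exp (- t l)\<bar> \<le> ((C + C * L + 1) + (L + 1)\<^sup>2) * h\<^sup>2"
      using exp_minus_linear[OF t0[of l]] by (simp add: algebra_simps abs_le_iff)
  qed
  also have "\<dots> = real (K - j) * h * (((C + C * L + 1) + (L + 1)\<^sup>2) * h)"
    by (simp add: power2_eq_square)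
  also have "\<dots> \<le> L * (((C + C * L + 1) + (L + 1)\<^sup>2) * h)"
  proof (intro mult_right_mono)
    have "real (K - j) * h \<le> real K * h" using h by (intro mult_right_mono) auto
    with h(3) show "real (K - j) * h \<le> L" by linarith
  qed (use C L h in auto)
  finally have 1: "\<bar>surv K p j y - (\<Prod>l\<in>{j<..K}. exp (- t l))\<bar> \<le> L * ((C + C * L + 1) + (L + 1)\<^sup>2) * h"
    by (simp add: surv_def s_def mult_ac)
  define m where "m = real (y - j)"
  have "2 * (\<Sum>l\<in>{j<..K}. real (y - l)) = m * (m - 1)"
  proof -
    have "2 * (\<Sum>l\<in>{j<..K}. real (y - l)) = real (2 * (\<Sum>l\<in>{j<..K}. y - l))" by simp
    also have "\<dots> = m * (m - 1)"
      unfolding sum_triangle[OF j y] m_def by (cases "y - j") (auto simp: algebra_simps)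
    finally show ?thesis .
  qed
  then have sumt: "(\<Sum>l\<in>{j<..K}. t l) = h\<^sup>2 * (m * (m - 1) / 2)"
    by (simp add: t_def flip: sum_distrib_left)
  have "(\<Prod>l\<in>{j<..K}. exp (- t l)) = exp (- (\<Sum>l\<in>{j<..K}. t l))"
    by (simp add: exp_sum flip: sum_negf)
  also have "\<bar>\<dots> - exp (- ((m * h)\<^sup>2 / 2))\<bar> \<le> \<bar>(\<Sum>l\<in>{j<..K}. t l) - (m * h)\<^sup>2 / 2\<bar>"
    using t0 by (intro exp_minus_diff_le sum_nonneg) auto
  also have "\<dots> = (m * h) * h / 2"
    unfolding sumt using h by (simp add: power2_eq_square field_simps m_def)
  also have "\<dots> \<le> (L + 1) * h"
    using mult_right_mono[OF yh[of j], of h] h L by (simp add: m_def)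
  finally have "\<bar>(\<Prod>l\<in>{j<..K}. exp (- t l)) - no_lower (m * h)\<bar> \<le> (L + 1) * h"
    by (simp add: no_lower_def)
  with 1 show ?thesis
    unfolding m_def distrib_right[of _ _ h] by linarith
qed

context threshold
begin

text \<open>
  Truncated subtraction gives distance \<open>0\<close>, hence value \<open>0\<close>, once the running minimum is at most the current
  time and cannot be undercut any more.
\<close>

definition grid_value :: "real \<Rightarrow> nat \<Rightarrow> nat \<Rightarrow> real" where
  "grid_value h j k = cont_value (real (k - j) * h)"

lemma sum_opt_value_near:
  assumes A: "\<And>x h. 0 \<le> h \<Longrightarrow> h \<le> x \<Longrightarrow> x \<le> b \<Longrightarrow>
       \<bar>opt_int x - opt_int (x - h) - h * opt_value x\<bar> \<le> A * h\<^sup>2"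
    and h: "0 < h" and m: "real m * h \<le> b"
  shows "\<bar>opt_int (real m * h) - (\<Sum>i\<in>{1..m}. h * opt_value (real i * h))\<bar> \<le> real m * (A * h\<^sup>2)"
  using m
proof (induction m)
  case (Suc m)
  have mh: "real m * h \<le> b" using Suc.prems h by (simp add: distrib_right)
  have "\<bar>opt_int (real (Suc m) * h) - opt_int (real (Suc m) * h - h) - h * opt_value (real (Suc m) * h)\<bar> \<le> A * h\<^sup>2"
    using Suc.prems h by (intro A) (auto simp: distrib_right)
  moreover have "real (Suc m) * h - h = real m * h" by (simp add: algebra_simps)
  ultimately show ?case
    using Suc.IH[OF mh] by (simp add: algebra_simps abs_le_iff)
qed simp

text \<open>
  The Bellman equation on the grid. The sum over new marks is \<open>h\<close> times a Riemann sum for \<open>opt_int\<close>, the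
  distance drops by \<open>h\<close>, and the differential equation for \<open>cont_value\<close> cancels all terms of order \<open>h\<close>. The
  reward \<open>u\<close> is only required to be \<open>O(h)\<close>-close to \<open>opt_value\<close>: each mark has probability \<open>O(h\<^sup>2)\<close> and there are
  \<open>O(1/h)\<close> of them, so this costs \<open>O(h\<^sup>2)\<close>. One lemma therefore serves both the supremum over rules and the cutoff
  rule.
\<close>

lemma grid_step:
  assumes C: "0 \<le> C" and D: "0 \<le> D" and L: "0 \<le> L"
  shows "\<exists>B\<ge>0. \<forall>p K h u j k. near_uniform L C p K h \<longrightarrow> j < K \<longrightarrow> k \<le> Suc K \<longrightarrow>
     (\<forall>y\<in>{Suc j..K}. \<bar>u y - opt_value (real (y - Suc j) * h)\<bar> \<le> D * h) \<longrightarrow>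
     \<bar>one_step K p (Suc j) u (grid_value h (Suc j)) k - grid_value h j k\<bar> \<le> B * h\<^sup>2"
proof -
  obtain A where A: "1 \<le> A"
    "\<And>d. d \<in> {0..L+1} \<Longrightarrow> \<bar>cont_value d\<bar> \<le> A" "\<And>d. d \<in> {0..L+1} \<Longrightarrow> \<bar>opt_value d\<bar> \<le> A"
    "\<And>x y. x \<in> {0..L+1} \<Longrightarrow> y \<in> {0..L+1} \<Longrightarrow> \<bar>cont_value x - cont_value y\<bar> \<le> A * \<bar>x - y\<bar>"
    "\<And>x y. x \<in> {0..L+1} \<Longrightarrow> y \<in> {0..L+1} \<Longrightarrow> \<bar>opt_int x - opt_int y\<bar> \<le> A * \<bar>x - y\<bar>"
    "\<And>x h. 0 \<le> h \<Longrightarrow> h \<le> x \<Longrightarrow> x \<le> L+1 \<Longrightarrow>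
       \<bar>cont_value (x - h) - (cont_value x - h * (opt_int x - x * cont_value x))\<bar> \<le> A * h\<^sup>2"
    "\<And>x h. 0 \<le> h \<Longrightarrow> h \<le> x \<Longrightarrow> x \<le> L+1 \<Longrightarrow>
       \<bar>opt_int x - opt_int (x - h) - h * opt_value x\<bar> \<le> A * h\<^sup>2"
    by (rule regularity[of "L + 1"]) (rule that)
  \<comment> \<open>a bound for \<open>u y - v\<close>, the change of value caused by a mark\<close>
  define W where "W = A + D + A"
  define B where "B = C * W + L * (C * W + D) + 2 * A + (L + 1) * A + A + A + ((L + 1) * A + A)"
  have W: "0 \<le> W" using A(1) D by (simp add: W_def)
  show ?thesis
  proof (intro exI[of _ B] conjI allI impI)
    show "0 \<le> B"
      unfolding B_def using A(1) C D L W by (intro add_nonneg_nonneg mult_nonneg_nonneg) auto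
    fix p K h u j k
    assume nu: "near_uniform L C p K h" and j: "j < K" and k: "k \<le> Suc K"
      and u: "\<forall>y\<in>{Suc j..K}. \<bar>u y - opt_value (real (y - Suc j) * h)\<bar> \<le> D * h"
    have h: "0 < h" "h \<le> 1" "real K * h \<le> L" using nu by (auto simp: near_uniform_def)
    have p0: "p (Suc j) y = 0" if "y < Suc j" for y
      using nu j that by (auto simp: near_uniform_def)
    show "\<bar>one_step K p (Suc j) u (grid_value h (Suc j)) k - grid_value h j k\<bar> \<le> B * h\<^sup>2"
    proof (cases "k \<le> j")
      case True
      then have "(\<Sum>y\<le>min k K. p (Suc j) y * (u y - grid_value h (Suc j) k)) = 0"
        by (intro sum.neutral) (auto simp: p0)
      with True \<open>0 \<le> B\<close> show ?thesis by (simp add: one_step_def grid_value_def)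
    next
      case False
      define d where "d = real (k - j) * h"
      define m where "m = k - Suc j"
      have km: "k = Suc j + m" using False by (simp add: m_def)
      have dm: "real m * h = d - h" using False by (simp add: d_def m_def of_nat_diff algebra_simps)
      have ih: "real i * h \<le> L + 1" if "i \<le> Suc K" for i
      proof -
        have "real i * h \<le> (real K + 1) * h" using that h by (intro mult_right_mono) auto
        with h show ?thesis by (simp add: distrib_right)
      qed
      have "0 \<le> real m * h" using h by simp
      then have d: "h \<le> d" "d \<le> L + 1" "0 \<le> d - h"
        using ih[of "k - j"] k dm by (auto simp: d_def)
      define v where "v = cont_value (d - h)"
      have gv: "grid_value h (Suc j) k = v" "grid_value h j k = cont_value d"
        using dm by (auto simp: grid_value_def v_def d_def m_def)
      have v: "\<bar>v\<bar> \<le> A" unfolding v_def using d h by (intro A(2)) auto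
      let ?U = "\<lambda>y. opt_value (real (y - Suc j) * h)"
      have U: "\<bar>?U y\<bar> \<le> A" if "y \<le> Suc K" for y
        using ih[of "y - Suc j"] that h by (intro A(3)) auto
      have w: "\<bar>u y - v\<bar> \<le> W" if "y \<in> {Suc j..K}" for y
      proof -
        have "D * h \<le> D" using D h by (simp add: mult_left_le)
        with u that U[of y] v show ?thesis unfolding W_def by force
      qed
      define S where "S = (\<Sum>y\<in>{Suc j<..min k K}. p (Suc j) y * (u y - v))"
      \<comment> \<open>\<open>T\<close> idealises the probabilities and rewards in \<open>S\<close>; \<open>T'\<close> adds the term \<open>k = K + 1\<close>, which no mark reaches\<close>
      define T where "T = (\<Sum>y\<in>{Suc j<..min k K}. h\<^sup>2 * (?U y - v))"
      define T' where "T' = (\<Sum>y\<in>{Suc j<..k}. h\<^sup>2 * (?U y - v))"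
      have 1: "\<bar>(\<Sum>y\<le>min k K. p (Suc j) y * (u y - v)) - S\<bar> \<le> C * W * h\<^sup>2"
      proof -
        have "(\<Sum>y\<le>min k K. p (Suc j) y * (u y - v)) = (\<Sum>y\<in>{Suc j..min k K}. p (Suc j) y * (u y - v))"
          by (intro sum.mono_neutral_right) (auto simp: p0 not_le)
        also have "\<dots> = p (Suc j) (Suc j) * (u (Suc j) - v) + S"
          unfolding S_def using False j by (subst sum.remove[of _ "Suc j"]) (auto intro!: sum.cong)
        finally have "\<bar>(\<Sum>y\<le>min k K. p (Suc j) y * (u y - v)) - S\<bar> = p (Suc j) (Suc j) * \<bar>u (Suc j) - v\<bar>"
          using nu j by (auto simp: abs_mult near_uniform_def)
        also have "\<dots> \<le> (C * h\<^sup>2) * W"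
          using nu j w[of "Suc j"] C by (intro mult_mono) (auto simp: near_uniform_def)
        finally show ?thesis by (simp add: mult_ac)
      qed
      have 2: "\<bar>S - T\<bar> \<le> L * (C * W + D) * h\<^sup>2"
      proof -
        have "\<bar>S - T\<bar> \<le> (\<Sum>y\<in>{Suc j<..min k K}. (C * W + D) * h ^ 3)"
          unfolding S_def T_def sum_subtractf[symmetric]
        proof (intro order_trans[OF sum_abs] sum_mono)
          fix y assume y: "y \<in> {Suc j<..min k K}"
          have "\<bar>(p (Suc j) y - h\<^sup>2) * (u y - v)\<bar> \<le> (C * h ^ 3) * W"
            unfolding abs_mult using nu j y w[of y] C h
            by (intro mult_mono) (auto simp: near_uniform_def)
          moreover have "\<bar>h\<^sup>2 * (u y - ?U y)\<bar> \<le> h\<^sup>2 * (D * h)"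
            unfolding abs_mult using u y by (intro mult_mono) auto
          moreover have "p (Suc j) y * (u y - v) - h\<^sup>2 * (?U y - v) =
              (p (Suc j) y - h\<^sup>2) * (u y - v) + h\<^sup>2 * (u y - ?U y)"
            by (simp add: algebra_simps)
          ultimately have "\<bar>p (Suc j) y * (u y - v) - h\<^sup>2 * (?U y - v)\<bar> \<le> (C * h ^ 3) * W + h\<^sup>2 * (D * h)"
            by linarith
          then show "\<bar>p (Suc j) y * (u y - v) - h\<^sup>2 * (?U y - v)\<bar> \<le> (C * W + D) * h ^ 3"
            by (simp add: power2_eq_square power3_eq_cube algebra_simps)
        qed
        also have "\<dots> = real (min k K - Suc j) * ((C * W + D) * h ^ 3)" by simp
        also have "\<dots> \<le> real K * ((C * W + D) * h ^ 3)"
          using C W D h by (intro mult_right_mono mult_nonneg_nonneg add_nonneg_nonneg) auto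
        also have "\<dots> = (real K * h) * ((C * W + D) * h\<^sup>2)" by (simp add: power2_eq_square power3_eq_cube)
        also have "\<dots> \<le> L * ((C * W + D) * h\<^sup>2)"
          using h C W D by (intro mult_right_mono mult_nonneg_nonneg add_nonneg_nonneg) auto
        finally show ?thesis by (simp add: mult_ac)
      qed
      have 3: "\<bar>T - T'\<bar> \<le> 2 * A * h\<^sup>2"
      proof (cases "k = Suc K")
        case True
        have "{Suc j<..k} = insert k {Suc j<..min k K}" using True j by auto
        then have "T' = T + h\<^sup>2 * (?U k - v)"
          unfolding T_def T'_def using True by simp
        then have "\<bar>T - T'\<bar> = \<bar>?U k - v\<bar> * h\<^sup>2" by (simp add: abs_mult)
        also have "\<dots> \<le> (2 * A) * h\<^sup>2" using U[of k] v k by (intro mult_right_mono) auto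
        finally show ?thesis .
      next
        case False
        with k have "min k K = k" by auto
        then show ?thesis using A(1) by (simp add: T_def T'_def)
      qed
      have T': "T' = h * (\<Sum>i\<in>{1..m}. h * opt_value (real i * h)) - h * (d - h) * v"
      proof -
        have "T' = (\<Sum>i\<in>{1..m}. h\<^sup>2 * (opt_value (real i * h) - v))"
          unfolding T'_def
          by (rule sum.reindex_bij_witness[of _ "\<lambda>i. i + Suc j" "\<lambda>y. y - Suc j"]) (auto simp: km)
        also have "\<dots> = h * (\<Sum>i\<in>{1..m}. h * opt_value (real i * h)) - h * (real m * h) * v"
          by (simp add: right_diff_distrib sum_subtractf sum_distrib_left power2_eq_square mult_ac)
        finally show ?thesis by (simp add: dm)
      qed
      have 4: "\<bar>h * opt_int (d - h) - h * (\<Sum>i\<in>{1..m}. h * opt_value (real i * h))\<bar> \<le> (L + 1) * A * h\<^sup>2"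
      proof -
        have "\<bar>opt_int (d - h) - (\<Sum>i\<in>{1..m}. h * opt_value (real i * h))\<bar> \<le> real m * (A * h\<^sup>2)"
        proof -
          have "real m * h \<le> L + 1" using dm d h by linarith
          from sum_opt_value_near[OF A(7) h(1) this] show ?thesis by (simp add: dm)
        qed
        also have "\<dots> = (real m * h) * (A * h)" by (simp add: power2_eq_square)
        also have "\<dots> \<le> (L + 1) * (A * h)" using d dm h A(1) by (intro mult_right_mono) auto
        finally have "h * \<bar>opt_int (d - h) - (\<Sum>i\<in>{1..m}. h * opt_value (real i * h))\<bar> \<le> h * ((L + 1) * (A * h))"
          using h by (intro mult_left_mono) auto
        then show ?thesis
          using h by (simp add: abs_mult power2_eq_square mult_ac flip: right_diff_distrib)
      qed
      have 5: "\<bar>v - (cont_value d - h * (opt_int d - d * cont_value d))\<bar> \<le> A * h\<^sup>2"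
        unfolding v_def using d h by (intro A(6)) auto
      have 6: "\<bar>h * opt_int (d - h) - h * opt_int d\<bar> \<le> A * h\<^sup>2"
      proof -
        have "\<bar>opt_int (d - h) - opt_int d\<bar> \<le> A * \<bar>(d - h) - d\<bar>" using d h by (intro A(5)) auto
        then have "h * \<bar>opt_int (d - h) - opt_int d\<bar> \<le> h * (A * h)"
          using h by (intro mult_left_mono) auto
        then show ?thesis
          using h by (simp add: abs_mult power2_eq_square mult_ac flip: right_diff_distrib)
      qed
      have 7: "\<bar>h * (d * cont_value d) - h * (d - h) * v\<bar> \<le> ((L + 1) * A + A) * h\<^sup>2"
      proof -
        have "\<bar>cont_value d - v\<bar> \<le> A * \<bar>d - (d - h)\<bar>" unfolding v_def using d h by (intro A(4)) auto
        then have "d * \<bar>cont_value d - v\<bar> \<le> (L + 1) * (A * h)"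
          using d h by (intro mult_mono) auto
        then have a: "\<bar>d * (cont_value d - v)\<bar> \<le> (L + 1) * (A * h)"
          using d h by (simp add: abs_mult)
        have b: "\<bar>h * v\<bar> \<le> A * h" using v h by (simp add: abs_mult mult.commute)
        have "d * cont_value d - (d - h) * v = d * (cont_value d - v) + h * v" by (simp add: algebra_simps)
        with a b have "\<bar>d * cont_value d - (d - h) * v\<bar> \<le> (L + 1) * (A * h) + A * h" by linarith
        then have "h * \<bar>d * cont_value d - (d - h) * v\<bar> \<le> h * ((L + 1) * (A * h) + A * h)"
          using h by (intro mult_left_mono) auto
        moreover have "h * \<bar>d * cont_value d - (d - h) * v\<bar> = \<bar>h * (d * cont_value d) - h * (d - h) * v\<bar>"
        proof -
          have "h * (d * cont_value d) - h * (d - h) * v = h * (d * cont_value d - (d - h) * v)"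
            by (simp add: algebra_simps)
          with h show ?thesis by (simp only: abs_mult abs_of_pos)
        qed
        ultimately show ?thesis by (simp add: algebra_simps power2_eq_square)
      qed
      have "\<bar>v + (\<Sum>y\<le>min k K. p (Suc j) y * (u y - v)) - cont_value d\<bar>
         \<le> C * W * h\<^sup>2 + L * (C * W + D) * h\<^sup>2 + 2 * A * h\<^sup>2 + (L + 1) * A * h\<^sup>2 + A * h\<^sup>2 + A * h\<^sup>2 + ((L + 1) * A + A) * h\<^sup>2"
      proof -
        have triangle: "\<bar>v + q - w\<bar> \<le> e1 + e2 + e3 + e4 + e5 + e6 + e7"
          if "\<bar>q - s\<bar> \<le> e1" "\<bar>s - t\<bar> \<le> e2" "\<bar>t - t'\<bar> \<le> e3" "t' = x1 - x5" "\<bar>x2 - x1\<bar> \<le> e4"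
            "\<bar>v - (w - (x3 - x4))\<bar> \<le> e5" "\<bar>x2 - x3\<bar> \<le> e6" "\<bar>x4 - x5\<bar> \<le> e7"
          for q s t t' x1 x2 x3 x4 x5 v w e1 e2 e3 e4 e5 e6 e7 :: real
          using that by linarith
        show ?thesis
          by (rule triangle[OF 1 2 3 T' 4 5[unfolded right_diff_distrib[of h]] 6 7])
      qed
      also have "\<dots> = B * h\<^sup>2"
        unfolding B_def by (simp only: distrib_right)
      finally show ?thesis unfolding one_step_def gv .
    qed
  qed
qed

definition cutoff_cells :: "real \<Rightarrow> nat" where
  "cutoff_cells h = nat \<lfloor>c / h\<rfloor>"

lemma le_cutoff_cells: "0 < h \<Longrightarrow> m \<le> cutoff_cells h \<longleftrightarrow> real m * h \<le> c"
  using c_pos by (simp add: cutoff_cells_def le_nat_iff le_floor_iff pos_le_divide_eq)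

text \<open>
  A constant that works simultaneously for all near-uniform families at all scales \<open>h\<close>; the limit \<open>h \<rightarrow> 0\<close>
  needs this uniformity.
\<close>

definition error_bound :: "real \<Rightarrow> real \<Rightarrow> real \<Rightarrow> bool" where
  "error_bound L C B \<longleftrightarrow> 0 \<le> B \<and> (\<forall>p K h. near_uniform L C p K h \<longrightarrow>
     (\<forall>j\<le>K. \<forall>y\<le>Suc K. \<bar>surv K p j y - no_lower (real (y - j) * h)\<bar> \<le> B * h) \<and>
     (\<forall>k\<le>Suc K. grid_value h K k \<le> B * h) \<and>
     (\<forall>j k. j < K \<longrightarrow> k \<le> Suc K \<longrightarrow>
       \<bar>one_step K p (Suc j) (\<lambda>y. max (surv K p (Suc j) y) (grid_value h (Suc j) y))
          (grid_value h (Suc j)) k - grid_value h j k\<bar> \<le> B * h\<^sup>2 \<and>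
       \<bar>one_step K p (Suc j)
          (\<lambda>y. if y \<le> Suc j + cutoff_cells h then surv K p (Suc j) y else grid_value h (Suc j) y)
          (grid_value h (Suc j)) k - grid_value h j k\<bar> \<le> B * h\<^sup>2))"

lemma error_bound_exists:
  assumes C: "0 \<le> C" and L: "0 \<le> L"
  shows "\<exists>B. error_bound L C B"
proof -
  define D where "D = L * ((C + C * L + 1) + (L + 1)\<^sup>2) + (L + 1)"
  have D: "0 \<le> D" unfolding D_def using C L by (intro add_nonneg_nonneg mult_nonneg_nonneg) auto
  obtain B where B: "0 \<le> B" "\<forall>p K h u j k. near_uniform L C p K h \<longrightarrow> j < K \<longrightarrow> k \<le> Suc K \<longrightarrow>
     (\<forall>y\<in>{Suc j..K}. \<bar>u y - opt_value (real (y - Suc j) * h)\<bar> \<le> D * h) \<longrightarrow>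
     \<bar>one_step K p (Suc j) u (grid_value h (Suc j)) k - grid_value h j k\<bar> \<le> B * h\<^sup>2"
    using grid_step[OF C D L] by blast
  obtain A where A: "1 \<le> A"
    "\<And>x y. x \<in> {0..1} \<Longrightarrow> y \<in> {0..1} \<Longrightarrow> \<bar>cont_value x - cont_value y\<bar> \<le> A * \<bar>x - y\<bar>"
    by (rule regularity[of 1]) (rule that)
  let ?B = "B + D + A"
  have "error_bound L C ?B"
    unfolding error_bound_def
  proof (intro conjI allI impI)
    show "0 \<le> ?B" using A B D by simp
    fix p K h assume nu: "near_uniform L C p K h"
    have h: "0 < h" "h \<le> 1" using nu by (auto simp: near_uniform_def)
    have D': "D * h \<le> ?B * h" "A * h \<le> ?B * h" "B * h\<^sup>2 \<le> ?B * h\<^sup>2"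
      using A B D h by (auto intro!: mult_right_mono)
    have s: "\<bar>surv K p j y - no_lower (real (y - j) * h)\<bar> \<le> D * h" if "j \<le> K" "y \<le> Suc K" for j y
      unfolding D_def by (rule surv_near[OF nu C that])
    show "\<bar>surv K p j y - no_lower (real (y - j) * h)\<bar> \<le> ?B * h" if "j \<le> K" "y \<le> Suc K" for j y
      using s[OF that] D'(1) by linarith
    show "grid_value h K k \<le> ?B * h" if "k \<le> Suc K" for k
    proof -
      have kh: "real (k - K) * h \<in> {0..1}" "real (k - K) * h \<le> h"
        using that h by (auto simp: mult_le_one)
      have "grid_value h K k \<le> A * (real (k - K) * h)"
        using A(2)[OF kh(1), of 0] kh by (simp add: grid_value_def)
      also have "\<dots> \<le> A * h" using kh A by (intro mult_left_mono) auto
      finally show ?thesis using D' by linarith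
    qed
    fix j k assume jk: "j < K" "k \<le> Suc K"
    show "\<bar>one_step K p (Suc j) (\<lambda>y. max (surv K p (Suc j) y) (grid_value h (Suc j) y))
          (grid_value h (Suc j)) k - grid_value h j k\<bar> \<le> ?B * h\<^sup>2"
    proof (rule order_trans[OF B(2)[rule_format, OF nu jk] D'(3)])
      fix y assume y: "y \<in> {Suc j..K}"
      have "opt_value (real (y - Suc j) * h) = max (no_lower (real (y - Suc j) * h)) (grid_value h (Suc j) y)"
        unfolding grid_value_def using h by (intro opt_value_eq_max) auto
      then show "\<bar>max (surv K p (Suc j) y) (grid_value h (Suc j) y) - opt_value (real (y - Suc j) * h)\<bar> \<le> D * h"
        using s[of "Suc j" y] jk y by (auto simp: max_def abs_le_iff split: if_splits)
    qed
    show "\<bar>one_step K p (Suc j)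
          (\<lambda>y. if y \<le> Suc j + cutoff_cells h then surv K p (Suc j) y else grid_value h (Suc j) y)
          (grid_value h (Suc j)) k - grid_value h j k\<bar> \<le> ?B * h\<^sup>2"
    proof (rule order_trans[OF B(2)[rule_format, OF nu jk] D'(3)])
      fix y assume y: "y \<in> {Suc j..K}"
      have "y \<le> Suc j + cutoff_cells h \<longleftrightarrow> real (y - Suc j) * h \<le> c"
        using le_cutoff_cells[OF h(1), of "y - Suc j"] y by auto
      then show "\<bar>(if y \<le> Suc j + cutoff_cells h then surv K p (Suc j) y else grid_value h (Suc j) y) - opt_value (real (y - Suc j) * h)\<bar> \<le> D * h"
        using s[of "Suc j" y] jk y h D by (auto simp: opt_value_def grid_value_def)
    qed
  qed
  then show ?thesis by blast
qed

lemma slots_upper: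
  assumes sl: "slots M F Y K p" and nu: "near_uniform L C p K h" and B: "error_bound L C B"
    and A: "\<And>j. j \<in> {1..K} \<Longrightarrow> A j \<in> sets (F j)" "disjoint_family_on A {1..K}"
  shows "(\<Sum>j=1..K. measure M (A j \<inter> slots.overall_min M Y K j)) \<le> cont_value (real (Suc K) * h) + L * B * h"
proof -
  interpret slots M F Y K p by fact
  have h: "0 < h" "real K * h \<le> L" and B0: "0 \<le> B"
    using nu B by (auto simp: near_uniform_def error_bound_def)
  have "(\<Sum>j=1..K. measure M (A j \<inter> overall_min j)) \<le> grid_value h 0 (Suc K) + real K * (B * h\<^sup>2)"
  proof (rule prob_stop_at_min_le[OF A])
    show "0 \<le> grid_value h j k" for j k
      using h by (auto simp: grid_value_def intro!: cont_value_nonneg)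
    show "one_step K p (Suc j) (\<lambda>y. max (surv K p (Suc j) y) (grid_value h (Suc j) y))
        (grid_value h (Suc j)) k \<le> grid_value h j k + B * h\<^sup>2"
      if "j < K" "k \<le> Suc K" for j k
      using B nu that unfolding error_bound_def abs_le_iff by fastforce
  qed (use B0 in auto)
  also have "real K * (B * h\<^sup>2) = (real K * h) * (B * h)" by (simp add: power2_eq_square)
  also have "\<dots> \<le> L * (B * h)" using h B0 by (intro mult_right_mono) auto
  finally show ?thesis by (simp add: grid_value_def mult_ac)
qed

lemma slots_lower:
  assumes sl: "slots M F Y K p" and nu: "near_uniform L C p K h" and B: "error_bound L C B"
  shows "cont_value (real (Suc K) * h) - (L + 1) * B * h
    \<le> (\<Sum>j=1..K. measure M (slots.cutoff_stop M Y K (cutoff_cells h) j \<inter> slots.overall_min M Y K j))"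
proof -
  interpret slots M F Y K p by fact
  have h: "0 < h" "real K * h \<le> L" and B0: "0 \<le> B"
    using nu B by (auto simp: near_uniform_def error_bound_def)
  have "grid_value h 0 (Suc K) - real K * (B * h\<^sup>2) - B * h
    \<le> (\<Sum>j=1..K. measure M (cutoff_stop (cutoff_cells h) j \<inter> overall_min j))"
  proof (rule prob_cutoff_ge)
    show "grid_value h j k \<le> one_step K p (Suc j)
        (\<lambda>y. if y \<le> Suc j + cutoff_cells h then surv K p (Suc j) y else grid_value h (Suc j) y)
        (grid_value h (Suc j)) k + B * h\<^sup>2"
      if "j < K" "k \<le> Suc K" for j k
      using B nu that unfolding error_bound_def abs_le_iff by fastforce
    show "grid_value h K k \<le> B * h" if "k \<le> Suc K" for k
      using B nu that unfolding error_bound_def by blast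
  qed (use B0 h in auto)
  moreover have "real K * (B * h\<^sup>2) = (real K * h) * (B * h)" by (simp add: power2_eq_square)
  moreover have "(real K * h) * (B * h) \<le> L * (B * h)" using h B0 by (intro mult_right_mono) auto
  moreover have "grid_value h 0 (Suc K) = cont_value (real (Suc K) * h)" by (simp add: grid_value_def)
  moreover have "(L + 1) * B * h = L * (B * h) + B * h" by (simp add: algebra_simps)
  ultimately show ?thesis by linarith
qed

lemma slots_no_low:
  assumes sl: "slots M F Y K p" and nu: "near_uniform L C p K h" and B: "error_bound L C B"
  shows "measure M {w \<in> space M. \<forall>l\<in>{1..K}. Suc K \<le> Y l w} \<le> no_lower (real (Suc K) * h) + B * h"
proof -
  interpret slots M F Y K p by fact
  have "\<bar>surv K p 0 (Suc K) - no_lower (real (Suc K - 0) * h)\<bar> \<le> B * h"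
    using B nu unfolding error_bound_def by blast
  then show ?thesis
    unfolding prob_no_low by simp
qed

definition value_inf :: real where
  "value_inf = no_lower c + slope * (sqrt (pi / 2) - gauss_int c)"

end

text \<open>
  The order of limits: \<open>L\<close> is chosen first, to make \<open>e L\<close> small, and the constant \<open>D\<close> may depend on \<open>L\<close>.
\<close>

lemma eventually_less_two_limits:
  fixes f h :: "nat \<Rightarrow> real" and e :: "real \<Rightarrow> real"
  assumes "\<And>L. L0 \<le> L \<Longrightarrow> \<exists>D. \<forall>\<^sub>F n in sequentially. f n \<le> e L + D * h n"
    and e: "(e \<longlongrightarrow> 0) at_top" and h: "h \<longlonglongrightarrow> 0" and r: "0 < r"
  shows "\<forall>\<^sub>F n in sequentially. f n < r"
proof -
  have "\<forall>\<^sub>F L in at_top. e L < r / 2 \<and> L0 \<le> L"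
    using order_tendstoD(2)[OF e, of "r / 2"] r eventually_ge_at_top[of L0] by (auto intro: eventually_conj)
  then obtain L where L: "e L < r / 2" "L0 \<le> L"
    using eventually_happens[of _ "at_top :: real filter"] by auto
  obtain D where D: "\<forall>\<^sub>F n in sequentially. f n \<le> e L + D * h n"
    using assms(1)[OF L(2)] by blast
  have "(\<lambda>n. D * h n) \<longlonglongrightarrow> 0"
    using tendsto_mult_right_zero[OF h] .
  then have "\<forall>\<^sub>F n in sequentially. D * h n < r / 2"
    using r by (intro order_tendstoD(2)) auto
  with D show ?thesis
    by eventually_elim (use L in linarith)
qed

section \<open>The constant and the optimal value\<close>

definition odd_prod :: "nat \<Rightarrow> real" where
  "odd_prod k = (\<Prod>i\<le>k. 2 * real i + 1)"

lemma odd_prod_0 [simp]: "odd_prod 0 = 1"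
  by (simp add: odd_prod_def)

lemma odd_prod_Suc: "odd_prod (Suc k) = odd_prod k * (2 * real k + 3)"
  by (simp add: odd_prod_def algebra_simps)

lemma odd_prod_pos [simp]: "0 < odd_prod k"
  unfolding odd_prod_def by (intro prod_pos) auto

definition odd_poly :: "nat \<Rightarrow> real \<Rightarrow> real" where
  "odd_poly N u = (\<Sum>k\<le>N. u ^ (2 * k + 1) / odd_prod k)"

text \<open>
  \<open>exp (u\<^sup>2 / 2) * gauss_int u\<close> solves \<open>G' = 1 + u * G\<close>. The truncated series solves this equation up to its
  last term, so the truncation error is an integral of a single power.
\<close>

lemma DERIV_odd_poly:
  "((\<lambda>u. no_lower u * odd_poly N u) has_real_derivative
     no_lower u * (1 - u ^ (2 * N + 2) / odd_prod N)) (at u)"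
proof (induction N)
  case 0
  show ?case
    by (auto simp: odd_poly_def power2_eq_square algebra_simps intro!: derivative_eq_intros)
next
  case (Suc N)
  have "((\<lambda>u. no_lower u * (u ^ (2 * N + 3) / odd_prod (Suc N))) has_real_derivative
     no_lower u * (u ^ (2 * N + 2) / odd_prod N) - no_lower u * (u ^ (2 * N + 4) / odd_prod (Suc N))) (at u)"
  proof -
    have D: "((\<lambda>u. no_lower u * (u ^ (2 * N + 3) / odd_prod (Suc N))) has_real_derivative
        - u * no_lower u * 1 * (u ^ (2 * N + 3) / odd_prod (Suc N))
        + real (2 * N + 3) * u ^ (2 * N + 3 - Suc 0) / odd_prod (Suc N) * no_lower u) (at u)"
      by (intro DERIV_mult DERIV_no_lower DERIV_ident DERIV_cdivide DERIV_pow)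
    have q: "real (2 * N + 3) * u ^ (2 * N + 3 - Suc 0) / odd_prod (Suc N) = u ^ (2 * N + 2) / odd_prod N"
    proof -
      have "real (2 * N + 3) = 2 * real N + 3" "2 * N + 3 - Suc 0 = 2 * N + 2" "2 * real N + 3 \<noteq> 0" by linarith+
      then show ?thesis
        by (simp only: odd_prod_Suc mult.commute[of "2 * real N + 3"] mult_divide_mult_cancel_right
            not_False_eq_True simp_thms)
    qed
    have pow: "u * u ^ (2 * N + 3) = u ^ (2 * N + 4)" by (simp add: eval_nat_numeral)
    have "- u * a * 1 * (x / y) + w * a = a * w - a * (u * x / y)" for a x y w :: real
      by (simp add: algebra_simps)
    from D[unfolded q this pow] show ?thesis .
  qed
  note D = DERIV_add[OF Suc this]
  have e: "2 * Suc N + 1 = 2 * N + 3" "2 * Suc N + 2 = 2 * N + 4" by auto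
  have "odd_poly (Suc N) u = odd_poly N u + u ^ (2 * N + 3) / odd_prod (Suc N)" for u
    unfolding odd_poly_def by (simp only: sum.atMost_Suc e)
  then show ?case
    using D by (simp only: e distrib_left) (simp add: right_diff_distrib)
qed

lemma power_deriv_bound:
  fixes f :: "real \<Rightarrow> real"
  assumes f: "\<And>u. 0 \<le> u \<Longrightarrow> u \<le> d \<Longrightarrow> (f has_real_derivative f' u) (at u)"
    and b: "\<And>u. 0 \<le> u \<Longrightarrow> u \<le> d \<Longrightarrow> 0 \<le> f' u" "\<And>u. 0 \<le> u \<Longrightarrow> u \<le> d \<Longrightarrow> f' u \<le> C * u ^ n"
    and d: "0 \<le> d" and f0: "f 0 = 0"
  shows "0 \<le> f d" "f d \<le> C * d ^ Suc n / real (Suc n)"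
proof -
  have "f 0 \<le> f d"
    using d f b by (intro DERIV_nonneg_imp_nondecreasing[of 0 d f]) blast+
  with f0 show "0 \<le> f d" by simp
  have "C * 0 ^ Suc n / real (Suc n) - f 0 \<le> C * d ^ Suc n / real (Suc n) - f d"
  proof (rule DERIV_nonneg_imp_nondecreasing[OF d, of "\<lambda>u. C * u ^ Suc n / real (Suc n) - f u"])
    fix u assume u: "0 \<le> u" "u \<le> d"
    have "((\<lambda>u. C * u ^ Suc n / real (Suc n) - f u) has_real_derivative C * u ^ n - f' u) (at u)"
      by (rule derivative_eq_intros f[OF u] refl | simp del: power_Suc of_nat_Suc)+
    with b(2)[OF u] show "\<exists>y. ((\<lambda>u. C * u ^ Suc n / real (Suc n) - f u) has_real_derivative y) (at u) \<and> 0 \<le> y"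
      by (intro exI[of _ "C * u ^ n - f' u"]) simp
  qed
  with f0 show "f d \<le> C * d ^ Suc n / real (Suc n)" by simp
qed

lemma gauss_int_near_poly:
  assumes "0 \<le> u"
  shows "0 \<le> gauss_int u - no_lower u * odd_poly N u"
    "gauss_int u - no_lower u * odd_poly N u \<le> u ^ (2 * N + 3) / odd_prod (Suc N)"
proof -
  have D: "((\<lambda>u. gauss_int u - no_lower u * odd_poly N u) has_real_derivative
      no_lower u * (u ^ (2 * N + 2) / odd_prod N)) (at u)" for u
    by (rule derivative_eq_intros DERIV_gauss_int DERIV_odd_poly refl)+ (simp add: algebra_simps)
  have b: "no_lower u * (u ^ (2 * N + 2) / odd_prod N) \<le> 1 / odd_prod N * u ^ (2 * N + 2)" if "0 \<le> u" for u
    using mult_right_mono[of "no_lower u" 1 "u ^ (2 * N + 2) / odd_prod N"] that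
    by (simp add: less_imp_le)
  have nn: "0 \<le> no_lower u * (u ^ (2 * N + 2) / odd_prod N)" if "0 \<le> u" for u
    using that by (intro mult_nonneg_nonneg divide_nonneg_pos) auto
  have z: "gauss_int 0 - no_lower 0 * odd_poly N 0 = 0"
    by (simp add: odd_poly_def)
  show "0 \<le> gauss_int u - no_lower u * odd_poly N u"
    by (rule power_deriv_bound(1)[where f = "\<lambda>u. gauss_int u - no_lower u * odd_poly N u", OF D nn b assms z])
  have "gauss_int u - no_lower u * odd_poly N u \<le> 1 / odd_prod N * u ^ Suc (2 * N + 2) / real (Suc (2 * N + 2))"
    by (rule power_deriv_bound(2)[where f = "\<lambda>u. gauss_int u - no_lower u * odd_poly N u", OF D nn b assms z])
  also have "\<dots> = u ^ (2 * N + 3) / odd_prod (Suc N)"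
    by (simp add: odd_prod_Suc eval_nat_numeral field_simps)
  finally show "gauss_int u - no_lower u * odd_poly N u \<le> u ^ (2 * N + 3) / odd_prod (Suc N)" .
qed

lemma mills_near_poly:
  assumes "0 \<le> u" "u\<^sup>2 / 2 \<le> 1"
  shows "odd_poly N u \<le> exp (u\<^sup>2 / 2) * gauss_int u"
    "exp (u\<^sup>2 / 2) * gauss_int u \<le> odd_poly N u + 3 * u ^ (2 * N + 3) / odd_prod (Suc N)"
proof -
  have eq: "exp (u\<^sup>2 / 2) * (gauss_int u - no_lower u * odd_poly N u) = exp (u\<^sup>2 / 2) * gauss_int u - odd_poly N u"
    using exp_no_lower[of u] by (simp add: algebra_simps)
  have "0 \<le> exp (u\<^sup>2 / 2) * (gauss_int u - no_lower u * odd_poly N u)"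
    using gauss_int_near_poly(1)[OF assms(1)] by (intro mult_nonneg_nonneg) auto
  then show "odd_poly N u \<le> exp (u\<^sup>2 / 2) * gauss_int u" unfolding eq by simp
  have "exp (u\<^sup>2 / 2) \<le> exp 1" using assms by simp
  then have "exp (u\<^sup>2 / 2) \<le> 3" using exp_le by linarith
  then have "exp (u\<^sup>2 / 2) * (gauss_int u - no_lower u * odd_poly N u) \<le> 3 * (u ^ (2 * N + 3) / odd_prod (Suc N))"
    using gauss_int_near_poly[OF assms(1)] by (intro mult_mono) auto
  then show "exp (u\<^sup>2 / 2) * gauss_int u \<le> odd_poly N u + 3 * u ^ (2 * N + 3) / odd_prod (Suc N)"
    unfolding eq by simp
qed

definition even_poly :: "nat \<Rightarrow> real \<Rightarrow> real" where
  "even_poly N z = (\<Sum>k\<le>N. (2 * z) ^ (k + 1) / ((2 * real k + 2) * odd_prod k))"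

lemma advantage_near_poly:
  assumes "0 \<le> d" "d\<^sup>2 / 2 \<le> 1"
  shows "even_poly N (d\<^sup>2 / 2) \<le> advantage d"
    "advantage d \<le> even_poly N (d\<^sup>2 / 2) + 3 * (d\<^sup>2) ^ (N + 2) / ((2 * real N + 4) * odd_prod (Suc N))"
proof -
  let ?f = "\<lambda>d. advantage d - (\<Sum>k\<le>N. d ^ (2 * k + 2) / ((2 * real k + 2) * odd_prod k))"
  let ?f' = "\<lambda>u. exp (u\<^sup>2 / 2) * gauss_int u - odd_poly N u"
  have S: "((\<lambda>d. \<Sum>k\<le>N. d ^ (2 * k + 2) / ((2 * real k + 2) * odd_prod k)) has_real_derivative odd_poly N u) (at u)" for u
    unfolding odd_poly_def
  proof (rule DERIV_sum)
    fix k
    have "((\<lambda>d. d ^ (2 * k + 2) / ((2 * real k + 2) * odd_prod k)) has_real_derivative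
        real (2 * k + 2) * u ^ (2 * k + 2 - Suc 0) / ((2 * real k + 2) * odd_prod k)) (at u)"
      by (intro DERIV_cdivide DERIV_pow)
    moreover have "real (2 * k + 2) * u ^ (2 * k + 2 - Suc 0) / ((2 * real k + 2) * odd_prod k) = u ^ (2 * k + 1) / odd_prod k"
    proof -
      have "real (2 * k + 2) = 2 * real k + 2" "2 * k + 2 - Suc 0 = 2 * k + 1" "2 * real k + 2 \<noteq> 0" by linarith+
      then show ?thesis by (simp only: mult_divide_mult_cancel_left not_False_eq_True simp_thms)
    qed
    ultimately show "((\<lambda>d. d ^ (2 * k + 2) / ((2 * real k + 2) * odd_prod k)) has_real_derivative u ^ (2 * k + 1) / odd_prod k) (at u)"
      by simp
  qed
  have D: "(?f has_real_derivative ?f' u) (at u)" for u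
    by (intro DERIV_diff DERIV_advantage S)
  have sq: "u\<^sup>2 / 2 \<le> 1" if "0 \<le> u" "u \<le> d" for u
  proof -
    have "u\<^sup>2 \<le> d\<^sup>2" using that by (intro power_mono)
    with assms(2) show ?thesis by linarith
  qed
  have nn: "0 \<le> ?f' u" if "0 \<le> u" "u \<le> d" for u
    using mills_near_poly(1)[OF that(1) sq[OF that]] by simp
  have b: "?f' u \<le> 3 / odd_prod (Suc N) * u ^ (2 * N + 3)" if "0 \<le> u" "u \<le> d" for u
    using mills_near_poly(2)[OF that(1) sq[OF that], of N] by (simp add: mult_ac)
  have z: "?f 0 = 0" by simp
  have eq: "(\<Sum>k\<le>N. d ^ (2 * k + 2) / ((2 * real k + 2) * odd_prod k)) = even_poly N (d\<^sup>2 / 2)"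
    unfolding even_poly_def by (intro sum.cong refl) (simp add: power_mult power_add power2_eq_square)
  have "0 \<le> ?f d"
    by (rule power_deriv_bound(1)[where f = ?f, OF D nn b assms(1) z])
  then show "even_poly N (d\<^sup>2 / 2) \<le> advantage d" unfolding eq by simp
  have "?f d \<le> 3 / odd_prod (Suc N) * d ^ Suc (2 * N + 3) / real (Suc (2 * N + 3))"
    by (rule power_deriv_bound(2)[where f = ?f, OF D nn b assms(1) z])
  also have "d ^ Suc (2 * N + 3) = (d\<^sup>2) ^ (N + 2)"
  proof -
    have "Suc (2 * N + 3) = 2 * (N + 2)" by simp
    then show ?thesis by (simp only: power_mult)
  qed
  finally show "advantage d \<le> even_poly N (d\<^sup>2 / 2) + 3 * (d\<^sup>2) ^ (N + 2) / ((2 * real N + 4) * odd_prod (Suc N))"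
    unfolding eq by (simp add: mult_ac add_ac)
qed

text \<open>
  The strict inequalities at two decimals enclose \<open>beta_star\<close> more tightly than stated in the theorem, because
  the bounds for \<open>optimal_value\<close> multiply the error of \<open>beta_star\<close> by about four.
\<close>

lemma advantage_lower: "advantage (sqrt (2 * 0.7606604)) < 1"
proof -
  have "advantage (sqrt (2 * 0.7606604)) \<le> even_poly 9 0.7606604
      + 3 * (2 * 0.7606604) ^ 11 / (22 * odd_prod 10)"
    using advantage_near_poly(2)[of "sqrt (2 * 0.7606604)" 9] by simp
  also have "\<dots> < 1"
    by (simp add: even_poly_def odd_prod_def atMost_nat_numeral power_divide)
  finally show ?thesis .
qed

lemma advantage_upper: "1 < advantage (sqrt (2 * 0.7606605))"
proof -
  have "1 < even_poly 9 0.7606605"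
    by (simp add: even_poly_def odd_prod_def atMost_nat_numeral power_divide)
  also have "\<dots> \<le> advantage (sqrt (2 * 0.7606605))"
    using advantage_near_poly(1)[of "sqrt (2 * 0.7606605)" 9] by simp
  finally show ?thesis .
qed

lemma solves_beta_unique: "solves_beta y \<Longrightarrow> solves_beta z \<Longrightarrow> y = z"
  unfolding solves_beta_iff
  using advantage_less[of "sqrt (2 * y)" "sqrt (2 * z)"] advantage_less[of "sqrt (2 * z)" "sqrt (2 * y)"]
  by (cases y z rule: linorder_cases) auto

lemma solves_beta_exists: "\<exists>z. solves_beta z \<and> 0.7606604 < z \<and> z < 0.7606605"
proof -
  have "\<exists>x\<ge>sqrt (2 * 0.7606604). x \<le> sqrt (2 * 0.7606605) \<and> advantage x = 1"
    using advantage_lower advantage_upper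
    by (intro IVT) (auto intro: DERIV_isCont[OF DERIV_advantage])
  then obtain x where x: "sqrt (2 * 0.7606604) \<le> x" "x \<le> sqrt (2 * 0.7606605)" "advantage x = 1"
    by blast
  with advantage_lower advantage_upper have x': "sqrt (2 * 0.7606604) < x" "x < sqrt (2 * 0.7606605)"
    by (force simp: less_le)+
  have x0: "0 < x" using x'(1) by (rule le_less_trans[rotated]) simp
  have "2 * 0.7606604 < x\<^sup>2"
    using x'(1) x0 by (metis real_less_lsqrt less_imp_le not_less real_sqrt_le_iff real_sqrt_abs abs_of_pos)
  moreover have "x\<^sup>2 < 2 * 0.7606605"
    using x'(2) x0 by (metis real_less_rsqrt real_sqrt_less_iff real_sqrt_abs abs_of_pos)
  moreover have "sqrt (2 * (x\<^sup>2 / 2)) = x" using x0 by simp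
  ultimately have "solves_beta (x\<^sup>2 / 2) \<and> 0.7606604 < x\<^sup>2 / 2 \<and> x\<^sup>2 / 2 < 0.7606605"
    unfolding solves_beta_iff using x(3) x0 by simp
  then show ?thesis by blast
qed

lemma ex1_solves_beta: "\<exists>!z. solves_beta z"
  using solves_beta_exists solves_beta_unique by blast

lemma beta_star_bounds: "solves_beta beta_star" "0.7606604 < beta_star" "beta_star < 0.7606605"
proof -
  show s: "solves_beta beta_star"
    unfolding beta_star_def by (rule theI'[OF ex1_solves_beta])
  then show "0.7606604 < beta_star" "beta_star < 0.7606605"
    using solves_beta_exists solves_beta_unique by blast+
qed

lemma gauss_int_sqrt2: "gauss_int (sqrt 2 * x) = sqrt (pi / 2) * erf x"
proof -
  let ?E = "\<lambda>x. LBINT t=0..ereal x. exp (- t\<^sup>2)"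
  have E: "(?E has_real_derivative exp (- x\<^sup>2)) (at x)" for x
    by (rule LBINT_has_derivative) (auto intro!: continuous_intros)
  have "((\<lambda>x. gauss_int (sqrt 2 * x) - sqrt 2 * ?E x) has_real_derivative 0) (at x)" for x
    by (rule derivative_eq_intros E refl)+ (simp add: no_lower_def power_mult_distrib)
  then have "gauss_int (sqrt 2 * x) - sqrt 2 * ?E x = gauss_int (sqrt 2 * 0) - sqrt 2 * ?E 0"
    by (intro DERIV_isconst_all[rule_format]) blast
  then have eq: "gauss_int (sqrt 2 * x) = sqrt 2 * ?E x"
    by (simp add: zero_ereal_def)
  have "sqrt 2 = sqrt (pi / 2) * (2 / sqrt pi)"
    by (simp add: real_sqrt_divide field_simps)
  then have "sqrt (pi / 2) * (2 / sqrt pi * ?E x) = sqrt 2 * ?E x"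
    by (simp only: mult.assoc[symmetric])
  then show ?thesis by (simp only: eq erf_def)
qed

lemma
  shows erfc_eq: "0 \<le> x \<Longrightarrow> erfc x = 1 - erf x"
    and erf_tendsto: "(erf \<longlongrightarrow> 1) at_top"
proof -
  let ?f = "\<lambda>t :: real. exp (- t\<^sup>2)"
  have int: "set_integrable lborel {0..} ?f" and val: "(LBINT t:{0..}. ?f t) = sqrt pi / 2"
    using gaussian_moment_0 by (auto simp: set_integrable_def set_lebesgue_integral_def has_bochner_integral_iff)
  have erf: "erf x = 2 / sqrt pi * (LBINT t:{0..x}. ?f t)" if "0 \<le> x" for x
    using that interval_integral_Icc[of 0 x ?f] by (simp add: erf_def zero_ereal_def)
  show "erfc x = 1 - erf x" if x: "0 \<le> x"
  proof -
    have "(LBINT t:{0..x} \<union> {x<..}. ?f t) = (LBINT t:{0..x}. ?f t) + (LBINT t:{x<..}. ?f t)"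
      by (rule set_integral_Un) (use x in \<open>auto intro!: set_integrable_subset[OF int]\<close>)
    moreover have "{0..x} \<union> {x<..} = {0..}" using x by auto
    ultimately have "(LBINT t:{0..}. ?f t) = (LBINT t:{0..x}. ?f t) + (LBINT t:{x<..}. ?f t)"
      by (simp only:)
    then have "(LBINT t:{x<..}. ?f t) = sqrt pi / 2 - (LBINT t:{0..x}. ?f t)"
      using val by linarith
    then show ?thesis
      unfolding erf[OF x] erfc_def interval_integral_to_infinity_eq
      by (simp add: right_diff_distrib)
  qed
  have "((\<lambda>x. LBINT t:{0..x}. ?f t) \<longlongrightarrow> (LBINT t:{0..}. ?f t)) at_top"
    by (rule tendsto_set_lebesgue_integral_at_top) (use int in auto)
  then have "((\<lambda>x. 2 / sqrt pi * (LBINT t:{0..x}. ?f t)) \<longlongrightarrow> 2 / sqrt pi * (sqrt pi / 2)) at_top"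
    unfolding val by (rule tendsto_mult_left)
  then have "((\<lambda>x. 2 / sqrt pi * (LBINT t:{0..x}. ?f t)) \<longlongrightarrow> 1) at_top"
    by simp
  moreover have "\<forall>\<^sub>F x in at_top. 2 / sqrt pi * (LBINT t:{0..x}. ?f t) = erf x"
    using eventually_ge_at_top[of "0 :: real"] by eventually_elim (simp add: erf)
  ultimately show "(erf \<longlongrightarrow> 1) at_top"
    by (rule Lim_transform_eventually)
qed

lemma gauss_int_tendsto: "(gauss_int \<longlongrightarrow> sqrt (pi / 2)) at_top"
proof -
  have "filterlim (\<lambda>x :: real. x / sqrt 2) at_top at_top"
    using filterlim_tendsto_pos_mult_at_top[OF tendsto_const[of "1 / sqrt 2"] _ filterlim_ident] by simp
  then have "((\<lambda>x. sqrt (pi / 2) * erf (x / sqrt 2)) \<longlongrightarrow> sqrt (pi / 2) * 1) at_top"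
    by (intro tendsto_mult_left filterlim_compose[OF erf_tendsto])
  moreover have "sqrt (pi / 2) * erf (x / sqrt 2) = gauss_int x" for x
    using gauss_int_sqrt2[of "x / sqrt 2"] by simp
  ultimately show ?thesis by simp
qed

lemma gauss_int_le: "gauss_int x \<le> sqrt (pi / 2)"
  by (rule tendsto_lowerbound[OF gauss_int_tendsto])
    (auto intro: eventually_mono[OF eventually_ge_at_top[of x]] gauss_int_mono)

lemma no_lower_tendsto: "(no_lower \<longlongrightarrow> 0) at_top"
proof -
  have "filterlim (\<lambda>x :: real. x\<^sup>2 / 2) at_top at_top"
    using filterlim_tendsto_pos_mult_at_top[OF tendsto_const[of "1 / 2"] _ filterlim_pow_at_top[OF _ filterlim_ident], of 2]
    by simp
  then have "filterlim (\<lambda>x :: real. - (x\<^sup>2 / 2)) at_bot at_top"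
    by (simp add: filterlim_uminus_at_top)
  then have "((\<lambda>x :: real. exp (- (x\<^sup>2 / 2))) \<longlongrightarrow> 0) at_top"
    by (rule filterlim_compose[OF exp_at_bot])
  then show ?thesis by (simp add: no_lower_def[abs_def])
qed

context threshold
begin

lemma cont_value_tendsto: "(cont_value \<longlongrightarrow> value_inf) at_top"
proof -
  have "((\<lambda>d. no_lower c + slope * (gauss_int d - gauss_int c)) \<longlongrightarrow> value_inf) at_top"
    unfolding value_inf_def by (intro tendsto_intros gauss_int_tendsto)
  moreover have "\<forall>\<^sub>F d in at_top. no_lower c + slope * (gauss_int d - gauss_int c) = cont_value d"
    using eventually_ge_at_top[of c] by eventually_elim (simp add: cont_value_gt)
  ultimately show ?thesis by (rule Lim_transform_eventually)
qed

lemma cont_value_le_inf: "c \<le> d \<Longrightarrow> cont_value d \<le> value_inf"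
  using slope_pos gauss_int_le by (simp add: cont_value_gt value_inf_def)

lemma value_inf_eq:
  "value_inf = no_lower c + (exp (c\<^sup>2 / 2) * gauss_int c - c) * (sqrt (pi / 2) - gauss_int c)"
proof -
  have "slope = exp (c\<^sup>2 / 2) * gauss_int c - c"
    using exp_no_lower[of c] by (simp add: slope_def algebra_simps)
  then show ?thesis by (simp add: value_inf_def)
qed

end

interpretation opt: threshold "sqrt (2 * beta_star)"
  using beta_star_bounds(1) by unfold_locales (auto simp: solves_beta_iff)

lemma value_inf_eq_at:
  "d = sqrt (2 * beta_star) \<Longrightarrow>
    opt.value_inf = no_lower d + (exp (d\<^sup>2 / 2) * gauss_int d - d) * (sqrt (pi / 2) - gauss_int d)"
  using opt.value_inf_eq by simp

lemma optimal_value_eq: "optimal_value = opt.value_inf"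
proof -
  define b where "b = sqrt beta_star"
  have b: "0 < b" "b\<^sup>2 = beta_star"
    using beta_star_bounds(2) by (auto simp: b_def)
  have c: "sqrt (2 * beta_star) = sqrt 2 * b"
    by (simp add: b_def real_sqrt_mult)
  have "opt.value_inf = exp (- beta_star) + (exp beta_star * (sqrt (pi / 2) * erf b) - sqrt 2 * b)
      * (sqrt (pi / 2) - sqrt (pi / 2) * erf b)"
    unfolding value_inf_eq_at[OF c[symmetric]] gauss_int_sqrt2 using b
    by (simp add: no_lower_def power_mult_distrib)
  moreover have "optimal_value = exp (- beta_star) + (exp beta_star * (sqrt pi / (2 * b)) * erf b - 1)
      * (sqrt pi * b) * (1 - erf b)"
    using b erfc_eq[of b] by (simp add: optimal_value_def b_def[symmetric] real_sqrt_mult)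
  moreover have "(exp beta_star * (sqrt pi / (2 * b)) * erf b - 1) * (sqrt pi * b) * (1 - erf b) =
     (exp beta_star * (sqrt (pi / 2) * erf b) - sqrt 2 * b) * (sqrt (pi / 2) - sqrt (pi / 2) * erf b)"
  proof -
    have "(e * (p / (r * r * b)) * f - 1) * (p * b) * (1 - f) =
        (e * (p / r * f) - r * b) * (p / r - p / r * f)" if "0 < r" for e p r f :: real
      using that b(1) by (simp add: field_simps)
    from this[of "sqrt 2" "exp beta_star" "sqrt pi" "erf b"] show ?thesis
      by (simp add: real_sqrt_divide)
  qed
  ultimately show ?thesis by simp
qed

text \<open>
  Expanding at \<open>0.76066\<close>, a nearby decimal with few digits, keeps the rational arithmetic small; the difference
  to \<open>beta_star\<close> is below \<open>1 / 10 ^ 6\<close> and is treated to first order.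
\<close>

lemma exp_minus_bounds:
  "0.467357633 \<le> exp (- beta_star)" "exp (- beta_star) \<le> 0.467357685"
proof -
  define z :: real where "z = 0.76066"
  obtain t where t: "\<bar>t\<bar> \<le> \<bar>- z\<bar>" "exp (- z) = (\<Sum>m<13. (- z) ^ m / fact m) + exp t / fact 13 * (- z) ^ 13"
    using Maclaurin_exp_le[of "- z" 13] by blast
  have "exp t \<le> exp 1" using t(1) by (simp add: z_def)
  then have "exp t \<le> 3" using exp_le by linarith
  moreover have "\<bar>- z\<bar> ^ 13 \<le> 1 ^ 13" by (intro power_mono) (auto simp: z_def)
  ultimately have "\<bar>exp t / fact 13 * (- z) ^ 13\<bar> \<le> 3 / fact 13 * 1"
    unfolding abs_mult power_abs by (intro mult_mono) (auto intro!: divide_right_mono)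
  also have "\<dots> \<le> 1 / 10 ^ 9" by (simp add: fact_numeral)
  finally have r: "\<bar>exp t / fact 13 * (- z) ^ 13\<bar> \<le> 1 / 10 ^ 9" .
  have "(\<Sum>m<13. (- z) ^ m / fact m) \<le> 0.4673578695" "0.4673578685 \<le> (\<Sum>m<13. (- z) ^ m / fact m)"
    by (simp_all add: z_def lessThan_nat_numeral fact_numeral power_divide)
  moreover have "\<bar>exp (- z) - (\<Sum>m<13. (- z) ^ m / fact m)\<bar> \<le> 0.000000001"
    using r unfolding t(2) by simp
  moreover have "a - r \<le> x \<and> x \<le> b + r" if "y \<le> b" "a \<le> y" "\<bar>x - y\<bar> \<le> r" for a b r x y :: real
    using that by linarith
  ultimately have "0.4673578685 - 0.000000001 \<le> exp (- z) \<and> exp (- z) \<le> 0.4673578695 + 0.000000001"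
    by blast
  then have z: "0.467357867 \<le> exp (- z)" "exp (- z) \<le> 0.467357871"
    by simp_all
  define e where "e = beta_star - z"
  have e: "4 / 10 ^ 7 \<le> e" "e \<le> 5 / 10 ^ 7"
    using beta_star_bounds by (simp_all add: e_def z_def)
  have eq: "exp (- beta_star) = exp (- z) * exp (- e)"
    by (simp add: e_def flip: exp_add)
  have "\<bar>exp (- e) - (1 - e)\<bar> \<le> e\<^sup>2" using e by (intro exp_minus_linear) auto
  moreover have "e\<^sup>2 \<le> (5 / 10 ^ 7)\<^sup>2" using e by (intro power_mono) auto
  ultimately have e': "1 - 5 / 10 ^ 7 - 1 / 10 ^ 12 \<le> exp (- e)" "exp (- e) \<le> 1 - 4 / 10 ^ 7 + 1 / 10 ^ 12"
    using e unfolding abs_le_iff by (simp_all add: power_divide)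
  have "0.467357633 \<le> (0.467357867 :: real) * (1 - 5 / 10 ^ 7 - 1 / 10 ^ 12)" by simp
  also have "\<dots> \<le> exp (- beta_star)"
    unfolding eq using z e' by (intro mult_mono) auto
  finally show "0.467357633 \<le> exp (- beta_star)" .
  have "exp (- beta_star) \<le> 0.467357871 * (1 - 4 / 10 ^ 7 + 1 / 10 ^ 12)"
    unfolding eq using z e' by (intro mult_mono) auto
  also have "\<dots> \<le> (0.467357685 :: real)" by simp
  finally show "exp (- beta_star) \<le> 0.467357685" .
qed

text \<open>
  Rewriting \<open>optimal_value\<close> through this quotient leaves only \<open>exp (- beta_star)\<close>, \<open>sqrt (pi * beta_star)\<close> and a
  power series with positive terms, whose enclosures suffice for six digits.
\<close>

definition mills_quotient :: real where
  "mills_quotient = exp beta_star * gauss_int (sqrt (2 * beta_star)) / sqrt (2 * beta_star)"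

lemma mills_quotient_bounds:
  "1.70148861 \<le> mills_quotient" "mills_quotient \<le> 1.70148876"
proof -
  define d where "d = sqrt (2 * beta_star)"
  have d: "0 < d" "d\<^sup>2 = 2 * beta_star" "0 \<le> d" "d\<^sup>2 / 2 = beta_star" "d\<^sup>2 / 2 \<le> 1"
    using beta_star_bounds by (auto simp: d_def)
  define S where "S z = (\<Sum>k\<le>9. (2 * z) ^ k / odd_prod k)" for z
  have poly: "odd_poly 9 d = d * S beta_star"
    unfolding odd_poly_def S_def sum_distrib_left d(2)[symmetric]
    by (intro sum.cong refl) (simp add: power_mult)
  have mono: "S x \<le> S y" if "0 \<le> x" "x \<le> y" for x y
    unfolding S_def using that by (intro sum_mono divide_right_mono power_mono) (auto simp: less_imp_le)
  have "d * S beta_star \<le> exp beta_star * gauss_int d"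
    using mills_near_poly(1)[OF d(3,5), of 9] unfolding poly d(4) .
  then have 1: "S beta_star \<le> mills_quotient"
    unfolding mills_quotient_def d_def[symmetric] using d(1) by (simp add: field_simps)
  have "d ^ 21 = d * (2 * beta_star) ^ 10"
    by (simp flip: d(2) power_mult power_Suc)
  then have "exp beta_star * gauss_int d \<le> d * S beta_star + 3 * (d * (2 * beta_star) ^ 10) / odd_prod 10"
    using mills_near_poly(2)[OF d(3,5), of 9] unfolding poly d(4) by simp
  then have 2: "mills_quotient \<le> S beta_star + 3 * (2 * beta_star) ^ 10 / odd_prod 10"
    unfolding mills_quotient_def d_def[symmetric] using d(1) by (simp add: field_simps)
  have "1.70148861 \<le> S 0.7606604"
    by (simp add: S_def odd_prod_def atMost_nat_numeral power_divide)
  also have "\<dots> \<le> S beta_star" using beta_star_bounds by (intro mono) auto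
  finally show "1.70148861 \<le> mills_quotient" using 1 by linarith
  have "S beta_star \<le> S 0.7606605" using beta_star_bounds by (intro mono) auto
  also have "\<dots> \<le> 1.701488742"
    by (simp add: S_def odd_prod_def atMost_nat_numeral power_divide)
  finally have "S beta_star \<le> 1.701488742" .
  moreover have "3 * (2 * beta_star) ^ 10 / odd_prod 10 \<le> 0.000000018"
  proof -
    have "3 * (2 * beta_star) ^ 10 / odd_prod 10 \<le> 3 * (2 * 0.77) ^ 10 / odd_prod 10"
    using beta_star_bounds by (intro divide_right_mono mult_left_mono power_mono) (auto simp: less_imp_le)
    also have "\<dots> \<le> (0.000000018 :: real)"
      by (simp add: odd_prod_def atMost_nat_numeral power_divide)
    finally show ?thesis .
  qed
  ultimately have "mills_quotient \<le> 1.701488742 + 0.000000018"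
    by (rule order_trans[OF 2 add_mono])
  then show "mills_quotient \<le> 1.70148876" by simp
qed

lemma sqrt_pi_beta_bounds:
  "1.54586064 \<le> sqrt (pi * beta_star)" "sqrt (pi * beta_star) \<le> 1.54586075"
proof -
  have "3.141592653588 * 0.7606604 \<le> pi * beta_star"
    using pi_approx beta_star_bounds by (intro mult_mono) auto
  then show "1.54586064 \<le> sqrt (pi * beta_star)"
    by (intro real_le_rsqrt) (simp add: power2_eq_square)
  have "pi * beta_star \<le> 3.1415926535899 * 0.7606605"
    using pi_approx beta_star_bounds by (intro mult_mono) auto
  then show "sqrt (pi * beta_star) \<le> 1.54586075"
    by (intro real_le_lsqrt) (simp_all add: power2_eq_square)
qed

lemma optimal_value_bounds: "0.703128 \<le> optimal_value" "optimal_value < 0.703129"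
proof -
  define E S R where "E = exp (- beta_star)" and "S = mills_quotient" and "R = sqrt (pi * beta_star)"
  define d where "d = sqrt (2 * beta_star)"
  have d: "0 < d" "d * d = 2 * beta_star" "d\<^sup>2 / 2 = beta_star"
    using beta_star_bounds by (auto simp: d_def)
  have G: "exp beta_star * gauss_int d = d * S"
    using d(1) by (simp add: S_def mills_quotient_def d_def)
  then have J: "gauss_int d = E * (d * S)"
    by (simp add: E_def exp_minus field_simps)
  have R: "d * sqrt (pi / 2) = R"
    by (simp add: R_def d_def flip: real_sqrt_mult)
  have "optimal_value = no_lower d + (exp (d\<^sup>2 / 2) * gauss_int d - d) * (sqrt (pi / 2) - gauss_int d)"
    unfolding optimal_value_eq by (rule value_inf_eq_at[OF d_def])
  also have "\<dots> = E + (d * S - d) * (sqrt (pi / 2) - E * (d * S))"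
    using d(3) G J by (simp add: no_lower_def E_def)
  also have "\<dots> = E + (S - 1) * (d * sqrt (pi / 2) - (d * d) * (E * S))"
    by (simp add: algebra_simps)
  also have "\<dots> = E + (S - 1) * (R - 2 * beta_star * (E * S))"
    unfolding R d(2) ..
  finally have val: "optimal_value = E + (S - 1) * (R - 2 * beta_star * (E * S))" .
  have E: "0.467357633 \<le> E" "E \<le> 0.467357685"
    using exp_minus_bounds by (simp_all add: E_def)
  have S: "1.70148861 \<le> S" "S \<le> 1.70148876"
    using mills_quotient_bounds by (simp_all add: S_def)
  have R: "1.54586064 \<le> R" "R \<le> 1.54586075"
    using sqrt_pi_beta_bounds by (simp_all add: R_def)
  have X1: "2 * 0.7606604 * (0.467357633 * 1.70148861) \<le> 2 * beta_star * (E * S)"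
    using beta_star_bounds(2) E S by (intro mult_mono) auto
  have X2: "2 * beta_star * (E * S) \<le> 2 * 0.7606605 * (0.467357685 * 1.70148876)"
    using beta_star_bounds(2,3) E S by (intro mult_mono) auto
  have "0.70148861 * (1.54586064 - 2 * 0.7606605 * (0.467357685 * 1.70148876)) \<le> (S - 1) * (R - 2 * beta_star * (E * S))"
    using S R X2 by (intro mult_mono) auto
  then show "0.703128 \<le> optimal_value"
    unfolding val using E(1) by simp
  have "(S - 1) * (R - 2 * beta_star * (E * S)) \<le> 0.70148876 * (1.54586075 - 2 * 0.7606604 * (0.467357633 * 1.70148861))"
    using S R X1 X2 by (intro mult_mono) auto
  then show "optimal_value < 0.703129"
    unfolding val using E(2) by simp
qed

section \<open>The triangular model\<close>

definition uniform_mark :: "nat \<Rightarrow> nat \<Rightarrow> nat \<Rightarrow> real" where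
  "uniform_mark n j y = (if y < j then 0 else 1 / (real n - real j + 1))"

lemma near_uniform_triangular:
  assumes L: "0 \<le> L" and n: "4 * L\<^sup>2 + 1 \<le> real n"
  shows "near_uniform L (2 * L + 2) (uniform_mark n) (nat \<lfloor>L * sqrt (real n)\<rfloor>) (1 / sqrt (real n))"
proof -
  define K where "K = nat \<lfloor>L * sqrt (real n)\<rfloor>"
  define h where "h = 1 / sqrt (real n)"
  have n1: "1 \<le> real n" using n by (smt (verit) zero_le_power2)
  have sq: "1 \<le> sqrt (real n)" "sqrt (real n) * sqrt (real n) = real n"
    using n1 by auto
  have h: "0 < h" "h \<le> 1" "h\<^sup>2 = 1 / real n"
    using sq n1 by (auto simp: h_def power_divide)
  have K: "real K \<le> L * sqrt (real n)"
    unfolding K_def using L sq by (intro of_nat_floor mult_nonneg_nonneg) auto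
  have "2 * L \<le> sqrt (real n)"
    using n by (intro real_le_rsqrt) (auto simp: power_mult_distrib)
  then have "2 * (L * sqrt (real n)) \<le> real n"
    using mult_right_mono[of "2 * L" "sqrt (real n)" "sqrt (real n)"] sq by (simp add: mult.assoc)
  with K have K2: "2 * real K \<le> real n" by linarith
  have Kh: "real K * h \<le> L"
    using K sq by (simp add: h_def divide_le_eq)
  show ?thesis
    unfolding near_uniform_def K_def[symmetric] h_def[symmetric]
  proof (intro conjI ballI h Kh allI impI)
    fix j assume j: "j \<in> {1..K}"
    have jn: "real n / 2 \<le> real n - real j + 1" "real j \<le> real K" "1 \<le> real j" "0 < real n - real j + 1"
      using j K2 n1 by auto
    show "0 \<le> uniform_mark n j y" for y
      using jn by (auto simp: uniform_mark_def)
    show "uniform_mark n j y = 0" if "y < j" for y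
      using that by (simp add: uniform_mark_def)
    have "(\<Sum>y\<le>K. uniform_mark n j y) = (\<Sum>y\<in>{j..K}. 1 / (real n - real j + 1))"
      by (rule sum.mono_neutral_cong_right) (auto simp: uniform_mark_def)
    also have "\<dots> = (real K - real j + 1) / (real n - real j + 1)"
      using j by (simp add: of_nat_diff)
    also have "\<dots> \<le> 1"
      using jn K2 by (simp add: divide_le_eq)
    finally show "(\<Sum>y\<le>K. uniform_mark n j y) \<le> 1" .
    have "1 / (real n - real j + 1) \<le> 1 / (real n / 2)"
      using jn n1 by (intro divide_left_mono mult_pos_pos) auto
    then have inv: "1 / (real n - real j + 1) \<le> 2 * h\<^sup>2"
      unfolding h(3) by simp
    also have "\<dots> \<le> (2 * L + 2) * h\<^sup>2"
      using L by (intro mult_right_mono) auto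
    finally show "uniform_mark n j j \<le> (2 * L + 2) * h\<^sup>2"
      by (simp add: uniform_mark_def)
    fix y assume "y \<in> {j<..K}"
    then have "\<bar>uniform_mark n j y - h\<^sup>2\<bar> = \<bar>1 / (real n - real j + 1) - 1 / real n\<bar>"
      by (simp add: uniform_mark_def h(3))
    also have "1 / (real n - real j + 1) - 1 / real n = (real j - 1) * (1 / (real n - real j + 1)) * (1 / real n)"
      using jn n1 by (simp add: field_simps)
    also have "\<bar>\<dots>\<bar> = (real j - 1) * (1 / (real n - real j + 1)) * (1 / real n)"
      using jn n1 by (intro abs_of_nonneg mult_nonneg_nonneg) auto
    also have "\<dots> \<le> real K * (2 * h\<^sup>2) * h\<^sup>2"
      unfolding h(3)[symmetric] using jn inv by (intro mult_mono mult_nonneg_nonneg) auto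
    also have "\<dots> = (real K * h) * (2 * h ^ 3)"
      by (simp add: power2_eq_square power3_eq_cube)
    also have "\<dots> \<le> L * (2 * h ^ 3)"
      using Kh h by (intro mult_right_mono) auto
    also have "\<dots> \<le> (2 * L + 2) * h ^ 3"
      using h by (simp add: algebra_simps)
    finally show "\<bar>uniform_mark n j y - h\<^sup>2\<bar> \<le> (2 * L + 2) * h ^ 3" .
  qed
qed

lemma triangular_prob:
  assumes T: "triangular_model P n X" and j: "j \<in> {1..n}" and y: "y \<le> n"
  shows "measure P {w \<in> space P. X j w = y} = uniform_mark n j y"
proof -
  interpret prob_space P using T by (simp add: triangular_model_def)
  have X: "X j \<in> P \<rightarrow>\<^sub>M count_space UNIV"
    using T j by (auto simp: triangular_model_def indep_vars_def)
  have "measure P {w \<in> space P. X j w = y} = measure (distr P (count_space UNIV) (X j)) {y}"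
    using X by (subst measure_distr) (auto intro!: arg_cong[where f = "measure P"])
  also have "\<dots> = pmf (pmf_of_set {j..n}) y"
    using T j by (simp add: triangular_model_def pmf.rep_eq)
  also have "\<dots> = uniform_mark n j y"
    using j y by (subst pmf_of_set) (auto simp: uniform_mark_def indicator_def of_nat_diff)
  finally show ?thesis .
qed

lemma triangular_AE:
  assumes T: "triangular_model P n X"
  shows "AE w in P. \<forall>j\<in>{1..n}. j \<le> X j w"
proof (intro AE_finite_allI)
  fix j assume j: "j \<in> {1..n}"
  have X: "X j \<in> P \<rightarrow>\<^sub>M count_space UNIV"
    using T j by (auto simp: triangular_model_def prob_space.indep_vars_def)
  have "AE y in measure_pmf (pmf_of_set {j..n}). j \<le> y"
    using j by (auto simp: AE_measure_pmf_iff)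
  also have "measure_pmf (pmf_of_set {j..n}) = distr P (count_space UNIV) (X j)"
    using T j by (simp add: triangular_model_def)
  finally show "AE w in P. j \<le> X j w"
    by (rule AE_distrD[OF X])
qed simp

lemma space_natural_filtration [simp]: "space (natural_filtration P X k) = space P"
  unfolding natural_filtration_def by (intro space_measure_of) auto

lemma sets_natural_filtration:
  "sets (natural_filtration P X k) = sigma_sets (space P) {X j -` A \<inter> space P | j A. j \<in> {1..k}}"
  unfolding natural_filtration_def by (intro sets_measure_of) auto

text \<open>
  With \<open>h = 1 / sqrt n\<close> the triangular model needs no discretisation.
\<close>

lemma triangular_slots:
  assumes T: "triangular_model P n X" and K: "K \<le> n"
  shows "slots P (natural_filtration P X) X K (uniform_mark n)"
proof -
  interpret prob_space P using T by (simp add: triangular_model_def)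
  have ind: "indep_vars (\<lambda>_. count_space UNIV) X {1..n}"
    using T by (simp add: triangular_model_def)
  have X: "X j \<in> P \<rightarrow>\<^sub>M count_space UNIV" if "j \<in> {1..n}" for j
    using ind that by (auto simp: indep_vars_def)
  show ?thesis
  proof
    show "space (natural_filtration P X j) = space P" for j by simp
    show "sets (natural_filtration P X j) \<subseteq> events" if "j \<le> K" for j
      unfolding sets_natural_filtration using that K
      by (intro sets.sigma_sets_subset) (auto intro!: measurable_sets[OF X])
    show "sets (natural_filtration P X i) \<subseteq> sets (natural_filtration P X j)" if "i \<le> j" "j \<le> K" for i j
      unfolding sets_natural_filtration using that by (intro sigma_sets_mono') force
    show "{w \<in> space P. X j w = y} \<in> sets (natural_filtration P X j)" if "1 \<le> j" for j y
    proof -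
      have "{w \<in> space P. X j w = y} = X j -` {y} \<inter> space P" by auto
      then show ?thesis
        unfolding sets_natural_filtration using that by (intro sigma_sets.Basic) auto
    qed
    fix j A y assume j: "j < K" and A: "A \<in> sets (natural_filtration P X j)" and y: "y \<le> K"
    define E where "E i = {X i -` B \<inter> space P | B. B \<in> sets (count_space (UNIV :: nat set))}" for i
    define I where "I b = (if b then {1..j} else {Suc j})" for b
    have "indep_sets E {1..n}"
      using ind unfolding indep_vars_def2 E_def by simp
    then have "indep_sets E (\<Union>b\<in>UNIV. I b)"
      by (rule indep_sets_mono_index[rotated]) (use j K in \<open>auto simp: I_def split: if_splits\<close>)
    then have "indep_sets (\<lambda>b. sigma_sets (space P) (\<Union>i\<in>I b. E i)) UNIV"
    proof (rule indep_sets_collect_sigma)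
      show "Int_stable (E i)" for i
        by (auto simp: E_def Int_stable_def) (metis vimage_Int Int_assoc Int_left_commute Int_absorb)
      show "disjoint_family_on I UNIV"
        by (auto simp: disjoint_family_on_def I_def)
    qed
    then have "prob (\<Inter>b\<in>UNIV. if b then A else {w \<in> space P. X (Suc j) w = y}) =
        (\<Prod>b\<in>UNIV. prob (if b then A else {w \<in> space P. X (Suc j) w = y}))"
    proof (rule indep_setsD)
      have "A \<in> sigma_sets (space P) (\<Union>i\<in>I True. E i)"
      proof -
        have "{X i -` B \<inter> space P | i B. i \<in> {1..j}} = (\<Union>i\<in>I True. E i)"
        proof (intro set_eqI iffI)
          fix S assume "S \<in> {X i -` B \<inter> space P | i B. i \<in> {1..j}}"
          then obtain i B where "S = X i -` B \<inter> space P" "i \<in> {1..j}" by blast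
          then show "S \<in> (\<Union>i\<in>I True. E i)"
            by (intro UN_I[of i]) (auto simp: I_def E_def)
        next
          fix S assume "S \<in> (\<Union>i\<in>I True. E i)"
          then obtain i where "i \<in> {1..j}" "S \<in> E i" unfolding I_def if_True by blast
          then show "S \<in> {X i -` B \<inter> space P | i B. i \<in> {1..j}}"
            unfolding E_def by blast
        qed
        with A show ?thesis unfolding sets_natural_filtration by simp
      qed
      moreover have "{w \<in> space P. X (Suc j) w = y} \<in> sigma_sets (space P) (\<Union>i\<in>I False. E i)"
      proof -
        have "{w \<in> space P. X (Suc j) w = y} = X (Suc j) -` {y} \<inter> space P" by auto
        then have "{w \<in> space P. X (Suc j) w = y} \<in> E (Suc j)"
          unfolding E_def by auto
        then show ?thesis by (intro sigma_sets.Basic) (auto simp: I_def)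
      qed
      ultimately show "\<forall>b\<in>UNIV. (if b then A else {w \<in> space P. X (Suc j) w = y}) \<in> sigma_sets (space P) (\<Union>i\<in>I b. E i)"
        by auto
    qed auto
    then have "prob (A \<inter> {w \<in> space P. X (Suc j) w = y}) = prob A * prob {w \<in> space P. X (Suc j) w = y}"
      by (simp add: UNIV_bool Int_commute)
    then show "prob (A \<inter> {w \<in> space P. X (Suc j) w = y}) = prob A * uniform_mark n (Suc j) y"
      using triangular_prob[OF T, of "Suc j" y] j y K by simp
  qed
qed

text \<open>
  Since \<open>X j \<ge> j\<close> almost surely, a minimum that is at most \<open>K\<close> is attained at a time at most \<open>K\<close>, so the later
  variables are irrelevant for success below \<open>K\<close>.
\<close>

lemma best_choice_upper:
  assumes T: "triangular_model P n X" and K: "K \<le> n" and n: "1 \<le> n"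
    and S: "\<And>A. (\<And>j. j \<in> {1..K} \<Longrightarrow> A j \<in> sets (natural_filtration P X j)) \<Longrightarrow> disjoint_family_on A {1..K} \<Longrightarrow>
       (\<Sum>j=1..K. measure P (A j \<inter> slots.overall_min P X K j)) \<le> b"
  shows "best_choice_value P n X \<le> b + measure P {w \<in> space P. \<forall>l\<in>{1..K}. Suc K \<le> X l w}"
  unfolding best_choice_value_def
proof (rule cSUP_least)
  interpret slots P "natural_filtration P X" X K "uniform_mark n"
    by (rule triangular_slots[OF T K])
  show "{\<tau>. stopping_time (natural_filtration P X) \<tau> \<and> (\<forall>w\<in>space P. \<tau> w \<in> {1..n})} \<noteq> {}"
    using n by (auto intro!: exI[of _ "\<lambda>_. 1"] stopping_time_const)
  fix \<tau> assume "\<tau> \<in> {\<tau>. stopping_time (natural_filtration P X) \<tau> \<and> (\<forall>w\<in>space P. \<tau> w \<in> {1..n})}"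
  then have st: "stopping_time (natural_filtration P X) \<tau>" and \<tau>: "\<And>w. w \<in> space P \<Longrightarrow> \<tau> w \<in> {1..n}"
    by auto
  define A where "A j = {w \<in> space P. \<tau> w = j}" for j
  have le: "{w \<in> space P. \<tau> w \<le> j} \<in> sets (natural_filtration P X j)" for j
    using stopping_timeD[OF st, of j] by (simp add: Measurable.pred_def)
  have A: "A j \<in> sets (natural_filtration P X j)" if "j \<in> {1..K}" for j
  proof -
    have "A j = {w \<in> space P. \<tau> w \<le> j} - {w \<in> space P. \<tau> w \<le> j - 1}"
      using that by (auto simp: A_def)
    moreover have "{w \<in> space P. \<tau> w \<le> j - 1} \<in> sets (natural_filtration P X j)"
      using F_mono[of "j - 1" j] le[of "j - 1"] that by auto
    ultimately show ?thesis using le[of j] by auto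
  qed
  have "prob {w \<in> space P. X (\<tau> w) w = Min ((\<lambda>j. X j w) ` {1..n})} \<le>
      (\<Sum>j=1..K. prob (A j \<inter> overall_min j)) + prob {w \<in> space P. \<forall>l\<in>{1..K}. Suc K \<le> X l w}"
  proof (rule prob_le_stop_sum[OF A])
    show "AE w in P. w \<in> {w \<in> space P. X (\<tau> w) w = Min ((\<lambda>j. X j w) ` {1..n})} \<longrightarrow>
       w \<in> (\<Union>j\<in>{1..K}. A j \<inter> overall_min j) \<union> {w \<in> space P. \<forall>l\<in>{1..K}. Suc K \<le> X l w}"
      using triangular_AE[OF T]
    proof eventually_elim
      case (elim w)
      show ?case
      proof (intro impI)
        assume "w \<in> {w \<in> space P. X (\<tau> w) w = Min ((\<lambda>j. X j w) ` {1..n})}"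
        then have w: "w \<in> space P" and eq: "X (\<tau> w) w = Min ((\<lambda>j. X j w) ` {1..n})" by auto
        have le: "X (\<tau> w) w \<le> X l w" if "l \<in> {1..n}" for l
          unfolding eq using that by (intro Min_le) auto
        show "w \<in> (\<Union>j\<in>{1..K}. A j \<inter> overall_min j) \<union> {w \<in> space P. \<forall>l\<in>{1..K}. Suc K \<le> X l w}"
        proof (cases "\<forall>l\<in>{1..K}. Suc K \<le> X l w")
          case False
          then obtain l where "l \<in> {1..K}" "X l w \<le> K" by (auto simp: not_less_eq_eq)
          with le[of l] K have XK: "X (\<tau> w) w \<le> K" by auto
          with elim \<tau>[OF w] have "\<tau> w \<in> {1..K}" by fastforce
          moreover have "w \<in> A (\<tau> w) \<inter> overall_min (\<tau> w)"
            using w le XK K by (auto simp: A_def overall_min_def)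
          ultimately show ?thesis by blast
        qed (use w in auto)
      qed
    qed
  qed
  also have "(\<Sum>j=1..K. prob (A j \<inter> overall_min j)) \<le> b"
    by (rule S[OF A]) (auto simp: A_def disjoint_family_on_def)
  finally show "prob {w \<in> space P. X (\<tau> w) w = Min ((\<lambda>j. X j w) ` {1..n})} \<le>
      b + prob {w \<in> space P. \<forall>l\<in>{1..K}. Suc K \<le> X l w}" by simp
qed

text \<open>
  The cutoff rule is extended by stopping at \<open>n\<close> when it chooses nothing.
\<close>

lemma best_choice_lower:
  assumes T: "triangular_model P n X" and K: "K \<le> n" and n: "1 \<le> n"
  shows "(\<Sum>j=1..K. measure P (slots.cutoff_stop P X K q j \<inter> slots.overall_min P X K j)) \<le> best_choice_value P n X"
proof -
  interpret slots P "natural_filtration P X" X K "uniform_mark n"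
    by (rule triangular_slots[OF T K])
  have X: "X j \<in> P \<rightarrow>\<^sub>M count_space UNIV" if "j \<in> {1..n}" for j
    using T that by (auto simp: triangular_model_def indep_vars_def)
  \<comment> \<open>the alternative \<open>j = n\<close> makes the least index exist\<close>
  define Q where "Q w j \<longleftrightarrow> j = n \<or> (j \<in> {1..K} \<and> w \<in> cutoff_stop q j)" for w j
  define \<tau> where "\<tau> w = (LEAST j. Q w j)" for w
  have Q: "Q w (\<tau> w)" for w
    unfolding \<tau>_def by (rule LeastI[of _ n]) (simp add: Q_def)
  have \<tau>n: "\<tau> w \<in> {1..n}" for w
    using Q[of w] n K by (auto simp: Q_def)
  have stop: "\<tau> w = j" if "j \<in> {1..K}" "w \<in> cutoff_stop q j" for w j
  proof -
    have "\<tau> w \<le> j" unfolding \<tau>_def using that by (intro Least_le) (simp add: Q_def)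
    moreover have "\<tau> w = n \<or> \<tau> w = j"
      using Q[of w] disjoint_family_onD[OF cutoff_stop_disjoint[of q], of "\<tau> w" j] that by (auto simp: Q_def)
    ultimately show ?thesis using that K by auto
  qed
  have st: "stopping_time (natural_filtration P X) \<tau>"
  proof
    fix k
    have "\<tau> w \<le> k \<longleftrightarrow> n \<le> k \<or> (\<exists>j\<in>{1..min k K}. w \<in> cutoff_stop q j)" for w
    proof -
      have "\<tau> w \<le> k \<longleftrightarrow> (\<exists>j\<le>k. Q w j)"
        using Q[of w] unfolding \<tau>_def by (auto intro: order_trans Least_le)
      then show ?thesis by (auto simp: Q_def)
    qed
    then have "{w \<in> space P. \<tau> w \<le> k} = (if n \<le> k then space (natural_filtration P X k)
        else (\<Union>j\<in>{1..min k K}. cutoff_stop q j))"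
      using sets.sets_into_space[OF cutoff_F(2)] by (auto; fastforce)
    also have "\<dots> \<in> sets (natural_filtration P X k)"
    proof -
      have "cutoff_stop q j \<in> sets (natural_filtration P X k)" if "j \<in> {1..min k K}" for j
      proof -
        have "sets (natural_filtration P X j) \<subseteq> sets (natural_filtration P X k)"
          unfolding sets_natural_filtration using that by (intro sigma_sets_mono') force
        with cutoff_F(2)[of j q] that show ?thesis by auto
      qed
      then have "(\<Union>j\<in>{1..min k K}. cutoff_stop q j) \<in> sets (natural_filtration P X k)"
        by (intro sets.finite_UN) simp_all
      then show ?thesis using sets.top[of "natural_filtration P X k"] by simp
    qed
    finally show "Measurable.pred (natural_filtration P X k) (\<lambda>w. \<tau> w \<le> k)"
      by (simp add: Measurable.pred_def)
  qed
  let ?S = "{w \<in> space P. X (\<tau> w) w = Min ((\<lambda>j. X j w) ` {1..n})}"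
  have iff: "X (\<tau> w) w = Min ((\<lambda>j. X j w) ` {1..n}) \<longleftrightarrow> (\<forall>l\<in>{1..n}. X (\<tau> w) w \<le> X l w)" for w
    using \<tau>n[of w] n by (subst eq_commute) (auto simp: Min_eq_iff)
  have "?S = (\<Union>j\<in>{1..n}. {w \<in> space P. \<tau> w = j} \<inter> (\<Inter>l\<in>{1..n}. {w \<in> space P. X j w \<le> X l w}))"
    unfolding iff using \<tau>n n by auto
  also have "\<dots> \<in> events"
  proof (intro sets.finite_UN sets.Int sets.finite_INT)
    fix j assume "j \<in> {1..n}"
    have "sets (natural_filtration P X k) \<subseteq> events" if "k \<le> n" for k
      using slots.sets_F[OF triangular_slots[OF T order_refl], of k] that by simp
    then have "{w \<in> space P. \<tau> w \<le> k} \<in> events" if "k \<le> n" for k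
      using stopping_timeD[OF st, of k] that by (auto simp: Measurable.pred_def)
    moreover have "{w \<in> space P. \<tau> w = j} = {w \<in> space P. \<tau> w \<le> j} - {w \<in> space P. \<tau> w \<le> j - 1}"
      using \<open>j \<in> {1..n}\<close> by auto
    ultimately show "{w \<in> space P. \<tau> w = j} \<in> events"
      using \<open>j \<in> {1..n}\<close> by auto
    show "{w \<in> space P. X j w \<le> X l w} \<in> events" if "l \<in> {1..n}" for l
    proof -
      have "{w \<in> space P. X j w \<le> X l w} = (\<Union>y. (X j -` {y} \<inter> space P) \<inter> (X l -` {y..} \<inter> space P))"
        by auto
      then show ?thesis
        using X[OF \<open>j \<in> {1..n}\<close>] X[OF that]
        by (simp only:) (intro sets.countable_UN'' sets.Int measurable_sets, auto)
    qed
  qed (use n in auto)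
  finally have S: "?S \<in> events" .
  have "(\<Sum>j=1..K. prob (cutoff_stop q j \<inter> overall_min j)) \<le> prob ?S + prob {}"
  proof (rule stop_sum_le_prob[OF S])
    show "AE w in P. w \<notin> {} \<longrightarrow> w \<in> (\<Union>j\<in>{1..K}. cutoff_stop q j \<inter> overall_min j) \<longrightarrow> w \<in> ?S"
      using triangular_AE[OF T]
    proof eventually_elim
      case (elim w)
      show ?case
      proof (intro impI)
        assume "w \<in> (\<Union>j\<in>{1..K}. cutoff_stop q j \<inter> overall_min j)"
        then obtain j where j: "j \<in> {1..K}" "w \<in> cutoff_stop q j" "w \<in> overall_min j" by auto
        have "X j w \<le> X l w" if "l \<in> {1..n}" for l
        proof (cases "l \<le> K")
          case False
          then show ?thesis using elim that j by (fastforce simp: overall_min_def)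
        qed (use j that in \<open>auto simp: overall_min_def\<close>)
        then show "w \<in> ?S"
          using j stop[OF j(1,2)] unfolding iff by (auto simp: overall_min_def)
      qed
    qed
  qed auto
  also have "prob ?S + prob {} = prob ?S"
    by simp
  also have "\<dots> \<le> best_choice_value P n X"
    unfolding best_choice_value_def
    by (rule cSUP_upper) (use st \<tau>n in \<open>auto intro!: bdd_aboveI2[of _ _ 1]\<close>)
  finally show ?thesis .
qed

context threshold
begin

theorem triangular_limit:
  assumes T: "\<And>n. 1 \<le> n \<Longrightarrow> triangular_model (P n) n (X n)"
    and lim: "(cont_value \<longlongrightarrow> value_inf) at_top" and le: "\<And>d. c \<le> d \<Longrightarrow> cont_value d \<le> value_inf"
    and nl: "(no_lower \<longlongrightarrow> 0) at_top"
  shows "(\<lambda>n. best_choice_value (P n) n (X n)) \<longlonglongrightarrow> value_inf"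
proof (rule LIMSEQ_I)
  let ?x = "\<lambda>n. best_choice_value (P n) n (X n)"
  fix r :: real assume r: "0 < r"
  have "\<forall>\<^sub>F n in sequentially. \<bar>?x n - value_inf\<bar> < r"
  proof (rule eventually_less_two_limits[OF _ _ _ r])
    show "((\<lambda>L. value_inf - cont_value L + no_lower L) \<longlongrightarrow> 0) at_top"
      using tendsto_add[OF tendsto_diff[OF tendsto_const[of value_inf] lim] nl] by simp
    show "(\<lambda>n. 1 / sqrt (real n)) \<longlonglongrightarrow> 0"
      by (intro tendsto_divide_0[OF tendsto_const] filterlim_at_top_imp_at_infinity
          filterlim_compose[OF sqrt_at_top filterlim_real_sequentially])
    fix L assume L: "c \<le> L"
    then have L0: "0 \<le> L" using c_pos by simp
    obtain B where B: "error_bound L (2 * L + 2) B"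
      using error_bound_exists[of "2 * L + 2" L] L0 by auto
    have "\<forall>\<^sub>F n in sequentially. max 1 (4 * L\<^sup>2 + 1) \<le> real n"
      using filterlim_real_sequentially unfolding filterlim_at_top by blast
    then have "\<forall>\<^sub>F n in sequentially. \<bar>?x n - value_inf\<bar> \<le>
        (value_inf - cont_value L + no_lower L) + (L + 1) * B * (1 / sqrt (real n))"
    proof eventually_elim
      case (elim n)
      define h where "h = 1 / sqrt (real n)"
      define K where "K = nat \<lfloor>L * sqrt (real n)\<rfloor>"
      have n: "1 \<le> n" using elim max.cobounded1[of 1 "4 * L\<^sup>2 + 1"] by linarith
      have nu: "near_uniform L (2 * L + 2) (uniform_mark n) K h"
        unfolding h_def K_def using elim L0 by (intro near_uniform_triangular) auto
      have h: "0 < h" using nu by (simp add: near_uniform_def)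
      have B0: "0 \<le> B" using B by (simp add: error_bound_def)
      have KhL: "L \<le> real (Suc K) * h"
      proof -
        have "L * sqrt (real n) \<le> real (Suc K)"
          unfolding K_def using L0 by (simp add: le_nat_iff) linarith
        then show ?thesis using n by (simp add: h_def field_simps)
      qed
      have Kn: "K \<le> n"
      proof -
        have "real K * h \<le> L" using nu by (simp add: near_uniform_def)
        then have "real K \<le> L * sqrt (real n)" using n by (simp add: h_def field_simps)
        also have "\<dots> \<le> sqrt (real n) * sqrt (real n)"
        proof (intro mult_right_mono real_le_rsqrt)
          have "4 * L\<^sup>2 + 1 \<le> real n" using elim by simp
          then show "L\<^sup>2 \<le> real n" using zero_le_power2[of L] by linarith
        qed simp
        finally show ?thesis by simp
      qed
      note sl = triangular_slots[OF T[OF n] Kn]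
      have "?x n \<le> (cont_value (real (Suc K) * h) + L * B * h)
          + measure (P n) {w \<in> space (P n). \<forall>l\<in>{1..K}. Suc K \<le> X n l w}"
        by (rule best_choice_upper[OF T[OF n] Kn n slots_upper[OF sl nu B]])
      also have "\<dots> \<le> (value_inf + L * B * h) + (no_lower L + B * h)"
        using slots_no_low[OF sl nu B] no_lower_mono[OF L0 KhL] le[of "real (Suc K) * h"] KhL L
        by (intro add_mono) (auto simp del: of_nat_Suc)
      finally have up: "?x n \<le> value_inf + no_lower L + (L + 1) * B * h"
        by (simp add: algebra_simps)
      have "cont_value L - (L + 1) * B * h \<le> cont_value (real (Suc K) * h) - (L + 1) * B * h"
        using cont_value_mono_above[OF L KhL] by simp
      also have "\<dots> \<le> ?x n"
        using slots_lower[OF sl nu B] best_choice_lower[OF T[OF n] Kn n, of "cutoff_cells h"] by linarith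
      finally have lo: "cont_value L - (L + 1) * B * h \<le> ?x n" .
      have "cont_value L \<le> value_inf" by (rule le[OF L])
      then show ?case
        using up lo no_lower_nonneg[of L] unfolding h_def[symmetric] abs_le_iff by linarith
    qed
    then show "\<exists>D. \<forall>\<^sub>F n in sequentially. \<bar>?x n - value_inf\<bar> \<le>
        (value_inf - cont_value L + no_lower L) + D * (1 / sqrt (real n))" by blast
  qed
  then show "\<exists>no. \<forall>n\<ge>no. norm (?x n - value_inf) < r"
    by (simp add: eventually_sequentially)
qed

end

section \<open>Poisson processes and their histories\<close>

lemma measurable_sum_count_space:
  fixes f :: "'i \<Rightarrow> 'a \<Rightarrow> nat"
  assumes "finite S" "\<And>i. i \<in> S \<Longrightarrow> f i \<in> M \<rightarrow>\<^sub>M count_space UNIV"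
  shows "(\<lambda>x. \<Sum>i\<in>S. f i x) \<in> M \<rightarrow>\<^sub>M count_space UNIV"
  using assms
proof (induction S rule: finite_induct)
  case (insert i S)
  have "(\<lambda>x. n + (\<Sum>i\<in>S. f i x)) \<in> M \<rightarrow>\<^sub>M count_space UNIV" for n
    by (rule measurable_compose[OF insert.IH]) (use insert.prems in auto)
  then have "(\<lambda>x. f i x + (\<Sum>i\<in>S. f i x)) \<in> M \<rightarrow>\<^sub>M count_space UNIV"
    by (rule measurable_compose_countable) (use insert.prems in auto)
  with insert.hyps show ?case by simp
qed simp

lemma measure_lborel_Times:
  fixes A B :: "real set"
  assumes "A \<in> sets borel" "B \<in> sets borel"
  shows "measure lborel (A \<times> B) = measure lborel A * measure lborel B"
proof -
  have "emeasure (lborel \<Otimes>\<^sub>M lborel) (A \<times> B) = emeasure lborel A * emeasure lborel B"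
    using assms by (intro lborel.emeasure_pair_measure_Times) auto
  then show ?thesis
    by (simp add: lborel_prod measure_def enn2real_mult)
qed

lemma sector_borel: "sector \<in> sets borel"
proof -
  have "sector = {p. 0 \<le> fst p \<and> fst p \<le> snd p}" by (auto simp: sector_def)
  also have "\<dots> \<in> sets borel"
    by (intro borel_closed closed_Collect_conj closed_Collect_le continuous_intros)
  finally show ?thesis .
qed

locale poisson_sector =
  fixes M :: "'w measure" and N :: "'w \<Rightarrow> (real \<times> real) set"
  assumes poisson: "unit_poisson_process M sector N"

sublocale poisson_sector \<subseteq> prob_space M
  using poisson by (simp add: unit_poisson_process_def)

context poisson_sector
begin

definition area :: "(real \<times> real) set \<Rightarrow> real" where
  "area B = measure lborel (B \<inter> sector)"

lemma N_sector: "w \<in> space M \<Longrightarrow> N w \<subseteq> sector"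
  using poisson by (simp add: unit_poisson_process_def)

lemma N_finite: "w \<in> space M \<Longrightarrow> bounded B \<Longrightarrow> finite (N w \<inter> B)"
  using poisson by (simp add: unit_poisson_process_def)

lemma count_measurable:
  "B \<in> sets borel \<Longrightarrow> bounded B \<Longrightarrow> (\<lambda>w. card (N w \<inter> B)) \<in> M \<rightarrow>\<^sub>M count_space UNIV"
  using poisson by (simp add: unit_poisson_process_def)

lemma count_events:
  assumes "B \<in> sets borel" "bounded B"
  shows "{w \<in> space M. P (card (N w \<inter> B))} \<in> events"
proof -
  have "(\<lambda>w. card (N w \<inter> B)) -` Collect P \<inter> space M \<in> events"
    by (rule measurable_sets[OF count_measurable[OF assms]]) simp
  then show ?thesis by (simp add: vimage_def Int_def conj_commute)
qed

lemma prob_count: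
  assumes "B \<in> sets borel" "bounded B"
  shows "prob {w \<in> space M. card (N w \<inter> B) = k} = area B ^ k / fact k * exp (- area B)"
  using poisson assms by (simp add: unit_poisson_process_def area_def)

lemma count_indep:
  fixes I :: "nat set"
  assumes "finite I" "disjoint_family_on B I" "\<And>i. i \<in> I \<Longrightarrow> B i \<in> sets borel" "\<And>i. i \<in> I \<Longrightarrow> bounded (B i)"
  shows "indep_vars (\<lambda>_. count_space UNIV) (\<lambda>i w. card (N w \<inter> B i)) I"
  using poisson[unfolded unit_poisson_process_def, THEN conjunct2, THEN conjunct2, THEN conjunct2, rule_format, of I B]
    assms by simp

lemma prob_empty:
  assumes "B \<in> sets borel" "bounded B"
  shows "prob {w \<in> space M. card (N w \<inter> B) = 0} = exp (- area B)"
  using prob_count[OF assms, of 0] by simp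

lemma area_nonneg: "0 \<le> area B"
  by (simp add: area_def)

lemma prob_count_ge1:
  assumes "B \<in> sets borel" "bounded B"
  shows "prob {w \<in> space M. 1 \<le> card (N w \<inter> B)} \<le> area B"
proof -
  have "{w \<in> space M. 1 \<le> card (N w \<inter> B)} = space M - {w \<in> space M. card (N w \<inter> B) = 0}"
    by auto
  then have "prob {w \<in> space M. 1 \<le> card (N w \<inter> B)} = 1 - exp (- area B)"
    using prob_compl[OF count_events[OF assms, of "\<lambda>n. n = 0"]] prob_empty[OF assms] by simp
  then show ?thesis
    using exp_ge_add_one_self[of "- area B"] by simp
qed

lemma prob_count_ge2:
  assumes "B \<in> sets borel" "bounded B"
  shows "prob {w \<in> space M. 2 \<le> card (N w \<inter> B)} \<le> (area B)\<^sup>2"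
proof -
  have "{w \<in> space M. 2 \<le> card (N w \<inter> B)} =
      space M - ({w \<in> space M. card (N w \<inter> B) = 0} \<union> {w \<in> space M. card (N w \<inter> B) = 1})"
    by auto
  moreover have "prob ({w \<in> space M. card (N w \<inter> B) = 0} \<union> {w \<in> space M. card (N w \<inter> B) = 1}) =
      exp (- area B) + area B * exp (- area B)"
    using prob_count[OF assms, of 1] prob_empty[OF assms]
    by (subst finite_measure_Union) (auto intro: count_events assms)
  ultimately have "prob {w \<in> space M. 2 \<le> card (N w \<inter> B)} = 1 - (1 + area B) * exp (- area B)"
    using prob_compl[of "{w \<in> space M. card (N w \<inter> B) = 0} \<union> {w \<in> space M. card (N w \<inter> B) = 1}"]
      count_events[OF assms, of "\<lambda>n. n = 0"] count_events[OF assms, of "\<lambda>n. n = 1"]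
    by (simp add: algebra_simps)
  moreover have "(1 + area B) * (1 - area B) \<le> (1 + area B) * exp (- area B)"
    using exp_ge_add_one_self[of "- area B"] area_nonneg[of B] by (intro mult_left_mono) auto
  ultimately show ?thesis
    by (simp add: algebra_simps power2_eq_square)
qed

lemma area_mono: "B \<subseteq> B' \<Longrightarrow> B \<in> sets borel \<Longrightarrow> B' \<in> sets borel \<Longrightarrow> bounded B' \<Longrightarrow> area B \<le> area B'"
proof -
  assume a: "B \<subseteq> B'" "B \<in> sets borel" "B' \<in> sets borel" "bounded B'"
  have "bounded (B' \<inter> sector)" using a(4) by (rule bounded_subset) auto
  then have "emeasure lborel (B' \<inter> sector) < \<infinity>" by (rule emeasure_bounded_finite)
  then show ?thesis
    unfolding area_def using a sector_borel
    by (intro measure_mono_fmeasurable) (auto simp: fmeasurable_def)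
qed

lemma area_le:
  assumes "B \<subseteq> A \<times> C" "A \<in> sets borel" "C \<in> sets borel" "B \<in> sets borel"
    and "bounded A" "bounded C"
  shows "area B \<le> measure lborel A * measure lborel C"
proof -
  have "bounded (A \<times> C)" using assms by (intro bounded_Times)
  then have "emeasure lborel (A \<times> C) < \<infinity>" by (rule emeasure_bounded_finite)
  then have "area B \<le> measure lborel (A \<times> C)"
    unfolding area_def using assms sector_borel
    by (intro measure_mono_fmeasurable) (auto simp: fmeasurable_def borel_prod[symmetric])
  then show ?thesis using assms measure_lborel_Times by simp
qed

lemma space_history [simp]: "space (history M N s) = space M"
  unfolding history_def by (intro space_measure_of) auto

lemma sets_history:
  "sets (history M N s) = sigma_sets (space M)
     {{w \<in> space M. card (N w \<inter> B) = k} | B k.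
        B \<in> sets borel \<and> bounded B \<and> B \<subseteq> {(t, x). 0 \<le> t \<and> ereal t \<le> s}}"
  unfolding history_def by (intro sets_measure_of) auto

lemma history_events: "sets (history M N s) \<subseteq> events"
  unfolding sets_history
  by (intro sets.sigma_sets_subset) (auto intro: count_events[where P = "\<lambda>n. n = k" for k])

lemma history_mono: "s \<le> s' \<Longrightarrow> sets (history M N s) \<subseteq> sets (history M N s')"
proof -
  assume "s \<le> s'"
  then have "{(t :: real, x :: real). 0 \<le> t \<and> ereal t \<le> s} \<subseteq> {(t, x). 0 \<le> t \<and> ereal t \<le> s'}"
    by (auto intro: order_trans)
  then show ?thesis
    unfolding sets_history by (intro sigma_sets_mono') blast
qed

lemma count_history:
  assumes "B \<in> sets borel" "bounded B" "B \<subseteq> {(t, x). 0 \<le> t \<and> ereal t \<le> s}"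
  shows "{w \<in> space M. P (card (N w \<inter> B))} \<in> sets (history M N s)"
proof -
  have "{w \<in> space M. P (card (N w \<inter> B))} = (\<Union>k\<in>Collect P. {w \<in> space M. card (N w \<inter> B) = k})"
    by auto
  also have "\<dots> \<in> sets (history M N s)"
  proof (intro sets.countable_UN'')
    show "{w \<in> space M. card (N w \<inter> B) = k} \<in> sets (history M N s)" for k
      unfolding sets_history by (intro sigma_sets.Basic) (use assms in blast)
  qed auto
  finally show ?thesis .
qed

text \<open>
  The sets \<open>B i\<close> may overlap, whereas the process is independent only on disjoint sets. Every count is a sum of
  counts on the atoms of the generated algebra, and an atom is indexed by the code of the set of all \<open>i\<close> whose
  \<open>B i\<close> contain it; index \<open>0\<close> is reserved for \<open>C\<close>.
\<close>

lemma indep_joint_count: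
  fixes B :: "nat \<Rightarrow> (real \<times> real) set" and r :: nat
  assumes B: "\<And>i. i < r \<Longrightarrow> B i \<in> sets borel" "\<And>i. i < r \<Longrightarrow> bounded (B i)" "\<And>i. i < r \<Longrightarrow> B i \<inter> C = {}"
    and C: "C \<in> sets borel" "bounded C"
  shows "prob ({w \<in> space M. \<forall>i<r. card (N w \<inter> B i) = k i} \<inter> {w \<in> space M. card (N w \<inter> C) = 0}) =
    prob {w \<in> space M. \<forall>i<r. card (N w \<inter> B i) = k i} * prob {w \<in> space M. card (N w \<inter> C) = 0}"
proof -
  define code where "code p = set_encode {i. i < r \<and> p \<in> B i}" for p
  define I0 where "I0 = set_encode ` Pow {..<r}"
  define D where "D y = (case y of 0 \<Rightarrow> C | Suc x \<Rightarrow> {p \<in> (\<Union>i\<in>{..<r}. B i). code p = x})" for y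
  define I where "I = insert 0 (Suc ` I0)"
  have fin: "finite I0" "finite I" by (auto simp: I0_def I_def)
  have code: "code p \<in> I0" for p by (auto simp: code_def I0_def)
  have dec: "i \<in> set_decode (code p) \<longleftrightarrow> i < r \<and> p \<in> B i" for i p
    by (simp add: code_def)
  have DS: "D (Suc x) \<in> sets borel" "bounded (D (Suc x))" if "x \<in> I0" for x
  proof -
    have "x \<in> set_encode ` Pow {..<r}" using that by (simp only: I0_def)
    then obtain S where "S \<in> Pow {..<r}" "x = set_encode S" by (rule imageE)
    then have S: "S \<subseteq> {..<r}" "x = set_encode S" by simp_all
    have cx: "code p = x \<longleftrightarrow> (\<forall>i\<in>{..<r}. p \<in> B i \<longleftrightarrow> i \<in> S)" for p
      using S finite_subset[of S "{..<r}"] unfolding code_def S(2)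
      by (subst set_encode_eq) auto
    have ix: "p \<in> (\<Inter>i\<in>{..<r}. if i \<in> S then B i else UNIV - B i) \<longleftrightarrow> (\<forall>i\<in>{..<r}. p \<in> B i \<longleftrightarrow> i \<in> S)" for p
    proof -
      have "p \<in> (if i \<in> S then B i else UNIV - B i) \<longleftrightarrow> (p \<in> B i \<longleftrightarrow> i \<in> S)" for i by simp
      then show ?thesis by (simp only: INT_iff)
    qed
    have "D (Suc x) = (\<Union>i\<in>{..<r}. B i) \<inter> (\<Inter>i\<in>{..<r}. if i \<in> S then B i else UNIV - B i)"
      by (intro set_eqI) (simp only: D_def nat.case mem_Collect_eq Int_iff cx ix)
    also have "\<dots> \<in> sets borel"
    proof (cases "r = 0")
      case False
      then show ?thesis
        by (intro sets.Int sets.finite_UN sets.finite_INT) (use B in \<open>auto intro!: sets.Diff\<close>)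
    qed simp
    finally show "D (Suc x) \<in> sets borel" .
    have "bounded (\<Union>i\<in>{..<r}. B i)" using B by (intro bounded_UN) auto
    then show "bounded (D (Suc x))" by (rule bounded_subset) (auto simp: D_def)
  qed
  have ind: "indep_vars (\<lambda>_. count_space UNIV) (\<lambda>i w. card (N w \<inter> D i)) I"
  proof (rule count_indep[OF fin(2)])
    show "disjoint_family_on D I"
      using B(3) by (fastforce simp: disjoint_family_on_def D_def split: nat.split)
    show "D i \<in> sets borel" "bounded (D i)" if "i \<in> I" for i
      using that DS C by (auto simp: I_def D_def[of 0])
  qed
  have card_B: "card (N w \<inter> B i) = (\<Sum>x\<in>{x\<in>I0. i \<in> set_decode x}. card (N w \<inter> D (Suc x)))"
    if "i < r" "w \<in> space M" for i w
  proof -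
    have "N w \<inter> B i = (\<Union>x\<in>{x\<in>I0. i \<in> set_decode x}. N w \<inter> D (Suc x))"
      using that code by (auto simp: D_def dec)
    also have "card \<dots> = (\<Sum>x\<in>{x\<in>I0. i \<in> set_decode x}. card (N w \<inter> D (Suc x)))"
      using fin DS that N_finite by (intro card_UN_disjoint) (auto simp: D_def)
    finally show ?thesis .
  qed
  let ?X = "\<lambda>A w. \<lambda>i\<in>A. card (N w \<inter> D i)"
  let ?PA = "PiM (Suc ` I0) (\<lambda>_. count_space (UNIV :: nat set))"
  let ?PC = "PiM {0 :: nat} (\<lambda>_. count_space (UNIV :: nat set))"
  let ?SA = "space ?PA \<inter> {f. \<forall>i<r. (\<Sum>x\<in>{x\<in>I0. i \<in> set_decode x}. f (Suc x)) = k i}"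
  let ?SC = "space ?PC \<inter> {f. f 0 = 0}"
  have iv: "indep_var ?PA (?X (Suc ` I0)) ?PC (?X {0})"
    by (rule indep_var_restrict[OF ind]) (auto simp: I_def)
  have SA: "?SA \<in> sets ?PA"
  proof -
    have m: "(\<lambda>f. \<Sum>x\<in>{x\<in>I0. i \<in> set_decode x}. f (Suc x)) \<in> ?PA \<rightarrow>\<^sub>M count_space UNIV" for i
      using fin by (intro measurable_sum_count_space measurable_component_singleton) auto
    have "?SA = space ?PA \<inter> (\<Inter>i\<in>{..<r}. (\<lambda>f. \<Sum>x\<in>{x\<in>I0. i \<in> set_decode x}. f (Suc x)) -` {k i} \<inter> space ?PA)"
      by auto
    also have "\<dots> \<in> sets ?PA"
    proof (cases "r = 0")
      case False
      have "(\<lambda>f. \<Sum>x\<in>{x\<in>I0. i \<in> set_decode x}. f (Suc x)) -` {k i} \<inter> space ?PA \<in> sets ?PA" for i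
        by (rule measurable_sets[OF m]) simp
      with False show ?thesis by (intro sets.Int[OF sets.top] sets.finite_INT) blast+
    qed simp
    finally show ?thesis .
  qed
  have SC: "?SC \<in> sets ?PC"
  proof -
    have "(\<lambda>f. f 0) \<in> ?PC \<rightarrow>\<^sub>M count_space UNIV"
      by (rule measurable_component_singleton) simp
    from measurable_sets[OF this, of "{0}"] have "(\<lambda>f. f 0) -` {0} \<inter> space ?PC \<in> sets ?PC" by simp
    also have "(\<lambda>f. f 0) -` {0} \<inter> space ?PC = ?SC" by auto
    finally show ?thesis .
  qed
  have 1: "?X (Suc ` I0) -` ?SA \<inter> space M = {w \<in> space M. \<forall>i<r. card (N w \<inter> B i) = k i}"
  proof (intro set_eqI)
    fix w
    have r: "(\<Sum>x\<in>{x\<in>I0. i \<in> set_decode x}. ?X (Suc ` I0) w (Suc x)) =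
        (\<Sum>x\<in>{x\<in>I0. i \<in> set_decode x}. card (N w \<inter> D (Suc x)))" for i
      by (intro sum.cong refl) auto
    have "?X (Suc ` I0) w \<in> space ?PA"
      by (simp add: space_PiM)
    then show "w \<in> ?X (Suc ` I0) -` ?SA \<inter> space M \<longleftrightarrow> w \<in> {w \<in> space M. \<forall>i<r. card (N w \<inter> B i) = k i}"
      by (simp only: vimage_eq Int_iff mem_Collect_eq r) (auto simp: card_B)
  qed
  have 2: "?X {0} -` ?SC \<inter> space M = {w \<in> space M. card (N w \<inter> C) = 0}"
    by (auto simp: space_PiM D_def)
  have 3: "(\<lambda>w. (?X (Suc ` I0) w, ?X {0} w)) -` (?SA \<times> ?SC) \<inter> space M =
      (?X (Suc ` I0) -` ?SA \<inter> space M) \<inter> (?X {0} -` ?SC \<inter> space M)"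
    by blast
  show ?thesis
    using indep_varD[OF iv SA SC] unfolding 3 1 2 .
qed

text \<open>
  Events that fix finitely many counts form an intersection-stable generator of the history.
\<close>

lemma history_indep:
  assumes A: "A \<in> sets (history M N (ereal s))" and C: "C \<in> sets borel" "bounded C"
    and later: "C \<subseteq> {(t, x). s < t}"
  shows "prob (A \<inter> {w \<in> space M. card (N w \<inter> C) = 0}) = prob A * prob {w \<in> space M. card (N w \<inter> C) = 0}"
proof -
  define G :: "(real \<times> real) set set" where "G = {B. B \<in> sets borel \<and> bounded B \<and> B \<subseteq> {(t, x). 0 \<le> t \<and> ereal t \<le> ereal s}}"
  define PI where "PI = {{w \<in> space M. \<forall>i<r. card (N w \<inter> B i) = k i} | (r :: nat) B k. \<forall>i<r. B i \<in> G}"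
  let ?E = "{w \<in> space M. card (N w \<inter> C) = 0}"
  have E: "?E \<in> events" using count_events[OF C, of "\<lambda>n. n = 0"] .
  have PI_events: "PI \<subseteq> events"
  proof
    fix S assume "S \<in> PI"
    then obtain r B k where S: "S = {w \<in> space M. \<forall>i<r. card (N w \<inter> B i) = k i}" and B: "\<forall>i<r::nat. B i \<in> G"
      by (auto simp: PI_def)
    have "S = space M \<inter> (\<Inter>i\<in>{..<r}. {w \<in> space M. card (N w \<inter> B i) = k i})"
      unfolding S by auto
    also have "\<dots> \<in> events"
    proof (cases "r = 0")
      case False
      have "{w \<in> space M. card (N w \<inter> B i) = k i} \<in> events" if "i < r" for i
        using B that by (intro count_events[where P = "\<lambda>n. n = k i"]) (auto simp: G_def)
      with False show ?thesis by (intro sets.Int sets.finite_INT) auto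
    qed simp
    finally show "S \<in> events" .
  qed
  have stable: "Int_stable PI"
    unfolding Int_stable_def
  proof (intro ballI)
    fix S S' assume "S \<in> PI" "S' \<in> PI"
    then obtain r B k r' B' k' where S: "S = {w \<in> space M. \<forall>i<r. card (N w \<inter> B i) = k i}" "\<forall>i<r::nat. B i \<in> G"
      and S': "S' = {w \<in> space M. \<forall>i<r'. card (N w \<inter> B' i) = k' i}" "\<forall>i<r'::nat. B' i \<in> G"
      unfolding PI_def by blast
    define B2 where "B2 i = (if i < r then B i else B' (i - r))" for i
    define k2 where "k2 i = (if i < r then k i else k' (i - r))" for i
    have "S \<inter> S' = {w \<in> space M. \<forall>i<r + r'. card (N w \<inter> B2 i) = k2 i}"
    proof (intro set_eqI iffI)
      fix w assume "w \<in> S \<inter> S'"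
      then show "w \<in> {w \<in> space M. \<forall>i<r + r'. card (N w \<inter> B2 i) = k2 i}"
        by (auto simp: S(1) S'(1) B2_def k2_def)
    next
      fix w assume "w \<in> {w \<in> space M. \<forall>i<r + r'. card (N w \<inter> B2 i) = k2 i}"
      then have w: "w \<in> space M" and a: "\<And>i. i < r + r' \<Longrightarrow> card (N w \<inter> B2 i) = k2 i"
        by simp_all
      have "card (N w \<inter> B i) = k i" if "i < r" for i
        using a[of i] that by (simp add: B2_def k2_def)
      moreover have "card (N w \<inter> B' i) = k' i" if "i < r'" for i
        using a[of "r + i"] that by (simp add: B2_def k2_def)
      ultimately show "w \<in> S \<inter> S'"
        using w by (simp add: S(1) S'(1))
    qed
    moreover have "\<forall>i<r + r'. B2 i \<in> G" using S(2) S'(2) by (auto simp: B2_def)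
    ultimately show "S \<inter> S' \<in> PI" unfolding PI_def by blast
  qed
  \<comment> \<open>counts on past sets are independent of counts on \<open>C\<close>, which lies strictly later\<close>
  have "indep_set PI {?E}"
    unfolding indep_sets2_eq
  proof (intro conjI ballI)
    fix S E' assume "S \<in> PI" and E': "E' \<in> {?E}"
    then obtain r B k where S: "S = {w \<in> space M. \<forall>i<r. card (N w \<inter> B i) = k i}" and B: "\<forall>i<r::nat. B i \<in> G"
      unfolding PI_def by blast
    have "B i \<inter> C = {}" if "i < r" for i
    proof -
      have "B i \<subseteq> {(t, x). 0 \<le> t \<and> ereal t \<le> ereal s}" using B that by (simp add: G_def)
      with later show ?thesis by fastforce
    qed
    then show "prob (S \<inter> E') = prob S * prob E'"
      using B E' C unfolding S by (simp add: G_def indep_joint_count)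
  qed (use PI_events E in auto)
  then have ind: "indep_set (sigma_sets (space M) PI) (sigma_sets (space M) {?E})"
    by (rule indep_set_sigma_sets[OF _ stable]) (simp add: Int_stable_def)
  have "sets (history M N (ereal s)) \<subseteq> sigma_sets (space M) PI"
    unfolding sets_history
  proof (rule sigma_sets_mono')
    show "{{w \<in> space M. card (N w \<inter> B) = k} | B k. B \<in> sets borel \<and> bounded B \<and> B \<subseteq> {(t, x). 0 \<le> t \<and> ereal t \<le> ereal s}} \<subseteq> PI"
    proof
      fix S assume "S \<in> {{w \<in> space M. card (N w \<inter> B) = k} | B k. B \<in> sets borel \<and> bounded B \<and> B \<subseteq> {(t, x). 0 \<le> t \<and> ereal t \<le> ereal s}}"
      then obtain B k where S: "S = {w \<in> space M. card (N w \<inter> B) = k}" and B: "B \<in> G"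
        unfolding G_def by blast
      have "S = {w \<in> space M. \<forall>i<1::nat. card (N w \<inter> (\<lambda>_. B) i) = (\<lambda>_. k) i}" unfolding S by auto
      with B show "S \<in> PI"
        unfolding PI_def by (intro CollectI exI[of _ "1 :: nat"] exI[of _ "\<lambda>_. B"] exI[of _ "\<lambda>_. k"]) simp
    qed
  qed
  with A have "A \<in> sigma_sets (space M) PI" by blast
  moreover have "?E \<in> sigma_sets (space M) {?E}" by (rule sigma_sets.Basic) simp
  ultimately show ?thesis
    using ind unfolding indep_sets2_eq by blast
qed

end

section \<open>Slicing the sector into cells\<close>

text \<open>
  The maximum with \<open>1\<close> puts the boundary value \<open>0\<close> into the first cell, so that cells cover the closed half-line.
\<close>

definition cell_index :: "real \<Rightarrow> real \<Rightarrow> nat" where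
  "cell_index h t = max 1 (nat \<lceil>t / h\<rceil>)"

lemma cell_index_ge_1 [simp]: "1 \<le> cell_index h t" "Suc 0 \<le> cell_index h t"
  by (simp_all add: cell_index_def)

lemma cell_index_le_iff: "0 < h \<Longrightarrow> 1 \<le> n \<Longrightarrow> cell_index h t \<le> n \<longleftrightarrow> t \<le> real n * h"
  by (simp add: cell_index_def nat_le_iff ceiling_le_iff pos_divide_le_eq)

lemma cell_index_mono: "0 < h \<Longrightarrow> s \<le> t \<Longrightarrow> cell_index h s \<le> cell_index h t"
  using cell_index_le_iff[of h "cell_index h t" t] cell_index_le_iff[of h "cell_index h t" s] by simp

definition cell_interval :: "real \<Rightarrow> nat \<Rightarrow> real set" where
  "cell_interval h j = (if j = 1 then {0..h} else {real (j - 1) * h<..real j * h})"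

lemma cell_interval_iff:
  assumes "0 < h" "0 \<le> t" "1 \<le> j" shows "t \<in> cell_interval h j \<longleftrightarrow> cell_index h t = j"
proof (cases "j = 1")
  case True
  then show ?thesis
    using assms cell_index_le_iff[of h 1 t] by (auto simp: cell_interval_def intro: le_antisym)
next
  case False
  have "cell_index h t = j \<longleftrightarrow> cell_index h t \<le> j \<and> \<not> cell_index h t \<le> j - 1"
    using assms False cell_index_ge_1(1)[of h t] by (intro iffI conjI) linarith+
  also have "\<dots> \<longleftrightarrow> t \<in> cell_interval h j"
    using assms False by (subst (1 2) cell_index_le_iff) (auto simp: cell_interval_def not_le)
  finally show ?thesis by simp
qed

lemma cell_interval_bounds:
  assumes "0 < h" "1 \<le> j" "t \<in> cell_interval h j"
  shows "0 \<le> t" "real (j - 1) * h \<le> t" "t \<le> real j * h"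
proof -
  show t: "real (j - 1) * h \<le> t" "t \<le> real j * h"
    using assms by (auto simp: cell_interval_def split: if_splits)
  have "0 \<le> real (j - 1) * h" using assms by simp
  with t show "0 \<le> t" by linarith
qed

lemma cell_interval_borel [simp]: "cell_interval h j \<in> sets borel"
  by (simp add: cell_interval_def)

lemma bounded_cell_interval [simp]: "bounded (cell_interval h j)"
  by (simp add: cell_interval_def)

lemma measure_cell_interval: "0 < h \<Longrightarrow> 1 \<le> j \<Longrightarrow> measure lborel (cell_interval h j) = h"
  by (auto simp: cell_interval_def of_nat_diff algebra_simps)

context poisson_sector
begin

definition low_strip :: "real \<Rightarrow> nat \<Rightarrow> nat \<Rightarrow> (real \<times> real) set" where
  "low_strip h j y = cell_interval h j \<times> (if y \<le> 1 then {} else {0..real (y - 1) * h})"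

definition lowest_cell :: "real \<Rightarrow> nat \<Rightarrow> nat \<Rightarrow> 'w \<Rightarrow> nat" where
  "lowest_cell h K j w = (LEAST y. y = Suc K \<or> (\<exists>p\<in>N w. cell_index h (fst p) = j \<and> cell_index h (snd p) = y))"

definition strip_prob :: "real \<Rightarrow> nat \<Rightarrow> nat \<Rightarrow> real" where
  "strip_prob h j y = exp (- area (low_strip h j y)) - exp (- area (low_strip h j (Suc y)))"

text \<open>
  The first column contains time \<open>0\<close>, so the information before it must be trivial rather than the history at
  time \<open>0\<close>.
\<close>

definition strip_history :: "real \<Rightarrow> nat \<Rightarrow> 'w measure" where
  "strip_history h j = (if j = 0 then sigma (space M) {} else history M N (ereal (real j * h)))"

lemma low_strip_borel [simp]: "low_strip h j y \<in> sets borel"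
  by (auto simp: low_strip_def intro!: borel_Times)

lemma bounded_low_strip [simp]: "bounded (low_strip h j y)"
  by (auto simp: low_strip_def intro!: bounded_Times)

lemma atom_nonneg: "w \<in> space M \<Longrightarrow> p \<in> N w \<Longrightarrow> 0 \<le> fst p \<and> fst p \<le> snd p"
  using N_sector[of w] by (auto simp: sector_def)

lemma le_lowest_cell:
  assumes "y \<le> Suc K"
  shows "y \<le> lowest_cell h K j w \<longleftrightarrow> (\<forall>p\<in>N w. cell_index h (fst p) = j \<longrightarrow> y \<le> cell_index h (snd p))"
    (is "_ \<longleftrightarrow> ?R")
proof -
  let ?Q = "\<lambda>y. y = Suc K \<or> (\<exists>p\<in>N w. cell_index h (fst p) = j \<and> cell_index h (snd p) = y)"
  have Q: "?Q (lowest_cell h K j w)"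
    unfolding lowest_cell_def by (rule LeastI[of _ "Suc K"]) simp
  have le: "lowest_cell h K j w \<le> z" if "?Q z" for z
    unfolding lowest_cell_def using that by (rule Least_le)
  show ?thesis
  proof
    assume "y \<le> lowest_cell h K j w"
    then show ?R using le by (blast intro: order_trans)
  next
    assume ?R
    then show "y \<le> lowest_cell h K j w" using Q assms by auto
  qed
qed

lemma lowest_cell_le: "p \<in> N w \<Longrightarrow> cell_index h (fst p) = j \<Longrightarrow> lowest_cell h K j w \<le> cell_index h (snd p)"
  unfolding lowest_cell_def by (rule Least_le) blast

lemma lowest_cell_attained:
  assumes "lowest_cell h K j w \<le> K"
  shows "\<exists>p\<in>N w. cell_index h (fst p) = j \<and> cell_index h (snd p) = lowest_cell h K j w"
proof -
  let ?Q = "\<lambda>y. y = Suc K \<or> (\<exists>p\<in>N w. cell_index h (fst p) = j \<and> cell_index h (snd p) = y)"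
  have Q: "?Q (lowest_cell h K j w)"
    unfolding lowest_cell_def by (rule LeastI[of _ "Suc K"]) simp
  with assms show ?thesis by auto
qed

text \<open>
  That a column is empty below some level is an event about one count, and these events determine the
  distribution of the lowest occupied cell.
\<close>

lemma lowest_cell_event:
  assumes h: "0 < h" and j: "1 \<le> j" and y: "y \<le> Suc K"
  shows "{w \<in> space M. y \<le> lowest_cell h K j w} = {w \<in> space M. card (N w \<inter> low_strip h j y) = 0}"
proof (intro Collect_cong conj_cong refl)
  fix w assume w: "w \<in> space M"
  have mem: "p \<in> low_strip h j y \<longleftrightarrow> cell_index h (fst p) = j \<and> cell_index h (snd p) < y" if "p \<in> N w" for p
  proof -
    have p: "0 \<le> fst p" "0 \<le> snd p" using atom_nonneg[OF w that] by auto
    have "cell_index h (snd p) < y \<longleftrightarrow> 2 \<le> y \<and> cell_index h (snd p) \<le> y - 1"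
      using cell_index_ge_1(1)[of h "snd p"] by (intro iffI conjI) linarith+
    also have "\<dots> \<longleftrightarrow> 2 \<le> y \<and> snd p \<le> real (y - 1) * h"
      using cell_index_le_iff[OF h, of "y - 1" "snd p"] by auto
    finally have y': "cell_index h (snd p) < y \<longleftrightarrow> 2 \<le> y \<and> snd p \<le> real (y - 1) * h" .
    have "fst p \<in> cell_interval h j \<longleftrightarrow> cell_index h (fst p) = j"
      by (rule cell_interval_iff[OF h p(1) j])
    with y' p show ?thesis by (auto simp: low_strip_def mem_Times_iff)
  qed
  have "card (N w \<inter> low_strip h j y) = 0 \<longleftrightarrow> N w \<inter> low_strip h j y = {}"
    using N_finite[OF w bounded_low_strip] by simp
  also have "\<dots> \<longleftrightarrow> (\<forall>p\<in>N w. cell_index h (fst p) = j \<longrightarrow> y \<le> cell_index h (snd p))"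
    using mem by (auto simp: not_less disjoint_iff)
  finally show "(y \<le> lowest_cell h K j w) = (card (N w \<inter> low_strip h j y) = 0)"
    unfolding le_lowest_cell[OF y] by simp
qed

lemma lowest_cell_eq_event:
  assumes h: "0 < h" and j: "1 \<le> j" and y: "y \<le> K"
  shows "{w \<in> space M. lowest_cell h K j w = y} =
    {w \<in> space M. card (N w \<inter> low_strip h j y) = 0} - {w \<in> space M. card (N w \<inter> low_strip h j (Suc y)) = 0}"
proof -
  have "{w \<in> space M. lowest_cell h K j w = y} =
      {w \<in> space M. y \<le> lowest_cell h K j w} - {w \<in> space M. Suc y \<le> lowest_cell h K j w}"
    by auto
  then show ?thesis
    using lowest_cell_event[OF h j, of y K] lowest_cell_event[OF h j, of "Suc y" K] y by simp
qed

lemma low_strip_mono: "0 < h \<Longrightarrow> low_strip h j y \<subseteq> low_strip h j (Suc y)"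
proof -
  assume "0 < h"
  then have "real (y - 1) * h \<le> real y * h" by (intro mult_right_mono) auto
  then show ?thesis by (auto simp: low_strip_def)
qed

lemma space_strip_history: "space (strip_history h j) = space M"
  by (simp add: strip_history_def)

lemma lowest_cell_slots:
  assumes h: "0 < h"
  shows "slots M (strip_history h) (lowest_cell h K) K (strip_prob h)"
proof
  have sets0: "sets (strip_history h 0) = {{}, space M}"
    by (simp add: strip_history_def sigma_sets_empty_eq)
  have later: "low_strip h (Suc j) y \<subseteq> {(t, x). real j * h < t}" if "j \<noteq> 0" for j y
    using that by (auto simp: low_strip_def cell_interval_def)
  have earlier: "low_strip h j y \<subseteq> {(t, x). 0 \<le> t \<and> ereal t \<le> ereal (real j * h)}" if "1 \<le> j" for j y
    using cell_interval_bounds[OF h that] by (auto simp: low_strip_def)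
  show "space (strip_history h j) = space M" for j by (rule space_strip_history)
  show "sets (strip_history h j) \<subseteq> events" for j
    using history_events sets0 by (cases "j = 0") (auto simp: strip_history_def)
  show "sets (strip_history h i) \<subseteq> sets (strip_history h j)" if "i \<le> j" for i j
  proof (cases "i = 0")
    case True
    then show ?thesis
      using sets0 sets.top[of "strip_history h j"] by (auto simp: space_strip_history)
  next
    case False
    with that have "real i * h \<le> real j * h" using h by (intro mult_right_mono) auto
    then have "sets (history M N (ereal (real i * h))) \<subseteq> sets (history M N (ereal (real j * h)))"
      by (intro history_mono) simp
    with False that show ?thesis by (simp add: strip_history_def)
  qed
  show "{w \<in> space M. lowest_cell h K j w = y} \<in> sets (strip_history h j)" if "1 \<le> j" "y \<le> K" for j y
  proof -
    have "{w \<in> space M. card (N w \<inter> low_strip h j y) = 0} \<in> sets (history M N (ereal (real j * h)))" for y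
      by (intro count_history[where P = "\<lambda>n. n = 0"] low_strip_borel bounded_low_strip earlier that(1))
    then show ?thesis
      unfolding lowest_cell_eq_event[OF h that] using that by (auto simp: strip_history_def)
  qed
  fix j A y assume j: "j < K" and A: "A \<in> sets (strip_history h j)" and y: "y \<le> K"
  let ?E = "\<lambda>y. {w \<in> space M. card (N w \<inter> low_strip h (Suc j) y) = 0}"
  have E: "?E y \<in> events" for y by (intro count_events[where P = "\<lambda>n. n = 0"]) auto
  have AE: "prob (A \<inter> ?E y) = prob A * exp (- area (low_strip h (Suc j) y))" for y
  proof (cases "j = 0")
    case True
    then have "A = {} \<or> A = space M" using A sets0 by auto
    then show ?thesis
      using prob_empty[of "low_strip h (Suc j) y"] E[of y] prob_space by (auto simp: Int_absorb1)
  next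
    case False
    then show ?thesis
      using history_indep[of A "real j * h" "low_strip h (Suc j) y"] A later[OF False]
        prob_empty[of "low_strip h (Suc j) y"] by (simp add: strip_history_def)
  qed
  have AM: "A \<in> events"
    using A history_events sets0 by (cases "j = 0") (auto simp: strip_history_def)
  have sub: "?E (Suc y) \<subseteq> ?E y"
  proof
    fix w assume w: "w \<in> ?E (Suc y)"
    then have "N w \<inter> low_strip h (Suc j) (Suc y) = {}"
      using N_finite[of w "low_strip h (Suc j) (Suc y)"] by auto
    then have "N w \<inter> low_strip h (Suc j) y = {}" using low_strip_mono[OF h, of "Suc j" y] by blast
    then show "w \<in> ?E y" using w by auto
  qed
  have "A \<inter> {w \<in> space M. lowest_cell h K (Suc j) w = y} = (A \<inter> ?E y) - (A \<inter> ?E (Suc y))"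
    using lowest_cell_eq_event[OF h _ y, of "Suc j"] by auto
  then have "prob (A \<inter> {w \<in> space M. lowest_cell h K (Suc j) w = y}) = prob (A \<inter> ?E y) - prob (A \<inter> ?E (Suc y))"
    using AM E sub by (simp add: finite_measure_Diff sets.Int subset_eq)
  then show "prob (A \<inter> {w \<in> space M. lowest_cell h K (Suc j) w = y}) = prob A * strip_prob h (Suc j) y"
    by (simp add: AE strip_prob_def algebra_simps)
qed

text \<open>
  Only the cell on the diagonal is not a full square, and a bound for its area is enough.
\<close>

lemma area_low_strip:
  assumes h: "0 < h" and j: "1 \<le> j"
  shows "y \<le> j \<Longrightarrow> area (low_strip h j y) = 0"
    and "area (low_strip h j (Suc j)) \<le> h\<^sup>2"
    and "j < y \<Longrightarrow> area (low_strip h j (Suc y)) = area (low_strip h j y) + h\<^sup>2"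
    and "1 \<le> y \<Longrightarrow> area (low_strip h j y) \<le> h * (real (y - 1) * h)"
proof -
  show "area (low_strip h j y) = 0" if "y \<le> j"
  proof -
    have "low_strip h j y \<inter> sector = {}"
    proof (rule ccontr)
      assume "low_strip h j y \<inter> sector \<noteq> {}"
      then obtain t x where tx: "t \<in> cell_interval h j" "\<not> y \<le> 1" "x \<le> real (y - 1) * h" "t \<le> x"
        by (auto simp: low_strip_def sector_def split: if_splits)
      have "real (y - 1) * h \<le> real (j - 1) * h" using that h by (intro mult_right_mono) auto
      moreover have "real (j - 1) * h < t" using tx that by (auto simp: cell_interval_def split: if_splits)
      ultimately show False using tx by linarith
    qed
    then show ?thesis by (simp add: area_def)
  qed
  show 4: "area (low_strip h j y) \<le> h * (real (y - 1) * h)" if "1 \<le> y" for y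
  proof -
    have "area (low_strip h j y) \<le> measure lborel (cell_interval h j) * measure lborel {0..real (y - 1) * h}"
      by (rule area_le) (auto simp: low_strip_def intro!: borel_Times split: if_splits)
    then show ?thesis using h j by (simp add: measure_cell_interval)
  qed
  show "area (low_strip h j (Suc j)) \<le> h\<^sup>2"
  proof -
    have "area (low_strip h j (Suc j)) = measure lborel ((cell_interval h j \<times> {real (j - 1) * h..real j * h}) \<inter> (low_strip h j (Suc j) \<inter> sector))"
      unfolding area_def using cell_interval_bounds[OF h j]
      by (intro arg_cong[where f = "measure lborel"]) (force simp: low_strip_def sector_def)
    also have "\<dots> \<le> measure lborel (cell_interval h j \<times> {real (j - 1) * h..real j * h})"
    proof (rule measure_mono_fmeasurable)
      have "bounded (cell_interval h j \<times> {real (j - 1) * h..real j * h})"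
        by (intro bounded_Times) auto
      then have "emeasure lborel (cell_interval h j \<times> {real (j - 1) * h..real j * h}) < \<infinity>"
        by (rule emeasure_bounded_finite)
      then show "cell_interval h j \<times> {real (j - 1) * h..real j * h} \<in> fmeasurable lborel"
        by (auto simp: fmeasurable_def intro!: borel_Times)
    qed (use sector_borel in \<open>auto intro!: sets.Int borel_Times\<close>)
    also have "\<dots> = h * (real j * h - real (j - 1) * h)"
      using h j by (subst measure_lborel_Times) (auto simp: measure_cell_interval mult_right_mono)
    also have "\<dots> = h\<^sup>2"
      using j by (simp add: of_nat_diff algebra_simps power2_eq_square)
    finally show ?thesis .
  qed
  show "area (low_strip h j (Suc y)) = area (low_strip h j y) + h\<^sup>2" if "j < y"
  proof -
    let ?B = "cell_interval h j \<times> {real (y - 1) * h<..real y * h}"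
    have "real j * h \<le> real (y - 1) * h" using that h by (intro mult_right_mono) auto
    then have "?B \<subseteq> sector"
      using cell_interval_bounds[OF h j] by (force simp: sector_def)
    moreover have "low_strip h j (Suc y) = low_strip h j y \<union> ?B"
    proof -
      have "0 \<le> real (y - 1) * h" "real (y - 1) * h \<le> real y * h"
        using h by (auto intro!: mult_right_mono)
      then have "{0..real y * h} = {0..real (y - 1) * h} \<union> {real (y - 1) * h<..real y * h}"
        by auto
      then show ?thesis
        using that j by (simp add: low_strip_def Times_Un_distrib1 flip: Sigma_Un_distrib2)
    qed
    ultimately have eq: "low_strip h j (Suc y) \<inter> sector = (low_strip h j y \<inter> sector) \<union> ?B"
      by auto
    have B: "?B \<in> fmeasurable lborel"
    proof -
      have "bounded ?B" by (intro bounded_Times) auto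
      then have "emeasure lborel ?B < \<infinity>" by (rule emeasure_bounded_finite)
      then show ?thesis by (auto simp: fmeasurable_def intro!: borel_Times)
    qed
    have S: "low_strip h j y \<inter> sector \<in> fmeasurable lborel"
    proof -
      have "bounded (low_strip h j y \<inter> sector)" by (rule bounded_subset[OF bounded_low_strip]) auto
      then have "emeasure lborel (low_strip h j y \<inter> sector) < \<infinity>" by (rule emeasure_bounded_finite)
      then show ?thesis using sector_borel by (auto simp: fmeasurable_def)
    qed
    have "measure lborel (low_strip h j (Suc y) \<inter> sector) = measure lborel (low_strip h j y \<inter> sector) + measure lborel ?B"
      unfolding eq using B S by (intro measure_Union) (auto simp: fmeasurable_def low_strip_def)
    also have "measure lborel ?B = h * (real y * h - real (y - 1) * h)"
      using h j by (subst measure_lborel_Times) (auto simp: measure_cell_interval mult_right_mono)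
    also have "\<dots> = h\<^sup>2"
      using that by (simp add: of_nat_diff algebra_simps power2_eq_square)
    finally show ?thesis by (simp add: area_def)
  qed
qed

lemma strip_prob_near_uniform:
  assumes h: "0 < h" "h \<le> 1" and K: "real K * h \<le> L"
  shows "near_uniform L (L + 1) (strip_prob h) K h"
  unfolding near_uniform_def
proof (intro conjI ballI h K allI impI)
  have L: "0 \<le> L" using K h by (auto intro: order_trans[of _ "real K * h"])
  fix j assume j: "j \<in> {1..K}"
  then have j1: "1 \<le> j" by simp
  note a = area_low_strip[OF h(1) j1]
  show "0 \<le> strip_prob h j y" for y
    using area_mono[OF low_strip_mono[OF h(1), of j y]] by (simp add: strip_prob_def)
  show "strip_prob h j y = 0" if "y < j" for y
    using a(1)[of y] a(1)[of "Suc y"] that by (simp add: strip_prob_def)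
  have "(\<Sum>y\<le>n. strip_prob h j y) = exp (- area (low_strip h j 0)) - exp (- area (low_strip h j (Suc n)))" for n
    by (induction n) (simp_all add: strip_prob_def)
  from this[of K] have "(\<Sum>y\<le>K. strip_prob h j y) = exp (- area (low_strip h j 0)) - exp (- area (low_strip h j (Suc K)))" .
  also have "\<dots> \<le> 1"
  proof -
    have "exp (- area (low_strip h j 0)) \<le> 1" using area_nonneg by simp
    with exp_ge_zero[of "- area (low_strip h j (Suc K))"] show ?thesis by linarith
  qed
  finally show "(\<Sum>y\<le>K. strip_prob h j y) \<le> 1" .
  have "strip_prob h j j = 1 - exp (- area (low_strip h j (Suc j)))"
    using a(1)[of j] by (simp add: strip_prob_def)
  also have "\<dots> \<le> h\<^sup>2"
    using a(2) exp_ge_add_one_self[of "- area (low_strip h j (Suc j))"] by linarith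
  also have "\<dots> \<le> (L + 1) * h\<^sup>2" using L by (simp add: mult_right_mono distrib_right)
  finally show "strip_prob h j j \<le> (L + 1) * h\<^sup>2" .
  fix y assume y: "y \<in> {j<..K}"
  define b where "b = area (low_strip h j y)"
  have b: "0 \<le> b" "b \<le> L * h"
  proof -
    have "b \<le> h * (real (y - 1) * h)" unfolding b_def using y by (intro a(4)) auto
    also have "real (y - 1) * h \<le> L"
      using y h K by (intro order_trans[OF _ K] mult_right_mono) auto
    then have "h * (real (y - 1) * h) \<le> h * L" using h by (intro mult_left_mono) auto
    finally show "b \<le> L * h" by (simp add: mult.commute)
  qed (simp add: b_def area_nonneg)
  have "strip_prob h j y = exp (- b) * (1 - exp (- h\<^sup>2))"
    using a(3)[of y] y by (simp add: strip_prob_def b_def right_diff_distrib flip: exp_add)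
  then have "strip_prob h j y - h\<^sup>2 = exp (- b) * (1 - h\<^sup>2 - exp (- h\<^sup>2)) * 1 + h\<^sup>2 * (exp (- b) - exp (- 0)) + 0"
    by (simp add: algebra_simps)
  also have "\<bar>\<dots>\<bar> \<le> 1 * (h\<^sup>2)\<^sup>2 + h\<^sup>2 * (L * h)"
  proof -
    have "\<bar>exp (- b) * (1 - h\<^sup>2 - exp (- h\<^sup>2))\<bar> \<le> 1 * (h\<^sup>2)\<^sup>2"
      unfolding abs_mult using b exp_minus_linear[of "h\<^sup>2"] by (intro mult_mono) (auto simp: abs_minus_commute)
    moreover have "\<bar>h\<^sup>2 * (exp (- b) - exp (- 0))\<bar> \<le> h\<^sup>2 * (L * h)"
      unfolding abs_mult using exp_minus_diff_le[of b 0] b by (intro mult_mono) auto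
    ultimately show ?thesis by linarith
  qed
  also have "\<dots> \<le> (L + 1) * h ^ 3"
  proof -
    have "(h\<^sup>2)\<^sup>2 \<le> h ^ 3" using h by (simp flip: power_mult add: power_decreasing)
    then show ?thesis by (simp add: algebra_simps power2_eq_square power3_eq_cube)
  qed
  finally show "\<bar>strip_prob h j y - h\<^sup>2\<bar> \<le> (L + 1) * h ^ 3" .
qed

end

section \<open>Optimality and admissibility\<close>

locale poisson_threshold = poisson_sector M N + threshold c
  for M :: "'w measure" and N and c

context poisson_sector
begin

definition success :: "('w \<Rightarrow> ereal) \<Rightarrow> 'w set" where
  "success T = {w \<in> space M. \<exists>t x. T w = ereal t \<and> is_last_record (N w) (t, x)}"

definition stop_in :: "real \<Rightarrow> ('w \<Rightarrow> ereal) \<Rightarrow> nat \<Rightarrow> 'w set" where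
  "stop_in h T j = {w \<in> space M. T w \<le> ereal (real j * h) \<and> (j = 1 \<or> \<not> T w \<le> ereal (real (j - 1) * h))}"

lemma stop_in_history:
  assumes T: "stopping_time (history M N) T" and h: "0 < h" and j: "1 \<le> j"
  shows "stop_in h T j \<in> sets (strip_history h j)"
proof -
  have le: "{w \<in> space M. T w \<le> s} \<in> sets (history M N s)" for s
    using stopping_timeD[OF T, of s] by (simp add: Measurable.pred_def)
  have mono: "sets (history M N (ereal (real (j - 1) * h))) \<subseteq> sets (history M N (ereal (real j * h)))"
    using h by (intro history_mono) (auto intro!: mult_right_mono)
  have "stop_in h T j = {w \<in> space M. T w \<le> ereal (real j * h)} -
      (if j = 1 then {} else {w \<in> space M. T w \<le> ereal (real (j - 1) * h)})"
    by (auto simp: stop_in_def)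
  also have "\<dots> \<in> sets (history M N (ereal (real j * h)))"
    using le mono by auto
  finally show ?thesis using j by (simp add: strip_history_def)
qed

lemma stop_in_iff:
  assumes "0 < h" "0 \<le> t" "1 \<le> j" "w \<in> space M" "T w = ereal t"
  shows "w \<in> stop_in h T j \<longleftrightarrow> cell_index h t = j"
proof -
  have "w \<in> stop_in h T j \<longleftrightarrow> t \<in> cell_interval h j"
    using assms by (cases "j = 1") (auto simp: stop_in_def cell_interval_def)
  then show ?thesis using cell_interval_iff[OF assms(1-3)] by simp
qed

lemma stop_in_disjoint:
  assumes "0 < h" shows "disjoint_family_on (stop_in h T) {1..K}"
proof -
  have "stop_in h T i \<inter> stop_in h T j = {}" if "1 \<le> i" "i < j" for i j
  proof -
    have "real i * h \<le> real (j - 1) * h" using that assms by (intro mult_right_mono) auto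
    then have "T w \<le> ereal (real (j - 1) * h)" if "T w \<le> ereal (real i * h)" for w
      using that by (auto intro: order_trans)
    with that show ?thesis by (auto simp: stop_in_def)
  qed
  then show ?thesis
    by (rule disjoint_family_on_ordered)
qed

text \<open>
  If the chosen atom has the minimal mark, then its row is the lowest occupied row of the whole grid.
\<close>

lemma success_cases:
  assumes h: "0 < h" and w: "w \<in> success T"
  shows "w \<in> (\<Union>j\<in>{1..K}. stop_in h T j \<inter> slots.overall_min M (lowest_cell h K) K j) \<union>
    {w \<in> space M. \<forall>l\<in>{1..K}. Suc K \<le> lowest_cell h K l w}"
proof -
  interpret slots M "strip_history h" "lowest_cell h K" K "strip_prob h"
    by (rule lowest_cell_slots[OF h])
  obtain t x where tx: "T w = ereal t" "is_last_record (N w) (t, x)" and wM: "w \<in> space M"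
    using w by (auto simp: success_def)
  have p: "(t, x) \<in> N w" and min: "\<And>q. q \<in> N w \<Longrightarrow> x \<le> snd q"
    using tx(2) by (auto simp: is_last_record_def is_record_def)
  have t: "0 \<le> t" "t \<le> x" using atom_nonneg[OF wM p] by auto
  define j where "j = cell_index h t"
  define k where "k = cell_index h x"
  have jk: "1 \<le> j" "j \<le> k" using t h by (auto simp: j_def k_def cell_index_mono)
  have ge: "k \<le> cell_index h (snd q)" if "q \<in> N w" for q
    unfolding k_def using h min[OF that] by (rule cell_index_mono)
  show ?thesis
  proof (cases "k \<le> K")
    case True
    have "k \<le> lowest_cell h K l w" for l
      using ge True by (subst le_lowest_cell) auto
    moreover have "lowest_cell h K j w \<le> k"
      using lowest_cell_le[OF p, of h j K] by (simp add: j_def k_def)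
    ultimately have "w \<in> overall_min j"
      using wM True by (auto simp: overall_min_def intro: order_trans)
    moreover have "w \<in> stop_in h T j"
      using stop_in_iff[where T = T, OF h t(1) jk(1) wM tx(1)] by (simp add: j_def)
    moreover have "j \<in> {1..K}" using jk True by simp
    ultimately show ?thesis by blast
  next
    case False
    have "Suc K \<le> lowest_cell h K l w" for l
      using ge False by (subst le_lowest_cell) (auto simp: not_le Suc_le_eq intro: less_le_trans)
    with wM show ?thesis by blast
  qed
qed

end

lemma eventually_grid:
  assumes "0 < L"
  shows "\<forall>\<^sub>F n in sequentially. 0 < 1 / real n \<and> 1 / real n \<le> 1 \<and>
     real (nat \<lfloor>L * real n\<rfloor>) * (1 / real n) \<le> L \<and> L \<le> real (Suc (nat \<lfloor>L * real n\<rfloor>)) * (1 / real n)"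
  using eventually_ge_at_top[of 1]
proof eventually_elim
  case (elim n)
  have "real (nat \<lfloor>L * real n\<rfloor>) \<le> L * real n"
    using assms by (intro of_nat_floor) auto
  moreover have "L * real n \<le> real (Suc (nat \<lfloor>L * real n\<rfloor>))"
    using assms by (simp add: le_nat_iff) linarith
  ultimately show ?case using elim by (auto simp: field_simps)
qed

context poisson_threshold
begin

text \<open>
  The success event of an arbitrary strategy is covered by measurable events of the finite problem, for every
  grid.
\<close>

theorem success_le:
  assumes T: "admissible M N T"
    and le: "\<And>d. c \<le> d \<Longrightarrow> cont_value d \<le> value_inf" and nl: "(no_lower \<longlongrightarrow> 0) at_top"
  shows "success_prob M N T \<le> value_inf"
proof (rule field_le_epsilon)
  fix r :: real assume r: "0 < r"
  have "\<forall>\<^sub>F n :: nat in sequentially. success_prob M N T - value_inf < r"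
  proof (rule eventually_less_two_limits[OF _ nl _ r])
    show "(\<lambda>n. 1 / real n) \<longlonglongrightarrow> 0" by (rule lim_1_over_n)
    fix L assume L: "c \<le> L"
    then have L0: "0 < L" using c_pos by simp
    obtain B where B: "error_bound L (L + 1) B"
      using error_bound_exists[of "L + 1" L] L0 by auto
    have B0: "0 \<le> B" using B by (simp add: error_bound_def)
    have "\<forall>\<^sub>F n in sequentially. success_prob M N T - value_inf \<le> no_lower L + (L + 1) * B * (1 / real n)"
      using eventually_grid[OF L0]
    proof eventually_elim
      case (elim n)
      define h where "h = 1 / real n"
      define K where "K = nat \<lfloor>L * real n\<rfloor>"
      have h: "0 < h" "h \<le> 1" "real K * h \<le> L" "L \<le> real (Suc K) * h"
        using elim by (auto simp: h_def K_def simp del: of_nat_Suc)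
      interpret slots M "strip_history h" "lowest_cell h K" K "strip_prob h"
        by (rule lowest_cell_slots[OF h(1)])
      note sl = lowest_cell_slots[OF h(1), of K]
      note nu = strip_prob_near_uniform[OF h(1-3)]
      have A: "stop_in h T j \<in> sets (strip_history h j)" if "j \<in> {1..K}" for j
        using T that h by (intro stop_in_history) (auto simp: admissible_def)
      have "success_prob M N T = prob (success T)"
        by (simp add: success_prob_def success_def)
      also have "\<dots> \<le> (\<Sum>j=1..K. prob (stop_in h T j \<inter> overall_min j)) + prob {w \<in> space M. \<forall>l\<in>{1..K}. Suc K \<le> lowest_cell h K l w}"
        by (rule prob_le_stop_sum[OF A]) (assumption, intro AE_I2 impI success_cases[OF h(1)])
      also have "\<dots> \<le> (cont_value (real (Suc K) * h) + L * B * h) + (no_lower (real (Suc K) * h) + B * h)"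
        by (intro add_mono slots_upper[OF sl nu B A stop_in_disjoint[OF h(1)]] slots_no_low[OF sl nu B])
      also have "\<dots> \<le> (value_inf + L * B * h) + (no_lower L + B * h)"
        using h L L0 by (intro add_mono le no_lower_mono) (auto simp del: of_nat_Suc)
      finally show ?case by (simp add: h_def[symmetric] algebra_simps)
    qed
    then show "\<exists>D. \<forall>\<^sub>F n in sequentially. success_prob M N T - value_inf \<le> no_lower L + D * (1 / real n)" by blast
  qed
  then obtain n :: nat where "success_prob M N T - value_inf < r"
    by (auto simp: eventually_sequentially)
  then show "success_prob M N T \<le> value_inf + r" by simp
qed

end

context poisson_sector
begin

text \<open>
  Before the time of any candidate there are only finitely many others, since \<open>x \<le> t + c\<close> confines them to a
  bounded box.
\<close>

lemma first_record_below_cases: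
  assumes w: "w \<in> space M"
  shows "first_record_below c (N w) = \<infinity> \<and> (\<forall>t x. is_record (N w) (t, x) \<longrightarrow> \<not> x \<le> t + c) \<or>
    (\<exists>t x. first_record_below c (N w) = ereal t \<and> is_record (N w) (t, x) \<and> x \<le> t + c)"
proof (cases "\<exists>t x. is_record (N w) (t, x) \<and> x \<le> t + c")
  case False
  then have e: "{ereal t | t x. is_record (N w) (t, x) \<and> x \<le> t + c} = {}" by auto
  have "first_record_below c (N w) = \<infinity>"
    unfolding first_record_below_def e by (simp add: top_ereal_def)
  with False show ?thesis by blast
next
  case True
  then obtain t0 x0 where r0: "is_record (N w) (t0, x0)" "x0 \<le> t0 + c" by auto
  define D where "D = {p \<in> N w. is_record (N w) p \<and> snd p \<le> fst p + c \<and> fst p \<le> t0}"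
  have "D \<subseteq> N w \<inter> ({0..t0} \<times> {0..t0 + c})"
    using atom_nonneg[OF w] by (fastforce simp: D_def)
  moreover have "finite (N w \<inter> ({0..t0} \<times> {0..t0 + c}))"
    by (rule N_finite[OF w]) (intro bounded_Times bounded_closed_interval)
  ultimately have fin: "finite D" by (rule finite_subset)
  have D0: "(t0, x0) \<in> D" using r0 by (auto simp: D_def is_record_def)
  define m where "m = Min (fst ` D)"
  have "m \<in> fst ` D" unfolding m_def using fin D0 by (intro Min_in) auto
  then obtain p where p: "p \<in> D" "fst p = m" by auto
  have mle: "m \<le> fst q" if "q \<in> D" for q unfolding m_def using fin that by (intro Min_le) auto
  have "Inf {ereal t | t x. is_record (N w) (t, x) \<and> x \<le> t + c} = ereal m"
  proof (rule antisym)
    show "Inf {ereal t | t x. is_record (N w) (t, x) \<and> x \<le> t + c} \<le> ereal m"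
      using p by (intro Inf_lower) (auto simp: D_def intro!: exI[of _ m] exI[of _ "snd p"])
    show "ereal m \<le> Inf {ereal t | t x. is_record (N w) (t, x) \<and> x \<le> t + c}"
    proof (rule Inf_greatest)
      fix s assume "s \<in> {ereal t | t x. is_record (N w) (t, x) \<and> x \<le> t + c}"
      then obtain t x where tx: "s = ereal t" "is_record (N w) (t, x)" "x \<le> t + c" by auto
      have "m \<le> t"
      proof (cases "t \<le> t0")
        case True
        then show ?thesis using mle[of "(t, x)"] tx by (auto simp: D_def is_record_def)
      next
        case False
        then show ?thesis using mle[OF D0] by simp
      qed
      then show "ereal m \<le> s" using tx by simp
    qed
  qed
  then show ?thesis
    using p by (auto simp: first_record_below_def D_def intro!: exI[of _ m] exI[of _ "snd p"])
qed

lemma first_record_below_lower: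
  "is_record A (t, x) \<Longrightarrow> x \<le> t + c \<Longrightarrow> first_record_below c A \<le> ereal t"
  unfolding first_record_below_def by (intro Inf_lower) blast

definition early_box :: "real \<Rightarrow> real \<Rightarrow> real \<Rightarrow> (real \<times> real) set" where
  "early_box s a b = {0..min s a} \<times> {0..b}"

lemma early_box_borel [simp]: "early_box s a b \<in> sets borel"
  unfolding early_box_def by (intro borel_closed closed_Times) auto

lemma bounded_early_box [simp]: "bounded (early_box s a b)"
  unfolding early_box_def by (intro bounded_Times) auto

text \<open>
  Records are detected by countably many counts: a record is the only atom in a slightly larger rational box.
  The time coordinate of the box is cut at \<open>s\<close>, so all counts belong to the history at \<open>s\<close>.
\<close>

lemma record_by_iff:
  assumes w: "w \<in> space M"
  shows "(\<exists>t x. is_record (N w) (t, x) \<and> x \<le> t + c \<and> t \<le> s) \<longleftrightarrow>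
    (\<exists>a\<in>\<rat>. \<exists>b\<in>\<rat>. card (N w \<inter> early_box s a b) = 1 \<and> 1 \<le> card (N w \<inter> (early_box s a b \<inter> {(t, x). x \<le> t + c})))"
    (is "?L \<longleftrightarrow> ?R")
proof
  assume ?R
  then obtain a b where ab: "card (N w \<inter> early_box s a b) = 1"
    "1 \<le> card (N w \<inter> (early_box s a b \<inter> {(t, x). x \<le> t + c}))" by auto
  then have "N w \<inter> (early_box s a b \<inter> {(t, x). x \<le> t + c}) \<noteq> {}" by force
  then obtain t x where tx: "(t, x) \<in> N w" "(t, x) \<in> early_box s a b" "x \<le> t + c" by auto
  obtain z where z: "N w \<inter> early_box s a b = {z}"
    using ab(1) by (rule card_1_singletonE)
  have one: "q = (t, x)" if "q \<in> N w" "q \<in> early_box s a b" for q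
  proof -
    have "q \<in> {z}" unfolding z[symmetric] using that by simp
    moreover have "(t, x) \<in> {z}" unfolding z[symmetric] using tx by simp
    ultimately show ?thesis by simp
  qed
  have "is_record (N w) (t, x)"
    unfolding is_record_def
  proof (intro conjI ballI impI)
    fix q assume "q \<in> N w" "q \<in> {0..fst (t, x)} \<times> {0..snd (t, x)}"
    then show "q = (t, x)" using tx by (intro one) (auto simp: early_box_def)
  qed (rule tx)
  moreover have "t \<le> s" using tx by (auto simp: early_box_def)
  ultimately show ?L using tx by blast
next
  assume ?L
  then obtain t x where tx: "is_record (N w) (t, x)" "x \<le> t + c" "t \<le> s" by auto
  have p: "(t, x) \<in> N w" "0 \<le> t" "0 \<le> x"
    using tx(1) atom_nonneg[OF w, of "(t, x)"] by (auto simp: is_record_def)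
  define Q where "Q = N w \<inter> ({0..t + 1} \<times> {0..x + 1})"
  have fin: "finite Q"
    unfolding Q_def by (rule N_finite[OF w]) (intro bounded_Times bounded_closed_interval)
  define a' where "a' = Min (insert (t + 1) {u \<in> fst ` Q. t < u})"
  define b' where "b' = Min (insert (x + 1) {u \<in> snd ` Q. x < u})"
  have a': "t < a'" "a' \<le> t + 1" "\<And>q. q \<in> Q \<Longrightarrow> t < fst q \<Longrightarrow> a' \<le> fst q"
    unfolding a'_def using fin by (auto simp: Min_gr_iff intro!: Min_le)
  have b': "x < b'" "b' \<le> x + 1" "\<And>q. q \<in> Q \<Longrightarrow> x < snd q \<Longrightarrow> b' \<le> snd q"
    unfolding b'_def using fin by (auto simp: Min_gr_iff intro!: Min_le)
  obtain a where a: "a \<in> \<rat>" "t < a" "a < a'" using Rats_dense_in_real[OF a'(1)] by auto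
  obtain b where b: "b \<in> \<rat>" "x < b" "b < b'" using Rats_dense_in_real[OF b'(1)] by auto
  have "N w \<inter> early_box s a b = {(t, x)}"
  proof (intro equalityI subsetI)
    fix q assume q: "q \<in> N w \<inter> early_box s a b"
    then have qQ: "q \<in> Q" using a b a'(2) b'(2) by (auto simp: Q_def early_box_def)
    have fs: "fst q \<le> a" "snd q \<le> b" using q by (auto simp: early_box_def)
    have "fst q \<le> t"
    proof (rule ccontr)
      assume "\<not> fst q \<le> t"
      then have "a' \<le> fst q" by (intro a'(3) qQ) simp
      with fs a(3) show False by simp
    qed
    moreover have "snd q \<le> x"
    proof (rule ccontr)
      assume "\<not> snd q \<le> x"
      then have "b' \<le> snd q" by (intro b'(3) qQ) simp
      with fs b(3) show False by simp
    qed
    ultimately have "q = (t, x)"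
      using tx(1) q by (auto simp: is_record_def early_box_def)
    then show "q \<in> {(t, x)}" by simp
  qed (use p tx a b in \<open>auto simp: early_box_def\<close>)
  moreover from this have "N w \<inter> (early_box s a b \<inter> {(t, x). x \<le> t + c}) = {(t, x)}"
    using tx(2) by blast
  ultimately show ?R using a(1) b(1) by (intro bexI[of _ a] bexI[of _ b]) simp_all
qed

lemma strip_closed: "{(t :: real, x). x \<le> t + c} \<in> sets borel"
proof -
  have "{(t :: real, x). x \<le> t + c} = {p. snd p \<le> fst p + c}" by auto
  also have "\<dots> \<in> sets borel"
    by (intro borel_closed closed_Collect_le continuous_intros)
  finally show ?thesis .
qed

lemma first_record_below_stopping: "stopping_time (history M N) (\<lambda>w. first_record_below c (N w))"
proof
  fix s :: ereal
  let ?T = "\<lambda>w. first_record_below c (N w)"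
  have "{w \<in> space M. ?T w \<le> s} \<in> sets (history M N s)"
  proof (cases s)
    case PInf
    then have "{w \<in> space M. ?T w \<le> s} = space (history M N s)" by simp
    then show ?thesis by (simp only: sets.top)
  next
    case MInf
    have "\<not> ?T w \<le> -\<infinity>" if "w \<in> space M" for w
      using first_record_below_cases[OF that, of c] by auto
    with MInf have "{w \<in> space M. ?T w \<le> s} = {}" by auto
    then show ?thesis by (simp only: sets.empty_sets)
  next
    case (real r)
    have iff: "?T w \<le> ereal r \<longleftrightarrow> (\<exists>t x. is_record (N w) (t, x) \<and> x \<le> t + c \<and> t \<le> r)" if wM: "w \<in> space M" for w
    proof
      assume le: "?T w \<le> ereal r"
      then have "?T w \<noteq> \<infinity>" by auto
      then obtain t x where "?T w = ereal t" "is_record (N w) (t, x)" "x \<le> t + c"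
        using first_record_below_cases[OF wM, of c] by blast
      with le show "\<exists>t x. is_record (N w) (t, x) \<and> x \<le> t + c \<and> t \<le> r"
        by (metis ereal_less_eq(3))
    next
      assume "\<exists>t x. is_record (N w) (t, x) \<and> x \<le> t + c \<and> t \<le> r"
      then obtain t x where "is_record (N w) (t, x)" "x \<le> t + c" "t \<le> r" by blast
      then show "?T w \<le> ereal r"
        using first_record_below_lower[of "N w" t x c] by (auto intro: order_trans)
    qed
    have sub: "early_box r a b \<subseteq> {(t, x). 0 \<le> t \<and> ereal t \<le> ereal r}" for a b
      by (auto simp: early_box_def)
    have b1: "{w \<in> space M. card (N w \<inter> early_box r a b) = 1} \<in> sets (history M N (ereal r))" for a b
      by (rule count_history[where P = "\<lambda>n. n = 1"]) (use sub in auto)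
    have b2: "{w \<in> space M. 1 \<le> card (N w \<inter> (early_box r a b \<inter> {(t, x). x \<le> t + c}))} \<in> sets (history M N (ereal r))" for a b
    proof (rule count_history[where P = "\<lambda>n. 1 \<le> n"])
      show "bounded (early_box r a b \<inter> {(t, x). x \<le> t + c})"
        by (rule bounded_subset[OF bounded_early_box]) auto
      show "early_box r a b \<inter> {(t, x). x \<le> t + c} \<in> sets borel"
        by (intro sets.Int early_box_borel strip_closed)
    qed (use sub[of a b] in auto)
    have "{w \<in> space M. ?T w \<le> s} = (\<Union>a\<in>\<rat>. \<Union>b\<in>\<rat>. {w \<in> space M. card (N w \<inter> early_box r a b) = 1} \<inter>
        {w \<in> space M. 1 \<le> card (N w \<inter> (early_box r a b \<inter> {(t, x). x \<le> t + c}))})"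
    proof (intro set_eqI)
      fix w
      show "w \<in> {w \<in> space M. ?T w \<le> s} \<longleftrightarrow> w \<in> (\<Union>a\<in>\<rat>. \<Union>b\<in>\<rat>. {w \<in> space M. card (N w \<inter> early_box r a b) = 1} \<inter>
        {w \<in> space M. 1 \<le> card (N w \<inter> (early_box r a b \<inter> {(t, x). x \<le> t + c}))})"
      proof (cases "w \<in> space M")
        case True
        then show ?thesis unfolding mem_Collect_eq real iff[OF True] record_by_iff[OF True] by blast
      qed blast
    qed
    also have "\<dots> \<in> sets (history M N s)"
      unfolding real by (intro sets.countable_UN'' countable_rat sets.Int b1 b2)
    finally show ?thesis .
  qed
  then show "Measurable.pred (history M N s) (\<lambda>w. ?T w \<le> s)"
    by (simp add: Measurable.pred_def)
qed

lemma first_record_below_admissible: "admissible M N (\<lambda>w. first_record_below c (N w))"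
  unfolding admissible_def
proof (intro conjI ballI first_record_below_stopping)
  fix w assume "w \<in> space M"
  then show "first_record_below c (N w) \<in> ereal ` record_times (N w) \<union> {\<infinity>}"
    using first_record_below_cases[of w c] by (auto simp: record_times_def)
qed

text \<open>
  The success event compares the stopping time with this variable, which reduces its measurability to that of two
  extended-real random variables.
\<close>

definition last_record_time :: "(real \<times> real) set \<Rightarrow> ereal" where
  "last_record_time A = Inf {ereal t | t x. is_last_record A (t, x)}"

lemma last_record_unique:
  assumes w: "w \<in> space M" and p: "is_last_record (N w) p" and q: "is_last_record (N w) q"
  shows "p = q"
proof -
  have m: "p \<in> N w" "q \<in> N w" "snd p = snd q"
    using p q by (auto simp: is_last_record_def is_record_def intro: antisym)
  have nn: "0 \<le> fst p" "0 \<le> fst q" "0 \<le> snd p"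
    using atom_nonneg[OF w m(1)] atom_nonneg[OF w m(2)] by auto
  show ?thesis
  proof (cases "fst p \<le> fst q")
    case True
    then have "p \<in> {0..fst q} \<times> {0..snd q}" using m nn by (auto simp: mem_Times_iff)
    then show ?thesis using q m(1) by (auto simp: is_last_record_def is_record_def)
  next
    case False
    then have "q \<in> {0..fst p} \<times> {0..snd p}" using m nn by (auto simp: mem_Times_iff)
    then show ?thesis using p m(2) by (auto simp: is_last_record_def is_record_def)
  qed
qed

lemma last_record_time_eq:
  assumes "w \<in> space M" "is_last_record (N w) (t, x)"
  shows "last_record_time (N w) = ereal t"
proof -
  have "{ereal t | t x. is_last_record (N w) (t, x)} = {ereal t}"
    using assms last_record_unique[OF assms(1,2)] by auto
  then show ?thesis by (simp add: last_record_time_def)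
qed

lemma last_record_exists:
  assumes w: "w \<in> space M" and ne: "N w \<noteq> {}"
  shows "\<exists>p. is_last_record (N w) p"
proof -
  obtain p0 where p0: "p0 \<in> N w" using ne by auto
  define Q where "Q = N w \<inter> ({0..snd p0} \<times> {0..snd p0})"
  have fin: "finite Q"
    unfolding Q_def by (rule N_finite[OF w]) (intro bounded_Times bounded_closed_interval)
  have inQ: "q \<in> Q" if "q \<in> N w" "snd q \<le> snd p0" for q
    using atom_nonneg[OF w that(1)] that by (auto simp: Q_def mem_Times_iff)
  define x where "x = Min (snd ` Q)"
  have "p0 \<in> Q" using p0 by (intro inQ) auto
  then have xin: "x \<in> snd ` Q" unfolding x_def using fin by (intro Min_in) auto
  have xle: "x \<le> snd q" if "q \<in> N w" for q
  proof (cases "snd q \<le> snd p0")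
    case True
    then show ?thesis unfolding x_def using fin inQ[OF that] by (intro Min_le) auto
  next
    case False
    have "x \<le> snd p0" unfolding x_def using fin \<open>p0 \<in> Q\<close> by (intro Min_le) auto
    with False show ?thesis by simp
  qed
  define R where "R = {q \<in> Q. snd q = x}"
  have "finite R" "R \<noteq> {}" using fin xin by (auto simp: R_def)
  define t where "t = Min (fst ` R)"
  have "t \<in> fst ` R" unfolding t_def using \<open>finite R\<close> \<open>R \<noteq> {}\<close> by (intro Min_in) auto
  then have tx: "(t, x) \<in> N w" by (auto simp: R_def Q_def)
  have tle: "t \<le> fst q" if "q \<in> N w" "snd q = x" for q
  proof -
    have "q \<in> Q" using that xle[OF p0] by (intro inQ) auto
    then show ?thesis unfolding t_def using \<open>finite R\<close> that by (intro Min_le) (auto simp: R_def)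
  qed
  have "is_last_record (N w) (t, x)"
    unfolding is_last_record_def is_record_def
  proof (intro conjI ballI impI tx)
    fix q assume q: "q \<in> N w" "q \<in> {0..fst (t, x)} \<times> {0..snd (t, x)}"
    then have "snd q = x" using xle[OF q(1)] by auto
    then show "q = (t, x)" using tle[OF q(1)] q by (auto simp: prod_eq_iff)
  qed (use xle in auto)
  then show ?thesis by blast
qed

definition mark_box :: "real \<Rightarrow> (real \<times> real) set" where
  "mark_box b = {0..b} \<times> {0..b}"

text \<open>
  A rational level slightly above the minimal mark isolates the atoms that carry it.
\<close>

lemma last_record_time_le_iff:
  assumes w: "w \<in> space M"
  shows "last_record_time (N w) \<le> ereal s \<longleftrightarrow>
    (\<exists>b\<in>\<rat>. 1 \<le> card (N w \<inter> mark_box b)) \<and>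
    (\<forall>b\<in>\<rat>. 1 \<le> card (N w \<inter> mark_box b) \<longrightarrow> 1 \<le> card (N w \<inter> early_box s b b))"
proof -
  have c1: "1 \<le> card (N w \<inter> B) \<longleftrightarrow> N w \<inter> B \<noteq> {}" if "bounded B" for B
    using N_finite[OF w that] by (simp add: Suc_le_eq card_gt_0_iff)
  have bm: "bounded (mark_box b)" for b
    unfolding mark_box_def by (intro bounded_Times bounded_closed_interval)
  have inbox: "q \<in> mark_box b" if "q \<in> N w" "snd q \<le> b" for q b
    using atom_nonneg[OF w that(1)] that by (auto simp: mark_box_def mem_Times_iff)
  show ?thesis
  proof (cases "N w = {}")
    case True
    then have "last_record_time (N w) = \<infinity>"
      by (simp add: last_record_time_def is_last_record_def is_record_def top_ereal_def)
    with True show ?thesis by simp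
  next
    case False
    then obtain t x where p: "is_last_record (N w) (t, x)"
      using last_record_exists[OF w] by (metis surj_pair)
    have pN: "(t, x) \<in> N w" and min: "\<And>q. q \<in> N w \<Longrightarrow> x \<le> snd q"
      and rec: "\<And>q. q \<in> N w \<Longrightarrow> q \<in> {0..t} \<times> {0..x} \<Longrightarrow> q = (t, x)"
      using p by (auto simp: is_last_record_def is_record_def)
    have nn: "0 \<le> t" "t \<le> x" using atom_nonneg[OF w pN] by auto
    have "t \<le> s \<longleftrightarrow> (\<exists>b\<in>\<rat>. N w \<inter> mark_box b \<noteq> {}) \<and>
        (\<forall>b\<in>\<rat>. N w \<inter> mark_box b \<noteq> {} \<longrightarrow> N w \<inter> early_box s b b \<noteq> {})"
    proof
      assume ts: "t \<le> s"
      obtain b where "b \<in> \<rat>" "x < b" using Rats_dense_in_real[of x "x + 1"] by auto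
      then have "b \<in> \<rat>" "(t, x) \<in> N w \<inter> mark_box b" using pN inbox[OF pN, of b] by auto
      moreover have "(t, x) \<in> N w \<inter> early_box s b b" if ne: "N w \<inter> mark_box b \<noteq> {}" for b
      proof -
        obtain q where q: "q \<in> N w" "q \<in> mark_box b" using ne by blast
        then have "snd q \<le> b" by (auto simp: mark_box_def)
        with q have "x \<le> b" using min[of q] by simp
        then show ?thesis using pN nn ts by (auto simp: early_box_def)
      qed
      ultimately show "(\<exists>b\<in>\<rat>. N w \<inter> mark_box b \<noteq> {}) \<and>
        (\<forall>b\<in>\<rat>. N w \<inter> mark_box b \<noteq> {} \<longrightarrow> N w \<inter> early_box s b b \<noteq> {})" by blast
    next
      assume *: "(\<exists>b\<in>\<rat>. N w \<inter> mark_box b \<noteq> {}) \<and>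
        (\<forall>b\<in>\<rat>. N w \<inter> mark_box b \<noteq> {} \<longrightarrow> N w \<inter> early_box s b b \<noteq> {})"
      define Q where "Q = N w \<inter> mark_box (x + 1)"
      have fin: "finite Q" unfolding Q_def by (rule N_finite[OF w bm])
      define b' where "b' = Min (insert (x + 1) {u \<in> snd ` Q. x < u})"
      have b': "x < b'" "b' \<le> x + 1" "\<And>q. q \<in> Q \<Longrightarrow> x < snd q \<Longrightarrow> b' \<le> snd q"
        unfolding b'_def using fin by (auto simp: Min_gr_iff intro!: Min_le)
      obtain b where b: "b \<in> \<rat>" "x < b" "b < b'" using Rats_dense_in_real[OF b'(1)] by auto
      have "N w \<inter> mark_box b \<noteq> {}" using pN inbox[OF pN, of b] b by auto
      with * b(1) have "N w \<inter> early_box s b b \<noteq> {}" by blast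
      then obtain q where q: "q \<in> N w" "q \<in> early_box s b b" by auto
      have "snd q \<le> b" using q by (auto simp: early_box_def)
      then have "q \<in> Q" unfolding Q_def using q(1) b b' inbox[OF q(1), of "x + 1"] by auto
      then have "snd q = x" using b'(3)[of q] min[OF q(1)] \<open>snd q \<le> b\<close> b by force
      have "t \<le> fst q"
      proof (rule ccontr)
        assume "\<not> t \<le> fst q"
        then have "q = (t, x)"
          using atom_nonneg[OF w q(1)] \<open>snd q = x\<close> nn by (intro rec q(1)) (auto simp: mem_Times_iff)
        with \<open>\<not> t \<le> fst q\<close> show False by simp
      qed
      also have "fst q \<le> s" using q by (auto simp: early_box_def)
      finally show "t \<le> s" .
    qed
    then show ?thesis
      unfolding last_record_time_eq[OF w p] c1[OF bm] c1[OF bounded_early_box] by simp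
  qed
qed

lemma last_record_time_measurable: "(\<lambda>w. last_record_time (N w)) \<in> borel_measurable M"
proof (rule borel_measurableI_le)
  fix s :: ereal
  show "{w \<in> space M. last_record_time (N w) \<le> s} \<in> events"
  proof (cases s)
    case MInf
    have "\<not> last_record_time (N w) \<le> -\<infinity>" if wM: "w \<in> space M" for w
    proof (cases "N w = {}")
      case True
      then show ?thesis by (simp add: last_record_time_def is_last_record_def is_record_def top_ereal_def)
    next
      case False
      then obtain t x where "is_last_record (N w) (t, x)"
        using last_record_exists[OF wM] by (metis surj_pair)
      then show ?thesis using last_record_time_eq[OF wM] by simp
    qed
    with MInf have "{w \<in> space M. last_record_time (N w) \<le> s} = {}" by auto
    then show ?thesis by (simp only: sets.empty_sets)
  next
    case (real r)
    have m: "{w \<in> space M. 1 \<le> card (N w \<inter> mark_box b)} \<in> events" for b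
      by (rule count_events[where P = "\<lambda>n. 1 \<le> n"])
        (auto simp: mark_box_def intro!: borel_closed closed_Times bounded_Times)
    have e: "{w \<in> space M. 1 \<le> card (N w \<inter> early_box r b b)} \<in> events" for b
      by (rule count_events[where P = "\<lambda>n. 1 \<le> n"]) auto
    have "{w \<in> space M. last_record_time (N w) \<le> s} =
       (\<Union>b\<in>\<rat>. {w \<in> space M. 1 \<le> card (N w \<inter> mark_box b)}) \<inter>
       (\<Inter>b\<in>\<rat>. (space M - {w \<in> space M. 1 \<le> card (N w \<inter> mark_box b)}) \<union> {w \<in> space M. 1 \<le> card (N w \<inter> early_box r b b)})"
    proof (intro set_eqI)
      fix w
      show "w \<in> {w \<in> space M. last_record_time (N w) \<le> s} \<longleftrightarrow>
        w \<in> (\<Union>b\<in>\<rat>. {w \<in> space M. 1 \<le> card (N w \<inter> mark_box b)}) \<inter>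
       (\<Inter>b\<in>\<rat>. (space M - {w \<in> space M. 1 \<le> card (N w \<inter> mark_box b)}) \<union> {w \<in> space M. 1 \<le> card (N w \<inter> early_box r b b)})"
      proof (cases "w \<in> space M")
        case True
        then show ?thesis unfolding mem_Collect_eq real last_record_time_le_iff[OF True] by blast
      qed blast
    qed
    also have "\<dots> \<in> events"
    proof (intro sets.Int sets.countable_UN'' sets.countable_INT' image_subsetI countable_rat sets.Un sets.Diff sets.top m e)
      show "(\<rat> :: real set) \<noteq> {}" using Rats_0 by blast
    qed
    finally show ?thesis .
  qed simp
qed

lemma success_events:
  assumes T: "admissible M N T" shows "success T \<in> events"
proof -
  have [measurable]: "T \<in> borel_measurable M"
    using T history_events by (intro measurable_stopping_time[of "history M N"]) (auto simp: admissible_def)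
  note last_record_time_measurable[measurable]
  have "success T = {w \<in> space M. T w = last_record_time (N w) \<and> last_record_time (N w) \<noteq> \<infinity>}"
  proof (intro set_eqI iffI)
    fix w assume "w \<in> success T"
    then show "w \<in> {w \<in> space M. T w = last_record_time (N w) \<and> last_record_time (N w) \<noteq> \<infinity>}"
      using last_record_time_eq[of w] by (auto simp: success_def)
  next
    fix w assume w: "w \<in> {w \<in> space M. T w = last_record_time (N w) \<and> last_record_time (N w) \<noteq> \<infinity>}"
    have "\<exists>t x. is_last_record (N w) (t, x)"
    proof (rule ccontr)
      assume "\<nexists>t x. is_last_record (N w) (t, x)"
      then have e: "{ereal t | t x. is_last_record (N w) (t, x)} = {}" by auto
      have "last_record_time (N w) = \<infinity>"
        unfolding last_record_time_def e by (simp add: top_ereal_def)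
      with w show False by simp
    qed
    then obtain t x where "is_last_record (N w) (t, x)" by blast
    with w show "w \<in> success T"
      using last_record_time_eq[of w t x] by (auto simp: success_def)
  qed
  also have "\<dots> \<in> events" by measurable
  finally show ?thesis .
qed

end

section \<open>The value of the threshold strategy\<close>

context poisson_sector
begin

definition row_strip :: "real \<Rightarrow> nat \<Rightarrow> nat \<Rightarrow> (real \<times> real) set" where
  "row_strip h K k = {0..real K * h} \<times> cell_interval h k"

definition column_strip :: "real \<Rightarrow> nat \<Rightarrow> nat \<Rightarrow> (real \<times> real) set" where
  "column_strip h K j = cell_interval h j \<times> {0..real K * h}"

definition boundary_cells :: "real \<Rightarrow> nat \<Rightarrow> nat \<Rightarrow> (real \<times> real) set" where
  "boundary_cells h q j = cell_interval h j \<times> {(real j + real q - 2) * h..(real j + real q + 2) * h}"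

definition low_square :: "real \<Rightarrow> (real \<times> real) set" where
  "low_square m = {0..m / 2} \<times> {m / 2..m}"

text \<open>
  The configurations on which cells and atoms may disagree: two atoms share a row or a column, an atom lies in a
  cell near the line \<open>x = t + c\<close>, or no mark is at most \<open>m\<close>. The square \<open>low_square m\<close> stands in for the triangle of
  marks below \<open>m\<close>, as it lies in the sector and its area also grows quadratically.
\<close>

definition irregular :: "real \<Rightarrow> nat \<Rightarrow> nat \<Rightarrow> real \<Rightarrow> 'w set" where
  "irregular h K q m =
     (\<Union>k\<in>{1..K}. {w \<in> space M. 2 \<le> card (N w \<inter> row_strip h K k)}) \<union>
     (\<Union>j\<in>{1..K}. {w \<in> space M. 2 \<le> card (N w \<inter> column_strip h K j)}) \<union>
     (\<Union>j\<in>{1..K}. {w \<in> space M. 1 \<le> card (N w \<inter> boundary_cells h q j)}) \<union>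
     {w \<in> space M. card (N w \<inter> low_square m) = 0}"

lemma strips_borel [simp]:
  "row_strip h K k \<in> sets borel" "column_strip h K j \<in> sets borel" "boundary_cells h q j \<in> sets borel"
  "low_square m \<in> sets borel"
  by (auto simp: row_strip_def column_strip_def boundary_cells_def low_square_def intro!: borel_Times)

lemma bounded_strips [simp]:
  "bounded (row_strip h K k)" "bounded (column_strip h K j)" "bounded (boundary_cells h q j)"
  "bounded (low_square m)"
  by (auto simp: row_strip_def column_strip_def boundary_cells_def low_square_def intro!: bounded_Times)

lemma irregular_part_events:
  "{w \<in> space M. 2 \<le> card (N w \<inter> row_strip h K k)} \<in> events"
  "{w \<in> space M. 2 \<le> card (N w \<inter> column_strip h K k)} \<in> events"
  "{w \<in> space M. 1 \<le> card (N w \<inter> boundary_cells h q k)} \<in> events"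
  "{w \<in> space M. card (N w \<inter> low_square m) = 0} \<in> events"
  by (rule count_events[where P = "\<lambda>n. 2 \<le> n"] count_events[where P = "\<lambda>n. 1 \<le> n"]
      count_events[where P = "\<lambda>n. n = 0"]; simp)+

lemma irregular_events: "irregular h K q m \<in> events"
  unfolding irregular_def by (intro sets.Un sets.finite_UN irregular_part_events) auto

lemma prob_UN_le:
  assumes "\<And>k. k \<in> {1..K} \<Longrightarrow> A k \<in> events" "\<And>k. k \<in> {1..K} \<Longrightarrow> prob (A k) \<le> b"
  shows "prob (\<Union>k\<in>{1..K}. A k) \<le> real K * b"
proof -
  have "prob (\<Union>k\<in>{1..K}. A k) \<le> (\<Sum>k\<in>{1..K}. prob (A k))"
    using assms by (intro finite_measure_subadditive_finite) auto
  also have "\<dots> \<le> (\<Sum>k\<in>{1..K}. b)" using assms by (intro sum_mono) auto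
  finally show ?thesis by simp
qed

text \<open>
  Two atoms in one strip of area \<open>O(h)\<close> have probability \<open>O(h\<^sup>2)\<close>, and there are \<open>O(1/h)\<close> strips.
\<close>

lemma prob_irregular:
  assumes h: "0 < h" and K: "real K * h \<le> L" and m: "0 \<le> m"
  shows "prob (irregular h K q m) \<le> (2 * L ^ 3 + 4 * L) * h + exp (- (m\<^sup>2 / 4))"
proof -
  have L: "0 \<le> L" using K h by (auto intro: order_trans[of _ "real K * h"])
  have sq: "real K * (L * h)\<^sup>2 \<le> L ^ 3 * h"
  proof -
    have "real K * (L * h)\<^sup>2 = (real K * h) * (L\<^sup>2 * h)" by (simp add: power2_eq_square)
    also have "\<dots> \<le> L * (L\<^sup>2 * h)" using K h by (intro mult_right_mono) auto
    finally show ?thesis by (simp add: power2_eq_square power3_eq_cube)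
  qed
  have r: "prob {w \<in> space M. 2 \<le> card (N w \<inter> row_strip h K k)} \<le> (L * h)\<^sup>2" if "k \<in> {1..K}" for k
  proof -
    have "area (row_strip h K k) \<le> measure lborel {0..real K * h} * measure lborel (cell_interval h k)"
      by (rule area_le) (auto simp: row_strip_def intro!: borel_Times)
    also have "\<dots> = (real K * h) * h" using h that by (simp add: measure_cell_interval)
    also have "\<dots> \<le> L * h" using h K by (intro mult_right_mono) auto
    finally have "(area (row_strip h K k))\<^sup>2 \<le> (L * h)\<^sup>2"
      using area_nonneg by (intro power_mono) auto
    then show ?thesis using prob_count_ge2[of "row_strip h K k"] by simp
  qed
  have c: "prob {w \<in> space M. 2 \<le> card (N w \<inter> column_strip h K j)} \<le> (L * h)\<^sup>2" if "j \<in> {1..K}" for j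
  proof -
    have "area (column_strip h K j) \<le> measure lborel (cell_interval h j) * measure lborel {0..real K * h}"
      by (rule area_le) (auto simp: column_strip_def intro!: borel_Times)
    also have "\<dots> = h * (real K * h)" using h that by (simp add: measure_cell_interval)
    also have "\<dots> \<le> L * h" using mult_right_mono[OF K, of h] h by (simp add: mult.commute)
    finally have "(area (column_strip h K j))\<^sup>2 \<le> (L * h)\<^sup>2"
      using area_nonneg by (intro power_mono) auto
    then show ?thesis using prob_count_ge2[of "column_strip h K j"] by simp
  qed
  have b: "prob {w \<in> space M. 1 \<le> card (N w \<inter> boundary_cells h q j)} \<le> 4 * h\<^sup>2" if "j \<in> {1..K}" for j
  proof -
    have "area (boundary_cells h q j) \<le> measure lborel (cell_interval h j)
        * measure lborel {(real j + real q - 2) * h..(real j + real q + 2) * h}"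
      by (rule area_le) (auto simp: boundary_cells_def intro!: borel_Times)
    also have "\<dots> = h * (4 * h)"
      using h that by (simp add: measure_cell_interval mult_right_mono left_diff_distrib[symmetric])
    finally show ?thesis
      using prob_count_ge1[of "boundary_cells h q j"] by (simp add: power2_eq_square)
  qed
  have z: "prob {w \<in> space M. card (N w \<inter> low_square m) = 0} = exp (- (m\<^sup>2 / 4))"
  proof -
    have "low_square m \<subseteq> sector" by (auto simp: low_square_def sector_def)
    then have "area (low_square m) = measure lborel (low_square m)"
      by (simp add: area_def Int_absorb2)
    also have "\<dots> = m\<^sup>2 / 4"
      unfolding low_square_def using m by (subst measure_lborel_Times) (auto simp: power2_eq_square)
    finally show ?thesis using prob_empty[of "low_square m"] by simp
  qed
  note ev = irregular_part_events
  let ?R = "\<Union>k\<in>{1..K}. {w \<in> space M. 2 \<le> card (N w \<inter> row_strip h K k)}"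
  let ?C = "\<Union>j\<in>{1..K}. {w \<in> space M. 2 \<le> card (N w \<inter> column_strip h K j)}"
  let ?B = "\<Union>j\<in>{1..K}. {w \<in> space M. 1 \<le> card (N w \<inter> boundary_cells h q j)}"
  let ?Z = "{w \<in> space M. card (N w \<inter> low_square m) = 0}"
  have E: "?R \<in> events" "?C \<in> events" "?B \<in> events" using ev by auto
  have "prob (irregular h K q m) \<le> prob (?R \<union> ?C \<union> ?B) + prob ?Z"
    unfolding irregular_def using E ev by (intro measure_Un_le) auto
  also have "prob (?R \<union> ?C \<union> ?B) \<le> prob (?R \<union> ?C) + prob ?B"
    using E by (intro measure_Un_le) auto
  also have "prob (?R \<union> ?C) \<le> prob ?R + prob ?C"
    using E by (intro measure_Un_le) auto
  also have "prob ?R \<le> real K * (L * h)\<^sup>2" by (intro prob_UN_le ev r)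
  also have "prob ?C \<le> real K * (L * h)\<^sup>2" by (intro prob_UN_le ev c)
  also have "prob ?B \<le> real K * (4 * h\<^sup>2)" by (intro prob_UN_le ev b)
  finally have "prob (irregular h K q m) \<le>
      real K * (L * h)\<^sup>2 + real K * (L * h)\<^sup>2 + real K * (4 * h\<^sup>2) + exp (- (m\<^sup>2 / 4))"
    using z by simp
  moreover have "real K * (4 * h\<^sup>2) \<le> 4 * L * h"
    using mult_right_mono[OF K, of "4 * h"] h by (simp add: power2_eq_square mult_ac)
  ultimately show ?thesis using sq by (simp add: algebra_simps)
qed

lemma count_le_1_eq:
  assumes "w \<in> space M" "bounded B" "\<not> 2 \<le> card (N w \<inter> B)"
    and "p \<in> N w" "p \<in> B" "p' \<in> N w" "p' \<in> B"
  shows "p = p'"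
proof (rule ccontr)
  assume "p \<noteq> p'"
  have "card {p, p'} \<le> card (N w \<inter> B)"
    using assms N_finite[OF assms(1,2)] by (intro card_mono) auto
  with \<open>p \<noteq> p'\<close> assms(3) show False by simp
qed

text \<open>
  The atom found by the cutoff rule has the minimal mark because its row is lowest and contains no other atom. It
  is the first record below the line: an earlier record below the line would, being far from the line, be
  within the cutoff in its own column, and the cutoff rule would have chosen that column already. The bound
  \<open>x \<le> m = K * h - c\<close> guarantees that such a record would have a mark below \<open>K * h\<close> and hence be visible to the grid.
\<close>

lemma cutoff_success:
  assumes h: "0 < h" and q: "real q * h \<le> c" "c < (real q + 1) * h" and m: "m = real K * h - c"
    and w: "w \<notin> irregular h K q m" and j: "j \<in> {1..K}"
    and stop: "w \<in> slots.cutoff_stop M (lowest_cell h K) K q j"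
    and omin: "w \<in> slots.overall_min M (lowest_cell h K) K j"
  shows "w \<in> success (\<lambda>w. first_record_below c (N w))"
proof -
  interpret slots M "strip_history h" "lowest_cell h K" K "strip_prob h"
    by (rule lowest_cell_slots[OF h])
  let ?Y = "lowest_cell h K"
  let ?i = "cell_index h"
  have wM: "w \<in> space M" using omin by (simp add: overall_min_def)
  define k where "k = ?Y j w"
  have kK: "k \<le> K" and kmin: "\<And>l. l \<in> {1..K} \<Longrightarrow> k \<le> ?Y l w"
    using omin by (auto simp: overall_min_def k_def)
  have kq: "k \<le> j + q" using stop by (simp add: cutoff_stop_def k_def)
  obtain t x where p: "(t, x) \<in> N w" "?i t = j" "?i x = k"
    using lowest_cell_attained[of h K j w] kK unfolding k_def by auto
  have tx: "0 \<le> t" "t \<le> x" "0 \<le> x" using atom_nonneg[OF wM p(1)] by auto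
  have k1: "1 \<le> k" using p(3) cell_index_ge_1(1)[of h x] by simp
  have j1: "1 \<le> j" "j \<le> K" using j by auto
  have xk: "x \<le> real k * h" using cell_index_le_iff[OF h k1, of x] p(3) by simp
  have kKh: "real k * h \<le> real K * h" using kK h by (intro mult_right_mono) auto
  have nn: "0 \<le> fst p'" "fst p' \<le> snd p'" "0 \<le> snd p'" if "p' \<in> N w" for p'
    using atom_nonneg[OF wM that] by auto
  have ge: "k \<le> ?i (snd p')" if "p' \<in> N w" for p'
  proof (cases "?i (snd p') \<le> K")
    case True
    have "?i (fst p') \<le> ?i (snd p')" using nn(2)[OF that] h by (intro cell_index_mono)
    with True have "?i (fst p') \<in> {1..K}" by simp
    from kmin[OF this] lowest_cell_le[OF that refl, of h K] show ?thesis by simp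
  qed (use kK in simp)
  have row: "\<not> 2 \<le> card (N w \<inter> row_strip h K k)"
    using w wM k1 kK by (auto simp: irregular_def)
  have in_row: "p' \<in> row_strip h K k" if "p' \<in> N w" "?i (snd p') = k" for p'
  proof -
    have "snd p' \<le> real k * h" using cell_index_le_iff[OF h k1, of "snd p'"] that by simp
    then show ?thesis
      using nn[OF that(1)] kKh cell_interval_iff[OF h, of "snd p'" k] k1 that
      by (auto simp: row_strip_def mem_Times_iff)
  qed
  have gt: "x < snd p'" if "p' \<in> N w" "p' \<noteq> (t, x)" for p'
  proof -
    have "?i (snd p') \<noteq> k"
      using count_le_1_eq[OF wM bounded_strips(1) row that(1) _ p(1)] in_row[OF that(1)] in_row[OF p(1)] p(3) that(2)
      by auto
    with ge[OF that(1)] have "?i x < ?i (snd p')" using p(3) by simp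
    then show ?thesis using cell_index_mono[OF h, of "snd p'" x] by (force simp: not_less[symmetric])
  qed
  have last: "is_last_record (N w) (t, x)"
    unfolding is_last_record_def is_record_def
  proof (intro conjI ballI impI p(1))
    fix p' assume p': "p' \<in> N w"
    show "p' = (t, x)" if "p' \<in> {0..fst (t, x)} \<times> {0..snd (t, x)}"
      using gt[OF p'] that by (force simp: mem_Times_iff)
    show "snd (t, x) \<le> snd p'" using gt[OF p'] by (cases "p' = (t, x)") auto
  qed
  have band: "p' \<notin> boundary_cells h q i" if "p' \<in> N w" "i \<in> {1..K}" for p' i
  proof
    assume "p' \<in> boundary_cells h q i"
    then have "N w \<inter> boundary_cells h q i \<noteq> {}" using that by auto
    then have "1 \<le> card (N w \<inter> boundary_cells h q i)"
      using N_finite[OF wM bounded_strips(3)] by (simp add: Suc_le_eq card_gt_0_iff)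
    with w wM that show False unfolding irregular_def by blast
  qed
  \<comment> \<open>the atom avoids the cells near the line, so the cutoff puts it well below\<close>
  have xq: "x < (real j + real q - 2) * h"
  proof -
    have "x \<le> (real j + real q + 2) * h"
    proof -
      have "real k * h \<le> (real j + real q + 2) * h" using kq h by (intro mult_right_mono) auto
      with xk show ?thesis by linarith
    qed
    moreover have "t \<in> cell_interval h j" using cell_interval_iff[OF h tx(1) j1(1)] p(2) by simp
    ultimately show ?thesis using band[OF p(1) j] by (auto simp: boundary_cells_def not_le)
  qed
  have xc: "x \<le> t + c"
  proof -
    have "t \<in> cell_interval h j" using cell_interval_iff[OF h tx(1) j1(1)] p(2) by simp
    then have "real (j - 1) * h \<le> t" by (rule cell_interval_bounds(2)[OF h j1(1)])
    then have "(real j - 1) * h \<le> t" using j1 by (simp add: of_nat_diff)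
    moreover have "(real j + real q - 2) * h = (real j - 1) * h + real q * h - h" by (simp add: algebra_simps)
    ultimately show ?thesis using xq q h by linarith
  qed
  have xm: "x \<le> m"
  proof -
    have "card (N w \<inter> low_square m) \<noteq> 0" using w wM by (auto simp: irregular_def)
    then have "N w \<inter> low_square m \<noteq> {}" by auto
    then obtain p' where "p' \<in> N w" "snd p' \<le> m" by (auto simp: low_square_def)
    then show ?thesis using gt[of p'] by (cases "p' = (t, x)") auto
  qed
  have first: "t \<le> s" if sy: "is_record (N w) (s, y)" "y \<le> s + c" for s y
  proof (rule ccontr)
    assume "\<not> t \<le> s"
    then have st: "s < t" by simp
    have syN: "(s, y) \<in> N w" using sy(1) by (simp add: is_record_def)
    have synn: "0 \<le> s" "s \<le> y" "0 \<le> y" using nn[OF syN] by auto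
    have yK: "y \<le> real K * h" using sy(2) st tx(2) xm m by linarith
    define i where "i = ?i s"
    have ij: "1 \<le> i" "i \<le> j" using cell_index_mono[OF h, of s t] st p(2) by (auto simp: i_def)
    then have iK: "i \<in> {1..K}" using j by auto
    have s_in: "s \<in> cell_interval h i"
      using cell_interval_iff[OF h synn(1) ij(1)] by (simp add: i_def)
    have sle: "s \<le> real i * h" by (rule cell_interval_bounds(3)[OF h ij(1) s_in])
    have yq: "y < (real i + real q - 2) * h"
    proof -
      have "(real i + real q + 2) * h = real i * h + (real q + 1) * h + h" by (simp add: algebra_simps)
      then have "y \<le> (real i + real q + 2) * h" using sy(2) sle q h by linarith
      then show ?thesis using band[OF syN iK] s_in by (auto simp: boundary_cells_def not_le)
    qed
    have iy: "?i y \<le> i + q"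
    proof -
      have "(real i + real q - 2) * h \<le> real (i + q) * h" using h by (intro mult_right_mono) auto
      with yq have "y \<le> real (i + q) * h" by linarith
      then show ?thesis using cell_index_le_iff[OF h, of "i + q" y] ij by simp
    qed
    have iyK: "?i y \<le> K" using cell_index_le_iff[OF h, of K y] yK j by auto
    have Yi: "?Y i w \<le> ?i y" using lowest_cell_le[OF syN, of h i K] by (simp add: i_def)
    show False
    proof (cases "i = j")
      case True
      have col: "\<not> 2 \<le> card (N w \<inter> column_strip h K j)"
        using w wM j by (auto simp: irregular_def)
      have "t \<in> cell_interval h j" using cell_interval_iff[OF h tx(1) j1(1)] p(2) by simp
      then have "(t, x) \<in> column_strip h K j" "(s, y) \<in> column_strip h K j"
        using True s_in synn yK tx xk kKh by (auto simp: column_strip_def)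
      then have "(t, x) = (s, y)"
        by (rule count_le_1_eq[OF wM bounded_strips(2) col p(1) _ syN])
      with st show False by simp
    next
      case False
      with ij have "i \<le> j - 1" by simp
      then have "w \<in> cutoff_wait q i"
        using stop cutoff_wait_antimono[of i "j - 1" q] by (auto simp: cutoff_stop_def)
      moreover obtain i' where i': "i = Suc i'" using ij by (cases i) auto
      ultimately have "\<not> (?Y i w \<le> min (running_min i' w) K \<and> ?Y i w \<le> i + q)"
        by simp
      moreover have "?Y i w \<le> running_min i' w"
        unfolding le_running_min
      proof (intro conjI ballI)
        show "?Y i w \<le> Suc K" using Yi iyK by simp
        fix l assume l: "l \<in> {1..i'}"
        have "?i y \<le> ?Y l w"
        proof (subst le_lowest_cell, use iyK in simp, intro ballI impI)
          fix p' assume p': "p' \<in> N w" "?i (fst p') = l"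
          have "\<not> s \<le> fst p'"
            using cell_index_mono[OF h, of s "fst p'"] p' l i' by (auto simp: i_def)
          then have "fst p' < s" by simp
          then have "\<not> snd p' \<le> y"
            using sy(1) p'(1) nn[OF p'(1)] by (auto simp: is_record_def mem_Times_iff)
          then show "?i y \<le> ?i (snd p')" using h by (intro cell_index_mono) auto
        qed
        with Yi show "?Y i w \<le> ?Y l w" by simp
      qed
      ultimately show False using Yi iyK iy by auto
    qed
  qed
  have "first_record_below c (N w) = ereal t"
  proof (rule antisym)
    show "first_record_below c (N w) \<le> ereal t"
      using last xc by (intro first_record_below_lower) (auto simp: is_last_record_def)
    show "ereal t \<le> first_record_below c (N w)"
      unfolding first_record_below_def using first by (intro Inf_greatest) auto
  qed
  with last wM show ?thesis by (auto simp: success_def)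
qed

end

context poisson_threshold
begin

theorem success_ge:
  assumes lim: "(cont_value \<longlongrightarrow> value_inf) at_top"
  shows "value_inf \<le> success_prob M N (\<lambda>w. first_record_below c (N w))"
proof (rule field_le_epsilon)
  let ?T = "\<lambda>w. first_record_below c (N w)"
  fix r :: real assume r: "0 < r"
  have "\<forall>\<^sub>F n :: nat in sequentially. value_inf - success_prob M N ?T < r"
  proof (rule eventually_less_two_limits[OF _ _ _ r])
    show "(\<lambda>n. 1 / real n) \<longlonglongrightarrow> 0" by (rule lim_1_over_n)
    have "filterlim (\<lambda>L. (L - 1 - c)\<^sup>2 / 4) at_top at_top"
    proof -
      have "filterlim (\<lambda>L. - (1 + c) + L) at_top at_top"
        by (rule filterlim_tendsto_add_at_top[OF tendsto_const filterlim_ident])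
      moreover have "(\<lambda>L. - (1 + c) + L) = (\<lambda>L. L - 1 - c)" by (rule ext) simp
      ultimately have "filterlim (\<lambda>L. L - 1 - c) at_top at_top"
        by (simp only:)
      then have "filterlim (\<lambda>L. (L - 1 - c)\<^sup>2) at_top at_top"
        by (intro filterlim_pow_at_top) auto
      then have "filterlim (\<lambda>L. 1 / 4 * (L - 1 - c)\<^sup>2) at_top at_top"
        by (intro filterlim_tendsto_pos_mult_at_top[OF tendsto_const]) auto
      then show ?thesis by simp
    qed
    then have "((\<lambda>L. exp (- ((L - 1 - c)\<^sup>2 / 4))) \<longlongrightarrow> 0) at_top"
      by (intro filterlim_compose[OF exp_at_bot]) (simp add: filterlim_uminus_at_top)
    then show "((\<lambda>L. value_inf - cont_value L + exp (- ((L - 1 - c)\<^sup>2 / 4))) \<longlongrightarrow> 0) at_top"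
      using tendsto_add[OF tendsto_diff[OF tendsto_const[of value_inf] lim]] by fastforce
    fix L assume L: "c + 1 \<le> L"
    then have L0: "0 < L" "c \<le> L" using c_pos by auto
    obtain B where B: "error_bound L (L + 1) B"
      using error_bound_exists[of "L + 1" L] L0 by auto
    have B0: "0 \<le> B" using B by (simp add: error_bound_def)
    have "\<forall>\<^sub>F n in sequentially. value_inf - success_prob M N ?T \<le>
        (value_inf - cont_value L + exp (- ((L - 1 - c)\<^sup>2 / 4))) + ((L + 1) * B + 2 * L ^ 3 + 4 * L) * (1 / real n)"
      using eventually_grid[OF L0(1)]
    proof eventually_elim
      case (elim n)
      define h where "h = 1 / real n"
      define K where "K = nat \<lfloor>L * real n\<rfloor>"
      have h: "0 < h" "h \<le> 1" "real K * h \<le> L" "L \<le> real (Suc K) * h"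
        using elim by (auto simp: h_def K_def simp del: of_nat_Suc)
      interpret slots M "strip_history h" "lowest_cell h K" K "strip_prob h"
        by (rule lowest_cell_slots[OF h(1)])
      note sl = lowest_cell_slots[OF h(1), of K]
      note nu = strip_prob_near_uniform[OF h(1-3)]
      define m where "m = real K * h - c"
      have m: "L - 1 - c \<le> m" "0 \<le> m"
        using h L by (auto simp: m_def distrib_right)
      let ?q = "cutoff_cells h"
      have q: "real ?q * h \<le> c" "c < (real ?q + 1) * h"
        using le_cutoff_cells[OF h(1), of ?q] le_cutoff_cells[OF h(1), of "Suc ?q"] by (auto simp: add.commute)
      have "cont_value L - (L + 1) * B * h \<le> cont_value (real (Suc K) * h) - (L + 1) * B * h"
        using cont_value_mono_above[OF L0(2) h(4)] by simp
      also have "\<dots> \<le> (\<Sum>j=1..K. prob (cutoff_stop ?q j \<inter> overall_min j))"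
        by (rule slots_lower[OF sl nu B])
      also have "\<dots> \<le> prob (success ?T) + prob (irregular h K ?q m)"
      proof (rule stop_sum_le_prob[OF success_events[OF first_record_below_admissible] irregular_events])
        show "AE w in M. w \<notin> irregular h K ?q m \<longrightarrow>
            w \<in> (\<Union>j\<in>{1..K}. cutoff_stop ?q j \<inter> overall_min j) \<longrightarrow> w \<in> success ?T"
          using cutoff_success[OF h(1) q m_def] by (intro AE_I2 impI) blast
      qed
      also have "prob (irregular h K ?q m) \<le> (2 * L ^ 3 + 4 * L) * h + exp (- (m\<^sup>2 / 4))"
        by (rule prob_irregular[OF h(1,3) m(2)])
      also have "exp (- (m\<^sup>2 / 4)) \<le> exp (- ((L - 1 - c)\<^sup>2 / 4))"
        using m L by (auto intro!: power_mono)
      finally have "cont_value L - (L + 1) * B * h \<le>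
          prob (success ?T) + ((2 * L ^ 3 + 4 * L) * h + exp (- ((L - 1 - c)\<^sup>2 / 4)))" by simp
      moreover have "success_prob M N ?T = prob (success ?T)"
        by (simp add: success_prob_def success_def)
      ultimately show ?case by (simp add: h_def[symmetric] algebra_simps)
    qed
    then show "\<exists>D. \<forall>\<^sub>F n in sequentially. value_inf - success_prob M N ?T \<le>
        (value_inf - cont_value L + exp (- ((L - 1 - c)\<^sup>2 / 4))) + D * (1 / real n)" by blast
  qed
  then obtain n :: nat where "value_inf - success_prob M N ?T < r"
    by (auto simp: eventually_sequentially)
  then show "value_inf \<le> success_prob M N ?T + r" by simp
qed

end

section \<open>The theorem\<close>

theorem mainTheorem5:
  shows "(\<exists>!z. solves_beta z)
    \<and> 0.760660 \<le> beta_star \<and> beta_star < 0.760661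
    \<and> (\<forall>(M :: 'w measure) N. unit_poisson_process M sector N \<longrightarrow>
         admissible M N (\<lambda>w. first_record_below (sqrt (2 * beta_star)) (N w))
         \<and> (\<forall>T. admissible M N T \<longrightarrow>
              success_prob M N T \<le>
              success_prob M N (\<lambda>w. first_record_below (sqrt (2 * beta_star)) (N w)))
         \<and> success_prob M N (\<lambda>w. first_record_below (sqrt (2 * beta_star)) (N w)) = optimal_value)
    \<and> 0.703128 \<le> optimal_value \<and> optimal_value < 0.703129
    \<and> (\<forall>(P :: nat \<Rightarrow> 'b measure) X. (\<forall>n\<ge>1. triangular_model (P n) n (X n)) \<longrightarrow>
         (\<lambda>n. best_choice_value (P n) n (X n)) \<longlonglongrightarrow> optimal_value)"
proof (intro conjI allI impI)
  show "\<exists>!z. solves_beta z" by (rule ex1_solves_beta)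
  show "0.760660 \<le> beta_star" "beta_star < 0.760661"
    using beta_star_bounds by auto
  show "0.703128 \<le> optimal_value" "optimal_value < 0.703129"
    by (rule optimal_value_bounds)+
next
  fix M :: "'w measure" and N assume "unit_poisson_process M sector N"
  then interpret poisson_threshold M N "sqrt (2 * beta_star)"
    by (intro poisson_threshold.intro poisson_sector.intro opt.threshold_axioms)
  let ?T = "\<lambda>w. first_record_below (sqrt (2 * beta_star)) (N w)"
  have le: "success_prob M N T \<le> optimal_value" if "admissible M N T" for T
    unfolding optimal_value_eq using that opt.cont_value_le_inf no_lower_tendsto by (rule success_le)
  have eq: "success_prob M N ?T = optimal_value"
    using le[OF first_record_below_admissible] success_ge[OF opt.cont_value_tendsto]
    unfolding optimal_value_eq by (rule antisym)
  show "admissible M N ?T" by (rule first_record_below_admissible)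
  show "success_prob M N ?T = optimal_value" by (rule eq)
  show "success_prob M N T \<le> success_prob M N ?T" if "admissible M N T" for T
    unfolding eq by (rule le[OF that])
next
  fix P :: "nat \<Rightarrow> 'b measure" and X
  assume "\<forall>n\<ge>1. triangular_model (P n) n (X n)"
  then show "(\<lambda>n. best_choice_value (P n) n (X n)) \<longlonglongrightarrow> optimal_value"
    unfolding optimal_value_eq
    by (intro opt.triangular_limit opt.cont_value_tendsto opt.cont_value_le_inf no_lower_tendsto) auto
qed

end
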